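(* For every simple matroid $M$ on a finite ground set, the Chow ring $\underline{\mathrm{CH}}(M)$ has a Koszul filtration.
   Context: Let $M$ be a simple matroid (no loops, no parallel elements) on a finite set $E$. The Chow ring of $M$ is the quotient ring $$\underline{\mathrm{CH}}(M) = \mathbb{Q}[x_F \mid F \text{ a nonempty flat of } M]\,/\,(\underline{I}_M + \underline{J}_M),$$ where $\underline{I}_M = \left(\sum_{F \ni i} x_F \mid i \in E\right)$ (for each $i$, the sum is over all flats $F$ containing $i$) and $\underline{J}_M = (x_F x_G \mid F, G \text{ incomparable nonempty flats of } M)$. It is graded with every $x_F$ in degree $1$. Let $R = \bigoplus_{i \ge 0} R_i$ be a standard graded algebra over a field $\mathbb{K} = R_0$ (commutative, finitely generated over $\mathbb{K}$ by elements of degree one), and $R_+ = \bigoplus_{i\ge1} R_i$. A family $\mathcal{F}$ of ideals of $R$ is a Koszul filtration of $R$ if: (1) every ideal $I \in \mathcal{F}$ is generated by linear forms (elements of $R_1$); (2) the ideals $(0)$ and $R_+$ are in $\mathcal{F}$; (3) for every nonzero $I \in \mathcal{F}$ there exists $J \in \mathcal{F}$ such that $J \subsetneq I$, $I/J$ is cyclic, and $(J : I) \in \mathcal{F}$. *)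

theory Defs
  imports "HOL-Library.Poly_Mapping" "HOL-Algebra.Generated_Rings"
begin

section \<open>Matroids\<close>

locale matroid =
  fixes E :: "'a set" and indep :: "'a set \<Rightarrow> bool"
  assumes finite_ground: "finite E"
    and indep_subset_ground: "indep X \<Longrightarrow> X \<subseteq> E"
    and indep_empty: "indep {}"
    and indep_mono: "indep X \<Longrightarrow> Y \<subseteq> X \<Longrightarrow> indep Y"
    and augmentation: "indep X \<Longrightarrow> indep Y \<Longrightarrow> card X < card Y \<Longrightarrow> \<exists>e\<in>Y - X. indep (insert e X)"
begin

definition rank :: "'a set \<Rightarrow> nat" where
  "rank X = Max {card I | I. I \<subseteq> X \<and> indep I}"

definition flat :: "'a set \<Rightarrow> bool" where
  "flat F \<longleftrightarrow> F \<subseteq> E \<and> (\<forall>e\<in>E - F. rank F < rank (insert e F))"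

definition loop :: "'a \<Rightarrow> bool" where
  "loop e \<longleftrightarrow> e \<in> E \<and> \<not> indep {e}"

definition parallel :: "'a \<Rightarrow> 'a \<Rightarrow> bool" where
  "parallel e f \<longleftrightarrow> e \<in> E \<and> f \<in> E \<and> e \<noteq> f \<and> \<not> loop e \<and> \<not> loop f \<and> \<not> indep {e, f}"

definition nonempty_flats :: "'a set set" where
  "nonempty_flats = {F. flat F \<and> F \<noteq> {}}"

end

locale simple_matroid = matroid +
  assumes no_loops: "\<not> loop e"
    and no_parallel: "\<not> parallel e f"


section \<open>Polynomial rings\<close>

text \<open>
  A monomial is a finitely supported exponent vector, and a polynomial a finitely supported
  family of coefficients indexed by monomials. The operations of the type class are those of
  the polynomial ring in all variables of type \<^typ>\<open>'v\<close>; the carrier restricts the variables to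
  \<^term>\<open>V\<close>.
\<close>

definition mpoly_ring :: "'v set \<Rightarrow> (('v \<Rightarrow>\<^sub>0 nat) \<Rightarrow>\<^sub>0 'k::comm_ring_1) ring" where
  "mpoly_ring V =
    \<lparr>carrier = {p. \<forall>m\<in>Poly_Mapping.keys p. Poly_Mapping.keys m \<subseteq> V},
     mult = (*), one = 1, zero = 0, add = (+)\<rparr>"

definition mpoly_var :: "'v \<Rightarrow> ('v \<Rightarrow>\<^sub>0 nat) \<Rightarrow>\<^sub>0 'k::comm_ring_1" where
  "mpoly_var v = Poly_Mapping.single (Poly_Mapping.single v 1) 1"

definition monom_degree :: "('v \<Rightarrow>\<^sub>0 nat) \<Rightarrow> nat" where
  "monom_degree m = (\<Sum>v\<in>Poly_Mapping.keys m. Poly_Mapping.lookup m v)"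

definition mpoly_homogeneous ::
    "'v set \<Rightarrow> nat \<Rightarrow> (('v \<Rightarrow>\<^sub>0 nat) \<Rightarrow>\<^sub>0 'k::comm_ring_1) set" where
  "mpoly_homogeneous V d =
    {p \<in> carrier (mpoly_ring V). \<forall>m\<in>Poly_Mapping.keys p. monom_degree m = d}"


section \<open>The Chow ring of a matroid\<close>

type_synonym 'a chow_poly = "('a set \<Rightarrow>\<^sub>0 nat) \<Rightarrow>\<^sub>0 rat"

context matroid
begin

definition chow_poly_ring :: "'a chow_poly ring" where
  "chow_poly_ring = mpoly_ring nonempty_flats"

definition chow_linear_ideal :: "'a chow_poly set" where
  "chow_linear_ideal =
    genideal chow_poly_ring {(\<Sum>F\<in>{F \<in> nonempty_flats. i \<in> F}. mpoly_var F) | i. i \<in> E}"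

definition chow_quadratic_ideal :: "'a chow_poly set" where
  "chow_quadratic_ideal =
    genideal chow_poly_ring
      {mpoly_var F * mpoly_var G | F G.
        F \<in> nonempty_flats \<and> G \<in> nonempty_flats \<and> \<not> F \<subseteq> G \<and> \<not> G \<subseteq> F}"

definition chow_ideal :: "'a chow_poly set" where
  "chow_ideal = chow_linear_ideal <+>\<^bsub>chow_poly_ring\<^esub> chow_quadratic_ideal"

definition chow_ring :: "'a chow_poly set ring" where
  "chow_ring = chow_poly_ring Quot chow_ideal"

definition chow_grading :: "nat \<Rightarrow> 'a chow_poly set set" where
  "chow_grading d = (\<lambda>p. chow_ideal +>\<^bsub>chow_poly_ring\<^esub> p) ` mpoly_homogeneous nonempty_flats d"

end


section \<open>Standard graded algebras and Koszul filtrations\<close>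

text \<open>
  \<^term>\<open>A i\<close> is the graded component of degree \<^term>\<open>i\<close>. The base field is the subfield
  \<^term>\<open>A 0\<close> of \<^term>\<open>R\<close>, and \<^term>\<open>homogeneous_decomposition R A x f\<close> says that the
  finitely supported family \<^term>\<open>f\<close> is a decomposition of \<^term>\<open>x\<close> into homogeneous components.
\<close>

definition homogeneous_decomposition ::
    "('r, 'm) ring_scheme \<Rightarrow> (nat \<Rightarrow> 'r set) \<Rightarrow> 'r \<Rightarrow> (nat \<Rightarrow> 'r) \<Rightarrow> bool" where
  "homogeneous_decomposition R A x f \<longleftrightarrow>
    (\<forall>i. f i \<in> A i) \<and> finite {i. f i \<noteq> \<zero>\<^bsub>R\<^esub>} \<and> x = (\<Oplus>\<^bsub>R\<^esub>i\<in>{i. f i \<noteq> \<zero>\<^bsub>R\<^esub>}. f i)"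

locale standard_graded_algebra = cring R for R (structure) +
  fixes A :: "nat \<Rightarrow> 'a set"
  assumes base_subfield: "subfield (A 0) R"
    and component_subgroup: "additive_subgroup (A i) R"
    and component_mult: "x \<in> A i \<Longrightarrow> y \<in> A j \<Longrightarrow> x \<otimes> y \<in> A (i + j)"
    and direct_sum: "x \<in> carrier R \<Longrightarrow> \<exists>!f. homogeneous_decomposition R A x f"
    and standard: "\<exists>X. finite X \<and> X \<subseteq> A 1 \<and> carrier R = generate_ring R (A 0 \<union> X)"

definition irrelevant_ideal :: "('r, 'm) ring_scheme \<Rightarrow> (nat \<Rightarrow> 'r set) \<Rightarrow> 'r set" where
  "irrelevant_ideal R A =
    {x \<in> carrier R. \<exists>f. homogeneous_decomposition R A x f \<and> f 0 = \<zero>\<^bsub>R\<^esub>}"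

definition colon_ideal :: "('r, 'm) ring_scheme \<Rightarrow> 'r set \<Rightarrow> 'r set \<Rightarrow> 'r set" where
  "colon_ideal R J I = {r \<in> carrier R. \<forall>x\<in>I. r \<otimes>\<^bsub>R\<^esub> x \<in> J}"

text \<open>For ideals \<^term>\<open>J \<subseteq> I\<close>, the \<^term>\<open>R\<close>-module \<^term>\<open>I\<close> modulo \<^term>\<open>J\<close> is generated by one coset.\<close>

definition cyclic_quotient :: "('r, 'm) ring_scheme \<Rightarrow> 'r set \<Rightarrow> 'r set \<Rightarrow> bool" where
  "cyclic_quotient R I J \<longleftrightarrow>
    (\<exists>a\<in>I. \<forall>x\<in>I. \<exists>r\<in>carrier R. J +>\<^bsub>R\<^esub> x = J +>\<^bsub>R\<^esub> (r \<otimes>\<^bsub>R\<^esub> a))"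

locale koszul_filtration = standard_graded_algebra +
  fixes \<F> :: "'a set set"
  assumes linearly_generated: "I \<in> \<F> \<Longrightarrow> \<exists>L \<subseteq> A 1. I = Idl L"
    and zero_mem: "{\<zero>} \<in> \<F>"
    and irrelevant_mem: "irrelevant_ideal R A \<in> \<F>"
    and filtration_step: "I \<in> \<F> \<Longrightarrow> I \<noteq> {\<zero>} \<Longrightarrow>
      \<exists>J\<in>\<F>. J \<subset> I \<and> cyclic_quotient R I J \<and> colon_ideal R J I \<in> \<F>"

end

theory Submission
  imports Defs
begin

text \<open>
  All ideals of the filtration are generated by variables of flats; put \<^term>\<open>x {} = 1\<close>. For a flat
  \<^term>\<open>G\<close> and \<^term>\<open>A \<subseteq> G\<close> let \<^term>\<open>C G A\<close> be the ideal generated by the \<^term>\<open>x K\<close> for which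
  \<^term>\<open>K\<close> is not contained in \<^term>\<open>G\<close>, or is covered by \<^term>\<open>G\<close> and contains \<^term>\<open>A\<close>. Adjoin
  the variables of the flats rank by rank from the top. Within one rank, first adjoin the flats
  containing a large set and shrink this set one element at a time: when the flats containing
  \<^term>\<open>insert m A\<close> are present and \<^term>\<open>G\<close> contains \<^term>\<open>A\<close> but not \<^term>\<open>m\<close>, adjoining
  \<^term>\<open>x G\<close> has colon ideal \<^term>\<open>C G A\<close>. Every \<^term>\<open>C G A\<close> is itself reached from zero by such
  steps.

  That the colon ideal is not larger rests on a form of Poincare duality: to a flat \<^term>\<open>F\<close> one
  attaches monomials \<^term>\<open>w\<close> such that \<^term>\<open>r * x F ^ n * w = 0\<close> only if \<^term>\<open>r\<close> lies in the ideal
  of the variables of the flats that are not contained in \<^term>\<open>F\<close> or have corank at most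
  \<^term>\<open>n\<close> in \<^term>\<open>F\<close>. The induction, on the rank of \<^term>\<open>F\<close> and downwards on \<^term>\<open>n\<close>, starts from
  the nonvanishing of the product of a complete flag. This is detected by a degree functional:
  polynomials act on balanced weights on flags, and the weight that is one on all complete flags
  is balanced.
\<close>

section \<open>Flats of a matroid\<close>

text \<open>For \<open>n < rk F\<close>, dividing by the variables of \<open>killed n F\<close>
  turns the Chow ring of the matroid into that of the n-fold truncation of its restriction to
  \<open>F\<close>: restriction removes the flats not contained in \<open>F\<close>, truncation
  those of corank at most \<open>n\<close> below \<open>F\<close>. The duality statement thus says
  that the principal ideal of \<open>x F ^ n * w\<close> is a copy of this smaller Chow ring; it
  takes the place of a monomial basis. The two bounds for a colon ideal constrain the order of
  adjunction. To see that \<open>x K * x G\<close> lies in the ideal for a coatom \<open>K\<close>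
  of \<open>G\<close>, linear relations are applied until only adjoined variables remain; the flat
  spanned by \<open>K\<close> and \<open>m\<close> must then be present. This is why the set
  \<open>A\<close> shrinks by a single element \<open>m\<close>. For the opposite bound,
  multiplication by a multiplier of \<open>G\<close> turns the question into one about annihilators.
  Flats of equal rank are incomparable, so a linear combination of their variables can be tested one
  flat at a time, which always leads to a smaller flat; this keeps the inductions running.\<close>

context matroid
begin

lemma indep_finite: "indep I \<Longrightarrow> finite I"
  using finite_ground finite_subset indep_subset_ground by blast

lemma finite_indep_cards: "finite {card I | I. I \<subseteq> X \<and> indep I}"
proof -
  have "{card I | I. I \<subseteq> X \<and> indep I} \<subseteq> card ` Pow E"
    using indep_subset_ground by blast
  thus ?thesis
    using finite_ground finite_subset by blast
qed

lemma card_le_rank: "I \<subseteq> X \<Longrightarrow> indep I \<Longrightarrow> card I \<le> rank X"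
  unfolding rank_def using finite_indep_cards by (intro Max_ge) auto

lemma obtain_basis:
  obtains I where "I \<subseteq> X" "indep I" "card I = rank X"
proof -
  have "rank X \<in> {card I | I. I \<subseteq> X \<and> indep I}"
    unfolding rank_def using finite_indep_cards indep_empty by (intro Max_in) auto
  thus ?thesis
    using that by auto
qed

lemma rank_mono: "X \<subseteq> Y \<Longrightarrow> rank X \<le> rank Y"
proof -
  assume sub: "X \<subseteq> Y"
  obtain I where "I \<subseteq> X" "indep I" "card I = rank X"
    by (rule obtain_basis)
  thus ?thesis
    using sub card_le_rank[of I Y] by simp
qed

lemma rank_empty [simp]: "rank {} = 0"
proof -
  obtain I where "I \<subseteq> {}" "indep I" "card I = rank {}"
    by (rule obtain_basis)
  thus ?thesis
    by simp
qed

lemma rank_insert_le: "rank (insert e X) \<le> Suc (rank X)"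
proof -
  obtain I where I: "I \<subseteq> insert e X" "indep I" "card I = rank (insert e X)"
    using obtain_basis by blast
  have "card (I - {e}) \<le> rank X"
    using I indep_mono by (intro card_le_rank) auto
  thus ?thesis
    using I(3) diff_card_le_card_Diff[of "{e}" I] by simp
qed

lemma extend_to_basis:
  assumes "I \<subseteq> X" "indep I"
  obtains J where "I \<subseteq> J" "J \<subseteq> X" "indep J" "card J = rank X"
proof -
  have "\<exists>J. I \<subseteq> J \<and> J \<subseteq> X \<and> indep J \<and> card J = rank X"
    using assms
  proof (induction "rank X - card I" arbitrary: I)
    case 0
    thus ?case
      using card_le_rank[of I X] by (metis diff_is_0_eq le_antisym order_refl)
  next
    case (Suc n)
    obtain B where B: "B \<subseteq> X" "indep B" "card B = rank X"
      using obtain_basis by blast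
    obtain e where e: "e \<in> B - I" "indep (insert e I)"
      using augmentation[OF Suc.prems(2) B(2)] Suc.hyps(2) B(3) by fastforce
    have "card (insert e I) = Suc (card I)"
      using e Suc.prems indep_finite by auto
    hence "\<exists>J. insert e I \<subseteq> J \<and> J \<subseteq> X \<and> indep J \<and> card J = rank X"
      using Suc.hyps(2) Suc.prems e B by (intro Suc.hyps(1)) auto
    thus ?case
      by auto
  qed
  thus ?thesis
    using that by blast
qed

text \<open>An augmenting element taken from a basis of \<open>insert e X\<close> can only be
  \<open>e\<close>: any other one lies in \<open>X\<close> and would give an independent subset of
  \<open>X\<close> larger than its rank.\<close>

lemma augment_basis:
  assumes "J \<subseteq> X" "indep J" "card J = rank X" "rank X < rank (insert e X)"
  shows "indep (insert e J)" "e \<notin> J"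
proof -
  obtain B where B: "B \<subseteq> insert e X" "indep B" "card B = rank (insert e X)"
    using obtain_basis by blast
  obtain f where f: "f \<in> B - J" "indep (insert f J)"
    using augmentation[of J B] assms B by auto
  have "f = e"
  proof (rule ccontr)
    assume "f \<noteq> e"
    hence "card (insert f J) \<le> rank X"
      using f assms B by (intro card_le_rank) auto
    thus False
      using f assms indep_finite[of J] by auto
  qed
  thus "indep (insert e J)" "e \<notin> J"
    using f by auto
qed

text \<open>A basis of \<open>X\<close> extends to one of \<open>Y\<close>; if \<open>e\<close>
  could be added to the latter, it could be added to the part in \<open>X\<close>. This monotonicity
  of span, rather than submodularity, is what \<open>closure_minimal\<close> and
  \<open>flat_Int\<close> rest on.\<close>

lemma rank_insert_eq_mono:
  assumes "rank (insert e X) = rank X" "X \<subseteq> Y"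
  shows "rank (insert e Y) = rank Y"
proof (rule ccontr)
  assume "rank (insert e Y) \<noteq> rank Y"
  hence less: "rank Y < rank (insert e Y)"
    using rank_mono[OF subset_insertI, of Y e] by simp
  obtain I where I: "I \<subseteq> X" "indep I" "card I = rank X"
    using obtain_basis by blast
  obtain J where J: "I \<subseteq> J" "J \<subseteq> Y" "indep J" "card J = rank Y"
    using extend_to_basis[of I Y] I assms by blast
  have "indep (insert e J)" "e \<notin> J"
    using augment_basis[OF J(2-4) less] by auto
  hence "indep (insert e I)" "e \<notin> I"
    using J indep_mono[of "insert e J" "insert e I"] by auto
  hence "Suc (rank X) \<le> rank (insert e X)"
    using card_le_rank[of "insert e I" "insert e X"] I indep_finite[of I] by auto
  thus False
    using assms by simp
qed

definition closure :: "'a set \<Rightarrow> 'a set" where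
  "closure X = {e \<in> E. rank (insert e X) = rank X}"

lemma subset_closure: "X \<subseteq> E \<Longrightarrow> X \<subseteq> closure X"
  unfolding closure_def by (auto simp: insert_absorb)

lemma rank_closure:
  assumes "X \<subseteq> E"
  shows "rank (closure X) = rank X"
proof (rule ccontr)
  assume "rank (closure X) \<noteq> rank X"
  hence less: "rank X < rank (closure X)"
    using rank_mono[OF subset_closure[OF assms]] by auto
  obtain I where I: "I \<subseteq> X" "indep I" "card I = rank X"
    using obtain_basis by blast
  obtain B where B: "B \<subseteq> closure X" "indep B" "card B = rank (closure X)"
    using obtain_basis by blast
  obtain e where e: "e \<in> B - I" "indep (insert e I)"
    using augmentation[of I B] I B less by auto
  have "Suc (rank X) \<le> rank (insert e X)"
    using card_le_rank[of "insert e I" "insert e X"] I e indep_finite[of I] by auto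
  thus False
    using e B unfolding closure_def by auto
qed

lemma flatD: "flat F \<Longrightarrow> e \<in> E \<Longrightarrow> rank (insert e F) = rank F \<Longrightarrow> e \<in> F"
  unfolding flat_def by (metis DiffI less_irrefl)

lemma flat_closure:
  assumes "X \<subseteq> E"
  shows "flat (closure X)"
  unfolding flat_def
proof (intro conjI ballI)
  show "closure X \<subseteq> E"
    by (auto simp: closure_def)
  fix e assume e: "e \<in> E - closure X"
  hence "rank X < rank (insert e X)"
    using rank_mono[OF subset_insertI, of X e] by (auto simp: closure_def intro: le_neq_trans)
  also have "\<dots> \<le> rank (insert e (closure X))"
    using subset_closure[OF assms] by (intro rank_mono) auto
  finally show "rank (closure X) < rank (insert e (closure X))"
    using rank_closure[OF assms] by simp
qed

lemma closure_minimal: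
  assumes "flat F" "X \<subseteq> F"
  shows "closure X \<subseteq> F"
proof
  fix e assume "e \<in> closure X"
  hence "e \<in> E" "rank (insert e F) = rank F"
    using rank_insert_eq_mono[OF _ assms(2)] unfolding closure_def by auto
  thus "e \<in> F"
    using assms(1) flatD by blast
qed

lemma flat_Int:
  assumes "flat F" "flat G"
  shows "flat (F \<inter> G)"
proof -
  have "rank (F \<inter> G) < rank (insert e (F \<inter> G))" if "e \<in> E" "e \<notin> F \<inter> G" for e
  proof (rule ccontr)
    assume "\<not> ?thesis"
    hence "rank (insert e (F \<inter> G)) = rank (F \<inter> G)"
      using rank_mono[OF subset_insertI, of "F \<inter> G" e] by simp
    hence "rank (insert e F) = rank F" "rank (insert e G) = rank G"
      by (auto intro: rank_insert_eq_mono)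
    thus False
      using that assms flatD by blast
  qed
  thus ?thesis
    using assms unfolding flat_def by auto
qed

lemma rank_flat_less:
  assumes "flat F" "flat G" "F \<subset> G"
  shows "rank F < rank G"
proof -
  obtain e where e: "e \<in> G - F"
    using assms(3) by blast
  hence "rank F < rank (insert e F)"
    using assms unfolding flat_def by auto
  also have "\<dots> \<le> rank G"
    using e assms by (intro rank_mono) auto
  finally show ?thesis .
qed

text \<open>The witness is the closure of \<open>insert i F\<close>. Being the least flat that
  contains \<open>F\<close> and \<open>i\<close>, it makes the covers of \<open>F\<close> partition
  the remaining elements; the matroid structure is used later in this form.\<close>

lemma flat_cover:
  assumes "flat F" "i \<in> E - F"
  shows "\<exists>G. flat G \<and> F \<subset> G \<and> i \<in> G \<and> rank G = Suc (rank F) \<and>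
    (\<forall>H. flat H \<longrightarrow> F \<subseteq> H \<longrightarrow> i \<in> H \<longrightarrow> G \<subseteq> H)"
proof (intro exI conjI allI impI)
  have sub: "insert i F \<subseteq> E"
    using assms unfolding flat_def by auto
  show "flat (closure (insert i F))"
    by (rule flat_closure[OF sub])
  show "F \<subset> closure (insert i F)" "i \<in> closure (insert i F)"
    using subset_closure[OF sub] assms(2) by auto
  have "rank F < rank (insert i F)"
    using assms unfolding flat_def by auto
  thus "rank (closure (insert i F)) = Suc (rank F)"
    using rank_closure[OF sub] rank_insert_le[of i F] by simp
  show "closure (insert i F) \<subseteq> H" if "flat H" "F \<subseteq> H" "i \<in> H" for H
    using that by (intro closure_minimal) auto
qed

end

lemma (in simple_matroid) flat_empty: "flat {}"
  unfolding flat_def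
proof (intro conjI ballI)
  fix e assume "e \<in> E - {}"
  hence "indep {e}"
    using no_loops unfolding loop_def by auto
  thus "rank {} < rank (insert e {})"
    using card_le_rank[of "{e}" "{e}"] by auto
qed auto

lemma (in matroid) flat_ground: "flat E"
  unfolding flat_def by auto

text \<open>What the argument uses of a geometric lattice: closure under intersection, a strictly
  increasing rank that grows by one along covers, and the partition of \<open>E - F\<close> by the
  covers of \<open>F\<close>.\<close>

locale flat_lattice =
  fixes E :: "'a set" and \<L> :: "'a set set" and rk :: "'a set \<Rightarrow> nat"
  assumes finite_E: "finite E"
    and flat_subset: "F \<in> \<L> \<Longrightarrow> F \<subseteq> E"
    and empty_flat [simp]: "{} \<in> \<L>"
    and ground_flat [simp]: "E \<in> \<L>"
    and Int_flat: "F \<in> \<L> \<Longrightarrow> G \<in> \<L> \<Longrightarrow> F \<inter> G \<in> \<L>"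
    and rk_empty [simp]: "rk {} = 0"
    and rk_less: "F \<in> \<L> \<Longrightarrow> G \<in> \<L> \<Longrightarrow> F \<subset> G \<Longrightarrow> rk F < rk G"
    and cover: "F \<in> \<L> \<Longrightarrow> i \<in> E - F \<Longrightarrow>
      \<exists>G\<in>\<L>. F \<subset> G \<and> i \<in> G \<and> rk G = Suc (rk F) \<and> (\<forall>H\<in>\<L>. F \<subseteq> H \<longrightarrow> i \<in> H \<longrightarrow> G \<subseteq> H)"
begin

lemma finite_flats [simp]: "finite \<L>"
  by (rule finite_subset[of _ "Pow E"]) (use finite_E flat_subset in auto)

lemma rk_le: "F \<in> \<L> \<Longrightarrow> G \<in> \<L> \<Longrightarrow> F \<subseteq> G \<Longrightarrow> rk F \<le> rk G"
  using rk_less[of F G] by (cases "F = G") (auto simp: psubset_eq)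

lemma flat_eqI: "F \<in> \<L> \<Longrightarrow> G \<in> \<L> \<Longrightarrow> F \<subseteq> G \<Longrightarrow> rk G \<le> rk F \<Longrightarrow> F = G"
  using rk_less[of F G] by (auto simp: psubset_eq)

lemma rk_pos: "F \<in> \<L> \<Longrightarrow> F \<noteq> {} \<Longrightarrow> 0 < rk F"
  using rk_less[of "{}" F] by (simp add: psubset_eq)

text \<open>Climb from \<open>F\<close> through least flats containing an element of
  \<open>G - F\<close>; the rank rises by one each time, and the flat reached just before
  \<open>G\<close> is the coatom.\<close>

lemma coatom_above:
  assumes "F \<in> \<L>" "G \<in> \<L>" "F \<subset> G"
  obtains K where "K \<in> \<L>" "F \<subseteq> K" "K \<subset> G" "Suc (rk K) = rk G"
proof -
  have "\<exists>K\<in>\<L>. F \<subseteq> K \<and> K \<subset> G \<and> Suc (rk K) = rk G"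
    using assms
  proof (induction "rk G - rk F" arbitrary: F rule: less_induct)
    case less
    obtain i where i: "i \<in> G - F"
      using less.prems by blast
    hence "i \<in> E - F"
      using less.prems flat_subset by blast
    then obtain F' where F': "F' \<in> \<L>" "F \<subset> F'" "i \<in> F'" "rk F' = Suc (rk F)"
        "\<forall>H\<in>\<L>. F \<subseteq> H \<longrightarrow> i \<in> H \<longrightarrow> F' \<subseteq> H"
      using cover[OF less.prems(1)] by meson
    have sub: "F' \<subseteq> G"
      using F' i less.prems by blast
    show ?case
    proof (cases "F' = G")
      case True
      thus ?thesis
        using F' less.prems by (intro bexI[of _ F]) auto
    next
      case False
      hence "rk F' < rk G"
        using sub F' less.prems rk_less by blast
      hence "rk G - rk F' < rk G - rk F"
        using F' by auto
      from less.hyps[OF this F'(1)] have "\<exists>K\<in>\<L>. F' \<subseteq> K \<and> K \<subset> G \<and> Suc (rk K) = rk G"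
        using False sub less.prems by auto
      thus ?thesis
        using F' by (metis order_trans psubset_imp_subset)
    qed
  qed
  thus ?thesis
    using that by blast
qed

end

lemma (in simple_matroid) flat_lattice: "flat_lattice E {F. flat F} rank"
proof
  show "\<exists>G\<in>{F. flat F}. F \<subset> G \<and> i \<in> G \<and> rank G = Suc (rank F) \<and>
      (\<forall>H\<in>{F. flat F}. F \<subseteq> H \<longrightarrow> i \<in> H \<longrightarrow> G \<subseteq> H)"
    if "F \<in> {F. flat F}" "i \<in> E - F" for F i
    using flat_cover[of F i] that by simp
  show "F \<subseteq> E" if "F \<in> {F. flat F}" for F
    using that by (simp add: flat_def)
qed (simp_all add: finite_ground flat_empty flat_ground flat_Int rank_flat_less)

section \<open>Ideals generated by variables of flats\<close>

text \<open>The ring as a module over itself: \<open>rmod.subspace\<close> means ideal, and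
  \<open>rmod.span\<close> is the generated ideal.\<close>

interpretation rmod: Modules.module "(*) :: 'r::comm_ring_1 \<Rightarrow> 'r \<Rightarrow> 'r"
  by standard (simp_all add: algebra_simps)

text \<open>As a simp rule this instance loops with associativity of multiplication.\<close>
declare rmod.scale_scale [simp del]

lemma rmod_subspaceD:
  assumes "rmod.subspace B"
  shows "0 \<in> B" "a \<in> B \<Longrightarrow> b \<in> B \<Longrightarrow> a + b \<in> B" "a \<in> B \<Longrightarrow> c * a \<in> B"
    "a \<in> B \<Longrightarrow> a * c \<in> B" "a \<in> B \<Longrightarrow> b \<in> B \<Longrightarrow> a - b \<in> B" "a \<in> B \<Longrightarrow> - a \<in> B"
proof -
  show "0 \<in> B" "a \<in> B \<Longrightarrow> b \<in> B \<Longrightarrow> a + b \<in> B" "a \<in> B \<Longrightarrow> c * a \<in> B"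
    using assms by (auto simp: rmod.subspace_def)
  thus "a \<in> B \<Longrightarrow> a * c \<in> B"
    by (simp add: mult.commute)
  show "a \<in> B \<Longrightarrow> b \<in> B \<Longrightarrow> a - b \<in> B" "a \<in> B \<Longrightarrow> - a \<in> B"
    using assms rmod.subspace_diff rmod.subspace_neg by blast+
qed

lemma span_Un_image_decompose:
  fixes x :: "'b \<Rightarrow> 'r::comm_ring_1"
  assumes "finite Q" "y \<in> rmod.span (S \<union> x ` Q)"
  shows "\<exists>c. y - (\<Sum>H\<in>Q. c H * x H) \<in> rmod.span S"
  using assms
proof (induction Q arbitrary: y rule: finite_induct)
  case empty
  thus ?case by simp
next
  case (insert q Q)
  have "y \<in> rmod.span (insert (x q) (S \<union> x ` Q))"
    using insert.prems by simp
  then obtain k where "y - k * x q \<in> rmod.span (S \<union> x ` Q)"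
    unfolding rmod.span_insert by blast
  from insert.IH[OF this] obtain c where
    c: "y - k * x q - (\<Sum>H\<in>Q. c H * x H) \<in> rmod.span S"
    by blast
  have "(\<Sum>H\<in>insert q Q. (c(q := k)) H * x H) = k * x q + (\<Sum>H\<in>Q. (c(q := k)) H * x H)"
    using insert.hyps by simp
  also have "(\<Sum>H\<in>Q. (c(q := k)) H * x H) = (\<Sum>H\<in>Q. c H * x H)"
    using insert.hyps by (intro sum.cong) auto
  finally show ?case
    using c by (intro exI[of _ "c(q := k)"]) (simp only: diff_diff_eq)
qed

text \<open>Membership in \<open>N\<close> replaces equality in the quotient. With
  \<open>x {} = 1\<close> a plain linear relation is the case \<open>K = {}\<close> of one
  multiplied by \<open>x K\<close>. The last axiom is the input from the degree functional: modulo
  the variables every element is a constant, and a nonzero constant does not annihilate the product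
  of a complete flag, which has \<open>rk E - 1\<close> members because \<open>{}\<close> and
  \<open>E\<close> are left out.\<close>

locale chow_relations = flat_lattice E \<L> rk for E :: "'a set" and \<L> rk +
  fixes x :: "'a set \<Rightarrow> 'r::comm_ring_1" and N :: "'r set"
  assumes subspace_N: "rmod.subspace N"
    and x_empty [simp]: "x {} = 1"
    and incomparable: "F \<in> \<L> \<Longrightarrow> G \<in> \<L> \<Longrightarrow> \<not> F \<subseteq> G \<Longrightarrow> \<not> G \<subseteq> F \<Longrightarrow> x F * x G \<in> N"
    and linear_relation: "i \<in> E \<Longrightarrow> (\<Sum>F\<in>{F \<in> \<L>. i \<in> F}. x F) \<in> N"
    and constant_part: "\<exists>c. r - c \<in> rmod.span (N \<union> x ` (\<L> - {{}})) \<and>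
      (c = 0 \<or> (\<forall>\<sigma>. \<sigma> \<subseteq> \<L> - {{}, E} \<longrightarrow> (\<forall>F\<in>\<sigma>. \<forall>G\<in>\<sigma>. F \<subseteq> G \<or> G \<subseteq> F) \<longrightarrow> Suc (card \<sigma>) = rk E \<longrightarrow>
        c * (\<Prod>F\<in>\<sigma>. x F) \<notin> N))"
begin

section \<open>Ideals of variables modulo the relations\<close>

lemmas N_closed = rmod_subspaceD[OF subspace_N]

text \<open>For nonempty \<open>F\<close> and \<open>n\<close> at least \<open>rk F\<close> the
  empty flat is a member, so the ideal of these variables is the whole ring; the downward induction
  on \<open>n\<close> starts there. \<open>F\<close> itself is never a member.\<close>

definition killed :: "nat \<Rightarrow> 'a set \<Rightarrow> 'a set set" where
  "killed n F = {K \<in> \<L>. \<not> K \<subseteq> F \<or> K \<subset> F \<and> rk F \<le> rk K + n}"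

lemma killed_0: "F \<in> \<L> \<Longrightarrow> killed 0 F = {K \<in> \<L>. \<not> K \<subseteq> F}"
  using rk_less[of _ F] by (fastforce simp: killed_def)

definition J :: "'a set set \<Rightarrow> 'r set" where
  "J \<K> = rmod.span (N \<union> x ` \<K>)"

lemma subspace_J: "rmod.subspace (J \<K>)"
  by (simp add: J_def)

lemmas J_closed = rmod_subspaceD[OF subspace_J]

lemma N_subset_J: "N \<subseteq> J \<K>"
  unfolding J_def using rmod.span_superset by blast

lemma x_in_J: "K \<in> \<K> \<Longrightarrow> x K \<in> J \<K>"
  unfolding J_def by (intro rmod.span_base) auto

lemma J_mono: "\<K> \<subseteq> \<K>' \<Longrightarrow> J \<K> \<subseteq> J \<K>'"
  unfolding J_def by (intro rmod.span_mono) auto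

lemma J_minimal: "rmod.subspace B \<Longrightarrow> N \<subseteq> B \<Longrightarrow> x ` \<K> \<subseteq> B \<Longrightarrow> J \<K> \<subseteq> B"
  unfolding J_def by (intro rmod.span_minimal) auto

lemma J_empty: "J {} = N"
  unfolding J_def using rmod.span_eq_iff subspace_N by simp

lemma J_insert_absorb:
  assumes "x G \<in> J \<K>"
  shows "J (insert G \<K>) = J \<K>"
proof
  show "J (insert G \<K>) \<subseteq> J \<K>"
    using assms by (intro J_minimal subspace_J N_subset_J) (auto intro: x_in_J)
  show "J \<K> \<subseteq> J (insert G \<K>)"
    by (intro J_mono) auto
qed

lemma subspace_multiplier:
  assumes "rmod.subspace B"
  shows "rmod.subspace {r. r * a \<in> B}"
proof (rule rmod.subspaceI; clarify)
  show "0 * a \<in> B"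
    using rmod_subspaceD(1)[OF assms] by simp
  show "(r + s) * a \<in> B" if "r * a \<in> B" "s * a \<in> B" for r s
    using rmod_subspaceD(2)[OF assms that] by (simp only: distrib_right)
  show "c * r * a \<in> B" if "r * a \<in> B" for c r
    using rmod_subspaceD(3)[OF assms that] by (simp only: mult.assoc)
qed

text \<open>The elements that multiply \<open>a\<close> into \<open>B\<close> form an ideal, so it
  suffices to test generators.\<close>

lemma J_mult_subset:
  assumes "rmod.subspace B" "N \<subseteq> B" "\<And>K. K \<in> \<K> \<Longrightarrow> x K * a \<in> B" "r \<in> J \<K>"
  shows "r * a \<in> B"
proof -
  have "J \<K> \<subseteq> {r. r * a \<in> B}"
  proof (intro J_minimal subspace_multiplier assms(1))
    show "N \<subseteq> {r. r * a \<in> B}"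
      using assms(2) rmod_subspaceD(4)[OF assms(1)] by blast
    show "x ` \<K> \<subseteq> {r. r * a \<in> B}"
      using assms(3) by blast
  qed
  thus ?thesis
    using assms(4) by blast
qed

lemma J_decompose:
  assumes "r \<in> J (\<K> \<union> Q)" "Q \<subseteq> \<L>"
  obtains c where "r - (\<Sum>H\<in>Q. c H * x H) \<in> J \<K>"
proof -
  have "r \<in> rmod.span ((N \<union> x ` \<K>) \<union> x ` Q)"
    using assms(1) by (simp add: J_def image_Un Un_assoc)
  moreover have "finite Q"
    using assms(2) finite_flats finite_subset by blast
  ultimately show ?thesis
    using span_Un_image_decompose[of Q r] that unfolding J_def by blast
qed

text \<open>Multiply the linear relation of \<^term>\<open>i\<close> by \<^term>\<open>x K\<close>: only flats strictly above
  \<^term>\<open>K\<close> survive.\<close>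

lemma expand:
  assumes B: "rmod.subspace B" "N \<subseteq> B"
    and K: "K \<in> \<L>" "i \<in> E" "i \<notin> K"
    and Q: "Q \<subseteq> {L \<in> \<L>. K \<subset> L \<and> i \<in> L}"
    and rest: "\<And>L. L \<in> \<L> \<Longrightarrow> K \<subset> L \<Longrightarrow> i \<in> L \<Longrightarrow> L \<notin> Q \<Longrightarrow> x K * x L * w \<in> B"
  shows "x K * (\<Sum>L\<in>Q. x L) * w \<in> B"
proof -
  note B_closed = rmod_subspaceD[OF B(1)]
  let ?U = "{F \<in> \<L>. i \<in> F}"
  have "(\<Sum>L\<in>?U - Q. x K * x L * w) \<in> B"
  proof (rule rmod.subspace_sum[OF B(1)])
    fix L assume L: "L \<in> ?U - Q"
    show "x K * x L * w \<in> B"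
    proof (cases "K \<subset> L")
      case True
      thus ?thesis
        using rest L by auto
    next
      case False
      \<comment> \<open>A flat containing \<open>i\<close> cannot lie below \<open>K\<close>, so not
        being above \<open>K\<close> means being incomparable with it.\<close>
      hence "\<not> K \<subseteq> L" "\<not> L \<subseteq> K"
        using L K by auto
      thus ?thesis
        using incomparable[of K L] L K B(2) B_closed(4) by auto
    qed
  qed
  moreover have "x K * (\<Sum>L\<in>?U. x L) * w \<in> B"
    using linear_relation[OF K(2)] B(2) B_closed by blast
  moreover have "x K * (\<Sum>L\<in>?U. x L) * w =
      x K * (\<Sum>L\<in>Q. x L) * w + (\<Sum>L\<in>?U - Q. x K * x L * w)"
  proof -
    have "(\<Sum>L\<in>?U. x L) = (\<Sum>L\<in>?U - Q. x L) + (\<Sum>L\<in>Q. x L)"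
      using Q by (intro sum.subset_diff) auto
    moreover have "(\<Sum>L\<in>?U - Q. x K * x L * w) = x K * (\<Sum>L\<in>?U - Q. x L) * w"
      by (simp add: sum_distrib_left sum_distrib_right)
    ultimately show ?thesis
      by (simp only: distrib_left distrib_right add.commute)
  qed
  ultimately have "x K * (\<Sum>L\<in>Q. x L) * w + (\<Sum>L\<in>?U - Q. x K * x L * w) \<in> B"
      "(\<Sum>L\<in>?U - Q. x K * x L * w) \<in> B"
    by simp_all
  from B_closed(5)[OF this] show ?thesis
    by (simp only: add_diff_cancel_right')
qed

text \<open>Only a \<open>K\<close> of corank exactly \<open>Suc n\<close> in \<open>F\<close> is
  new. In the relation of an element of \<open>F - K\<close>, every flat above \<open>K\<close>
  other than \<open>F\<close> is not contained in \<open>F\<close> or has smaller corank, hence is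
  in \<open>killed n F\<close>.\<close>

lemma kill_step:
  assumes B: "rmod.subspace B" "N \<subseteq> B" and F: "F \<in> \<L>"
    and hyp: "\<And>K. K \<in> killed n F \<Longrightarrow> x K * w \<in> B"
    and K: "K \<in> killed (Suc n) F"
  shows "x K * x F * w \<in> B"
proof (cases "K \<in> killed n F")
  case True
  hence "x F * (x K * w) \<in> B"
    by (intro rmod_subspaceD(3)[OF B(1)] hyp)
  thus ?thesis
    by (simp only: ac_simps)
next
  case False
  hence sub: "K \<in> \<L>" "K \<subset> F" "rk F \<le> Suc (rk K + n)"
    using K by (auto simp: killed_def)
  then obtain i where i: "i \<in> F" "i \<notin> K"
    by blast
  have "x K * (\<Sum>L\<in>{F}. x L) * w \<in> B"
  proof (rule expand[OF B sub(1) _ i(2)])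
    show "i \<in> E"
      using i F flat_subset by blast
    fix L assume L: "L \<in> \<L>" "K \<subset> L" "i \<in> L" "L \<notin> {F}"
    have "L \<in> killed n F"
      using L sub rk_less[of K L] by (auto simp: killed_def)
    hence "x K * (x L * w) \<in> B"
      by (intro rmod_subspaceD(3)[OF B(1)] hyp)
    thus "x K * x L * w \<in> B"
      by (simp only: mult.assoc)
  qed (use F sub i in auto)
  thus ?thesis
    by simp
qed

lemma kill:
  assumes B: "rmod.subspace B" "N \<subseteq> B" and F: "F \<in> \<L>"
    and hyp: "\<And>K. K \<in> killed n F \<Longrightarrow> x K * w \<in> B"
  shows "K \<in> killed (n + m) F \<Longrightarrow> x K * x F ^ m * w \<in> B"
proof (induction m arbitrary: K)
  case 0
  thus ?case
    using hyp by simp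
next
  case (Suc m)
  have "x K * x F * (x F ^ m * w) \<in> B"
  proof (rule kill_step[OF B F, of "n + m"])
    show "x L * (x F ^ m * w) \<in> B" if "L \<in> killed (n + m) F" for L
      using Suc.IH[OF that] by (simp only: mult.assoc)
    show "K \<in> killed (Suc (n + m)) F"
      using Suc.prems by simp
  qed
  thus ?case
    by (simp only: mult.assoc power_Suc)
qed

text \<open>For \<open>i\<close> in \<open>H - K\<close>, a flat above \<open>K\<close> containing
  \<open>i\<close> meets \<open>H\<close> in a flat strictly above the coatom \<open>K\<close>, so
  it contains \<open>H\<close>. Apart from \<open>H\<close> and \<open>F\<close> all such flats are
  in \<open>killed n F\<close>, and the relation of \<open>i\<close> has just two surviving
  terms.\<close>

lemma exchange:
  assumes B: "rmod.subspace B" "N \<subseteq> B" and F: "F \<in> \<L>"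
    and hyp: "\<And>K. K \<in> killed n F \<Longrightarrow> x K * w \<in> B"
    and H: "H \<in> \<L>" "H \<subset> F" "Suc (rk H + n) = rk F"
    and K: "K \<in> \<L>" "K \<subset> H" "Suc (rk K) = rk H"
  shows "x K * x H * w + x K * x F * w \<in> B"
proof -
  obtain i where i: "i \<in> H" "i \<notin> K"
    using K by blast
  have "x K * (\<Sum>L\<in>{H, F}. x L) * w \<in> B"
  proof (rule expand[OF B K(1) _ i(2)])
    show "i \<in> E"
      using i H flat_subset by blast
    fix L assume L: "L \<in> \<L>" "K \<subset> L" "i \<in> L" "L \<notin> {H, F}"
    have "K \<subset> L \<inter> H"
      using L i K by auto
    hence "L \<inter> H = H"
      using rk_less[of K "L \<inter> H"] Int_flat[OF L(1) H(1)] K H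
      by (intro flat_eqI) auto
    hence "H \<subset> L"
      using L by auto
    hence "L \<in> killed n F"
      using L H rk_less[of H L] by (auto simp: killed_def)
    hence "x K * (x L * w) \<in> B"
      by (intro rmod_subspaceD(3)[OF B(1)] hyp)
    thus "x K * x L * w \<in> B"
      by (simp only: mult.assoc)
  qed (use F H K i in auto)
  thus ?thesis
    using H by (simp add: algebra_simps)
qed

text \<open>A coefficient that is trivial in the truncated restriction to \<open>H\<close> lets the
  term at \<open>H\<close> be rewritten as a multiple of \<open>x F\<close>. On generators: a coatom
  \<open>K\<close> of \<open>H\<close> is handled by \<open>exchange\<close> with
  \<open>t = - x K\<close>, the flat \<open>F\<close> by \<open>t = x H\<close>, and every other
  flat not contained in \<open>H\<close> by \<open>t = 0\<close>.\<close>

lemma reduce: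
  assumes B: "rmod.subspace B" "N \<subseteq> B" and F: "F \<in> \<L>"
    and hyp: "\<And>K. K \<in> killed n F \<Longrightarrow> x K * w \<in> B"
    and H: "H \<in> \<L>" "H \<subset> F" "Suc (rk H + n) = rk F"
    and s: "s \<in> J (killed 1 H)"
  obtains t where "s * x H * w - t * x F * w \<in> B"
proof -
  note B_closed = rmod_subspaceD[OF B(1)]
  let ?S = "{s. \<exists>t. s * x H * w - t * x F * w \<in> B}"
  have "J (killed 1 H) \<subseteq> ?S"
  proof (rule J_minimal)
    show "rmod.subspace ?S"
    proof (rule rmod.subspaceI)
      show "0 \<in> ?S"
        using B_closed(1) by (intro CollectI exI[of _ 0]) simp
      show "a + b \<in> ?S" if ab: "a \<in> ?S" "b \<in> ?S" for a b
      proof -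
        obtain t u where "a * x H * w - t * x F * w \<in> B" "b * x H * w - u * x F * w \<in> B"
          using ab by blast
        hence "(a * x H * w - t * x F * w) + (b * x H * w - u * x F * w) \<in> B"
          by (rule B_closed(2))
        thus ?thesis
          by (intro CollectI exI[of _ "t + u"]) (simp add: algebra_simps)
      qed
      show "c * a \<in> ?S" if ca: "a \<in> ?S" for c a
      proof -
        obtain t where "a * x H * w - t * x F * w \<in> B"
          using ca by blast
        hence "c * (a * x H * w - t * x F * w) \<in> B"
          by (rule B_closed(3))
        thus ?thesis
          by (intro CollectI exI[of _ "c * t"]) (simp add: algebra_simps)
      qed
    qed
    show "N \<subseteq> ?S"
    proof
      fix s assume "s \<in> N"
      hence "s * (x H * w) \<in> B"
        using B(2) B_closed(4) by blast
      thus "s \<in> ?S"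
        by (intro CollectI exI[of _ 0]) (simp add: mult.assoc)
    qed
    show "x ` killed 1 H \<subseteq> ?S"
    proof safe
      fix K assume K: "K \<in> killed 1 H"
      show "\<exists>t. x K * x H * w - t * x F * w \<in> B"
      proof (cases "K \<subseteq> H")
        case True
        hence "K \<in> \<L>" "K \<subset> H" "Suc (rk K) = rk H"
          using K rk_less[of K H] H by (auto simp: killed_def)
        hence "x K * x H * w + x K * x F * w \<in> B"
          by (intro exchange[OF B F hyp H]) auto
        thus ?thesis
          by (intro exI[of _ "- x K"]) simp
      next
        case nle: False
        have K': "K \<in> \<L>"
          using K by (simp add: killed_def)
        show ?thesis
        proof (cases "H \<subseteq> K")
          case False
          hence "x K * x H \<in> B"
            using incomparable[OF K' H(1) nle] B(2) by blast
          thus ?thesis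
            using B_closed(4) by (intro exI[of _ 0]) simp
        next
          case True
          show ?thesis
          proof (cases "K = F")
            case True
            thus ?thesis
              using B_closed(1) by (intro exI[of _ "x H"]) (simp add: algebra_simps)
          next
            case False
            have "rk H < rk K"
              using True nle K' H by (intro rk_less) auto
            hence "K \<in> killed n F"
              using False K' H by (auto simp: killed_def)
            hence "x H * (x K * w) \<in> B"
              using hyp B_closed(3) by blast
            thus ?thesis
              by (intro exI[of _ 0]) (simp add: ac_simps)
          qed
        qed
      qed
    qed
  qed
  thus ?thesis
    using s that by blast
qed

text \<open>The pairs \<^term>\<open>(F, w)\<close> of a flat and a product \<^term>\<open>w\<close> whose annihilator will turn out to be
  generated by the variables of the flats not contained in \<^term>\<open>F\<close>.\<close>

inductive socle_multiplier :: "'a set \<Rightarrow> 'r \<Rightarrow> bool" where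
  ground: "socle_multiplier E 1"
| step: "socle_multiplier F w \<Longrightarrow> H \<in> \<L> \<Longrightarrow> H \<noteq> {} \<Longrightarrow> H \<subset> F \<Longrightarrow> Suc (rk H + n) = rk F \<Longrightarrow>
    socle_multiplier H (x H * x F ^ n * w)"

lemma socle_multiplier_flat: "socle_multiplier F w \<Longrightarrow> F \<in> \<L>"
  by (induction rule: socle_multiplier.induct) auto

lemma socle_multiplier_exists:
  assumes "F \<in> \<L>" "F \<noteq> {}"
  obtains w where "socle_multiplier F w"
proof (cases "F = E")
  case True
  thus ?thesis
    using that ground by blast
next
  case False
  hence "F \<subset> E"
    using assms flat_subset by auto
  moreover from this have "Suc (rk F + (rk E - Suc (rk F))) = rk E"
    using rk_less[OF assms(1) ground_flat] by auto
  ultimately show ?thesis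
    using that step[OF ground assms] by blast
qed

text \<open>Let \<open>K\<close> be strictly above \<open>H\<close>. If \<open>K\<close> is not
  \<open>F\<close>, it is not contained in \<open>F\<close> or has corank at most \<open>n\<close>
  there, so \<open>x F ^ n * w\<close> kills it. If \<open>K\<close> is \<open>F\<close>, the power
  becomes \<open>Suc n\<close>, and now it is \<open>H\<close>, of corank \<open>Suc n\<close>, that
  is killed.\<close>

lemma socle_multiplier_kill0:
  "socle_multiplier F w \<Longrightarrow> K \<in> killed 0 F \<Longrightarrow> x K * w \<in> N"
proof (induction arbitrary: K rule: socle_multiplier.induct)
  case ground
  thus ?case
    using flat_subset rk_less[of K E] by (force simp: killed_def)
next
  case (step F w H n)
  have F: "F \<in> \<L>"
    using step.hyps socle_multiplier_flat by blast
  note hyp = kill[OF subspace_N subset_refl F, of 0 w, OF step.IH]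
  have K: "K \<in> \<L>" "\<not> K \<subseteq> H"
    using step.prems step.hyps by (simp_all add: killed_0)
  show ?case
  proof (cases "H \<subset> K")
    case False
    hence "x K * x H \<in> N"
      using incomparable[OF K(1) step.hyps(2) K(2)] K(2) by auto
    hence "x K * x H * (x F ^ n * w) \<in> N"
      by (rule N_closed(4))
    thus ?thesis
      by (simp add: ac_simps)
  next
    case True
    have "x K * x F ^ n * w \<in> N \<or> K = F"
    proof (cases "K = F")
      case False
      hence "K \<in> killed (0 + n) F"
        using True K(1) step.hyps rk_less[of H K] by (auto simp: killed_def)
      thus ?thesis
        using hyp by blast
    qed auto
    thus ?thesis
    proof
      assume "x K * x F ^ n * w \<in> N"
      hence "x H * (x K * x F ^ n * w) \<in> N"
        by (rule N_closed(3))
      thus ?thesis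
        by (simp add: ac_simps)
    next
      assume "K = F"
      have "H \<in> killed (0 + Suc n) F"
        using step.hyps by (auto simp: killed_def)
      hence "x H * x F ^ Suc n * w \<in> N"
        using hyp by blast
      thus ?thesis
        using \<open>K = F\<close> by (simp add: ac_simps)
    qed
  qed
qed

lemma socle_multiplier_kill:
  assumes "socle_multiplier F w" "K \<in> killed n F"
  shows "x K * (x F ^ n * w) \<in> N"
  using kill[OF subspace_N subset_refl socle_multiplier_flat[OF assms(1)], of 0 w K n]
    socle_multiplier_kill0[OF assms(1)] assms(2) by (simp add: mult.assoc)

lemma J_killed_mult:
  assumes "socle_multiplier F w" "r \<in> J (killed n F)"
  shows "r * (x F ^ n * w) \<in> N"
  using J_mult_subset[OF subspace_N subset_refl _ assms(2)] socle_multiplier_kill[OF assms(1)]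
  by blast

section \<open>Nonvanishing of the multipliers\<close>

definition flag_above :: "'a set \<Rightarrow> 'a set set \<Rightarrow> bool" where
  "flag_above F \<sigma> \<longleftrightarrow> \<sigma> \<subseteq> {K \<in> \<L>. F \<subseteq> K \<and> K \<noteq> E} \<and> (\<forall>G\<in>\<sigma>. \<forall>H\<in>\<sigma>. G \<subseteq> H \<or> H \<subseteq> G) \<and>
    rk F + card \<sigma> = rk E"

lemma flag_above_insert:
  assumes "flag_above F \<sigma>" "H \<in> \<L>" "H \<subset> F" "Suc (rk H) = rk F" "F \<in> \<L>"
  shows "flag_above H (insert H \<sigma>)" "finite \<sigma>" "H \<notin> \<sigma>"
proof -
  have "\<sigma> \<subseteq> \<L>"
    using assms unfolding flag_above_def by auto
  thus fin: "finite \<sigma>"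
    using finite_flats finite_subset by blast
  show notin: "H \<notin> \<sigma>"
    using assms unfolding flag_above_def by auto
  have sub: "H \<subseteq> G" if "G \<in> \<sigma>" for G
    using that assms unfolding flag_above_def by auto
  have "H \<noteq> E"
    using assms flat_subset[of F] by auto
  moreover have "rk H + card (insert H \<sigma>) = rk E"
    using assms(1,4) fin notin unfolding flag_above_def by simp
  moreover have "\<forall>G\<in>insert H \<sigma>. \<forall>K\<in>insert H \<sigma>. G \<subseteq> K \<or> K \<subseteq> G"
    using assms(1) sub unfolding flag_above_def by auto
  ultimately show "flag_above H (insert H \<sigma>)"
    using assms(1,2) sub unfolding flag_above_def by auto
qed

text \<open>Each factor \<open>x F\<close> is traded, at the cost of a sign, for the variable of a
  flat between \<open>H\<close> and \<open>F\<close>: the relation of \<open>i\<close> in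
  \<open>F - H\<close>, times \<open>x H * x F ^ n * w\<close>, leaves only \<open>F\<close> and the
  least flat \<open>K\<close> containing \<open>H\<close> and \<open>i\<close>. For
  \<open>n = 0\<close> the coatom \<open>H\<close> is put in front of the flag. The count in
  \<open>flag_above\<close> makes the chain saturated: one flat for each rank from
  \<open>rk F\<close> to \<open>rk E - 1\<close>.\<close>

lemma socle_multiplier_flag:
  "socle_multiplier F w \<Longrightarrow> \<exists>\<sigma> s. flag_above F \<sigma> \<and> w - (- 1) ^ s * (\<Prod>G\<in>\<sigma>. x G) \<in> N"
proof (induction rule: socle_multiplier.induct)
  case ground
  show ?case
    by (intro exI[of _ "{}"] exI[of _ 0]) (auto simp: flag_above_def N_closed(1))
next
  case (step F w H n)
  have F: "F \<in> \<L>"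
    using step.hyps socle_multiplier_flat by blast
  have prepend: "\<exists>\<sigma> s. flag_above H \<sigma> \<and> x H * v - (- 1) ^ s * (\<Prod>G\<in>\<sigma>. x G) \<in> N"
    if fl: "flag_above K \<sigma>" "v - (- 1) ^ s * (\<Prod>G\<in>\<sigma>. x G) \<in> N"
      and K: "K \<in> \<L>" "H \<in> \<L>" "H \<subset> K" "Suc (rk H) = rk K" for H K \<sigma> s v
  proof -
    note fi = flag_above_insert[OF fl(1) K(2,3,4,1)]
    have "x H * (v - (- 1) ^ s * (\<Prod>G\<in>\<sigma>. x G)) \<in> N"
      using fl(2) by (rule N_closed(3))
    hence "x H * v - (- 1) ^ s * (\<Prod>G\<in>insert H \<sigma>. x G) \<in> N"
      using fi(2,3) by (simp add: algebra_simps)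
    thus ?thesis
      using fi(1) by blast
  qed
  show ?case
    using step.hyps(2-5)
  proof (induction n arbitrary: H)
    case 0
    obtain \<sigma> s where "flag_above F \<sigma>" "w - (- 1) ^ s * (\<Prod>G\<in>\<sigma>. x G) \<in> N"
      using step.IH by blast
    from prepend[OF this F 0(1,3)] 0(4) show ?case
      by simp
  next
    case (Suc n)
    obtain i where i: "i \<in> F" "i \<notin> H"
      using Suc.prems by blast
    hence iE: "i \<in> E - H"
      using F flat_subset by blast
    from cover[OF Suc.prems(1) this] obtain K where K: "K \<in> \<L>" "H \<subset> K" "i \<in> K"
      "rk K = Suc (rk H)" "\<forall>L\<in>\<L>. H \<subseteq> L \<longrightarrow> i \<in> L \<longrightarrow> K \<subseteq> L"
      by meson
    have "K \<subseteq> F"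
      using K(5) F i Suc.prems by auto
    hence KF: "K \<subset> F"
      using K(4) Suc.prems(4) by auto
    have rkK: "Suc (rk K + n) = rk F"
      using K(4) Suc.prems(4) by simp
    have "K \<noteq> {}"
      using K by auto
    from Suc.IH[OF K(1) this KF rkK] obtain \<sigma> s where \<sigma>: "flag_above K \<sigma>"
      "x K * x F ^ n * w - (- 1) ^ s * (\<Prod>G\<in>\<sigma>. x G) \<in> N"
      by blast
    have "x H * (\<Sum>L\<in>{K, F}. x L) * (x F ^ n * w) \<in> N"
    proof (rule expand[OF subspace_N subset_refl Suc.prems(1)])
      fix L assume L: "L \<in> \<L>" "H \<subset> L" "i \<in> L" "L \<notin> {K, F}"
      have "K \<subset> L"
        using L K by auto
      hence "L \<in> killed n F"
        using L rkK K rk_less[of K L] by (auto simp: killed_def)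
      hence "x L * (x F ^ n * w) \<in> N"
        using socle_multiplier_kill step.hyps(1) by blast
      thus "x H * x L * (x F ^ n * w) \<in> N"
        by (subst mult.assoc) (rule N_closed(3))
    qed (use iE K F i Suc.prems in auto)
    hence sum: "x H * (x K * x F ^ n * w) + x H * x F ^ Suc n * w \<in> N"
      using KF by (simp add: algebra_simps)
    obtain \<tau> u where \<tau>: "flag_above H \<tau>"
      "x H * (x K * x F ^ n * w) - (- 1) ^ u * (\<Prod>G\<in>\<tau>. x G) \<in> N"
      using prepend[OF \<sigma> K(1) Suc.prems(1) K(2)] K(4) by auto
    have "x H * x F ^ Suc n * w - (- 1) ^ Suc u * (\<Prod>G\<in>\<tau>. x G) =
      (x H * (x K * x F ^ n * w) + x H * x F ^ Suc n * w) -
      (x H * (x K * x F ^ n * w) - (- 1) ^ u * (\<Prod>G\<in>\<tau>. x G))"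
      by simp
    hence "x H * x F ^ Suc n * w - (- 1) ^ Suc u * (\<Prod>G\<in>\<tau>. x G) \<in> N"
      using N_closed(5)[OF sum \<tau>(2)] by metis
    thus ?case
      using \<tau>(1) by blast
  qed
qed

text \<open>A saturated chain starting in rank one is a complete flag, so the assumption on
  \<open>c\<close> applies to it. The unknown sign is removed by multiplying with it once
  more.\<close>

lemma socle_multiplier_atom_nonzero:
  assumes w: "socle_multiplier F w" "rk F = 1" and c: "c * w \<in> N"
    and flags: "\<forall>\<sigma>. \<sigma> \<subseteq> \<L> - {{}, E} \<longrightarrow> (\<forall>F\<in>\<sigma>. \<forall>G\<in>\<sigma>. F \<subseteq> G \<or> G \<subseteq> F) \<longrightarrow> Suc (card \<sigma>) = rk E \<longrightarrow>
        c * (\<Prod>F\<in>\<sigma>. x F) \<notin> N"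
  shows False
proof -
  obtain \<sigma> s where \<sigma>: "flag_above F \<sigma>" "w - (- 1) ^ s * (\<Prod>G\<in>\<sigma>. x G) \<in> N"
    using socle_multiplier_flag[OF w(1)] by blast
  have "(- 1) ^ s * (c * w - c * (w - (- 1) ^ s * (\<Prod>G\<in>\<sigma>. x G))) \<in> N"
    by (intro N_closed(3,5) c \<sigma>(2))
  also have "(- 1) ^ s * (c * w - c * (w - (- 1) ^ s * (\<Prod>G\<in>\<sigma>. x G))) =
      ((- 1) ^ s * (- 1) ^ s) * (c * (\<Prod>G\<in>\<sigma>. x G))"
    by (simp add: algebra_simps)
  also have "(- 1 :: 'r) ^ s * (- 1) ^ s = 1"
    by (simp flip: power_mult_distrib)
  finally have "c * (\<Prod>G\<in>\<sigma>. x G) \<in> N"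
    by simp
  moreover have "F \<noteq> {}"
    using w(2) by auto
  hence "\<sigma> \<subseteq> \<L> - {{}, E}"
    using \<sigma>(1) unfolding flag_above_def by auto
  ultimately show False
    using flags \<sigma>(1) w(2) unfolding flag_above_def by auto
qed

text \<open>The linear relation of any element of \<open>G\<close> contains \<open>x G\<close> and
  otherwise only variables from \<open>\<K>\<close>.\<close>

lemma x_self_in_J:
  assumes "G \<in> \<L>" "G \<noteq> {}" "{K \<in> \<L>. K \<noteq> {} \<and> \<not> K \<subseteq> G} \<subseteq> \<K>" "{K \<in> \<L>. K \<noteq> {} \<and> K \<subset> G} \<subseteq> \<K>"
  shows "x G \<in> J \<K>"
proof -
  obtain i where i: "i \<in> G"
    using assms by blast
  have "x {} * (\<Sum>L\<in>{G}. x L) * 1 \<in> J \<K>"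
  proof (rule expand[OF subspace_J N_subset_J empty_flat, of i])
    fix L assume L: "L \<in> \<L>" "{} \<subset> L" "i \<in> L" "L \<notin> {G}"
    have "L \<in> \<K>"
    proof (cases "L \<subseteq> G")
      case True
      hence "L \<in> {K \<in> \<L>. K \<noteq> {} \<and> K \<subset> G}"
        using L by auto
      thus ?thesis
        using assms(4) by (rule subsetD[rotated])
    next
      case False
      hence "L \<in> {K \<in> \<L>. K \<noteq> {} \<and> \<not> K \<subseteq> G}"
        using L by auto
      thus ?thesis
        using assms(3) by (rule subsetD[rotated])
    qed
    thus "x {} * x L * 1 \<in> J \<K>"
      by (simp add: x_in_J)
  qed (use i assms(1) flat_subset in auto)
  thus ?thesis
    by simp
qed

lemma J_all_but_self:
  assumes "G \<in> \<L>" "G \<noteq> {}" "\<L> - {{}, G} \<subseteq> \<K>" "\<K> \<subseteq> \<L> - {{}}"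
  shows "J \<K> = J (\<L> - {{}})"
proof
  show "J \<K> \<subseteq> J (\<L> - {{}})"
    by (rule J_mono[OF assms(4)])
  have "x G \<in> J \<K>"
    using assms by (intro x_self_in_J) auto
  hence "J (insert G \<K>) = J \<K>"
    by (rule J_insert_absorb)
  moreover have "J (\<L> - {{}}) \<subseteq> J (insert G \<K>)"
    using assms by (intro J_mono) auto
  ultimately show "J (\<L> - {{}}) \<subseteq> J \<K>"
    by simp
qed

text \<open>In rank above one take the rank one flat \<open>A\<close> of an element \<open>i\<close>
  of \<open>F\<close>. Every other flat containing \<open>i\<close>, except \<open>F\<close>, is
  above \<open>A\<close> and killed by \<open>x F ^ k * w\<close>, so \<open>x F ^ n * w\<close> is
  up to sign a multiplier of \<open>A\<close>.\<close>

lemma socle_multiplier_constant: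
  assumes w: "socle_multiplier F w" and n: "Suc n = rk F" and c: "c * (x F ^ n * w) \<in> N"
    and flags: "\<forall>\<sigma>. \<sigma> \<subseteq> \<L> - {{}, E} \<longrightarrow> (\<forall>F\<in>\<sigma>. \<forall>G\<in>\<sigma>. F \<subseteq> G \<or> G \<subseteq> F) \<longrightarrow> Suc (card \<sigma>) = rk E \<longrightarrow>
        c * (\<Prod>F\<in>\<sigma>. x F) \<notin> N"
  shows False
proof (cases n)
  case 0
  thus ?thesis
    using assms by (intro socle_multiplier_atom_nonzero[OF w _ _ flags]) auto
next
  case (Suc k)
  have F: "F \<in> \<L>" "F \<noteq> {}"
    using w n socle_multiplier_flat by auto
  then obtain i where i: "i \<in> F" "i \<in> E"
    using flat_subset by blast
  hence "i \<in> E - {}"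
    by simp
  from cover[OF empty_flat this] obtain A where A: "A \<in> \<L>" "i \<in> A" "rk A = 1"
    "\<forall>H\<in>\<L>. i \<in> H \<longrightarrow> A \<subseteq> H"
    by (metis One_nat_def empty_subsetI rk_empty)
  have AF: "A \<subset> F"
    using A i F n Suc by (auto simp: psubset_eq)
  have wA: "socle_multiplier A (x A * x F ^ k * w)"
    using w A(1) _ AF by (rule socle_multiplier.step) (use A n Suc in auto)
  have "x {} * (\<Sum>L\<in>{A, F}. x L) * (x F ^ k * w) \<in> N"
  proof (rule expand[OF subspace_N subset_refl empty_flat i(2)])
    fix L assume L: "L \<in> \<L>" "{} \<subset> L" "i \<in> L" "L \<notin> {A, F}"
    hence "A \<subset> L"
      using A by auto
    hence "L \<in> killed k F"
      using L A n Suc rk_less[of A L] by (auto simp: killed_def)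
    hence "x L * (x F ^ k * w) \<in> N"
      by (rule socle_multiplier_kill[OF w])
    thus "x {} * x L * (x F ^ k * w) \<in> N"
      by simp
  qed (use A i F in auto)
  moreover have "x {} * (\<Sum>L\<in>{A, F}. x L) * (x F ^ k * w) = x A * x F ^ k * w + x F ^ n * w"
    using AF Suc by (simp add: algebra_simps)
  ultimately have "c * (x A * x F ^ k * w + x F ^ n * w) \<in> N"
    by (metis N_closed(3))
  from N_closed(5)[OF this c] have "c * (x A * x F ^ k * w) \<in> N"
    by (simp add: algebra_simps)
  thus ?thesis
    using socle_multiplier_atom_nonzero[OF wA A(3) _ flags] by blast
qed

section \<open>The annihilators of the multipliers\<close>

lemma J_killed_Suc:
  "F \<in> \<L> \<Longrightarrow> killed (Suc n) F = killed n F \<union> {H \<in> \<L>. H \<subset> F \<and> Suc (rk H + n) = rk F}"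
  by (auto simp: killed_def)

text \<open>Distinct flats of one rank are incomparable, so the factor \<open>x H\<close> removes
  all summands but its own.\<close>

lemma sum_incomparable_mult:
  assumes "Q \<subseteq> \<L>" "H \<in> Q" "\<And>K. K \<in> Q \<Longrightarrow> rk K = rk H"
  shows "(\<Sum>K\<in>Q. c K * x K) * x H - c H * x H * x H \<in> N"
proof -
  have fin: "finite Q"
    using assms(1) finite_flats finite_subset by blast
  have "(\<Sum>K\<in>Q. c K * x K) * x H - c H * x H * x H = (\<Sum>K\<in>Q - {H}. c K * (x K * x H))"
    using fin assms(2)
    by (simp add: sum.remove[of Q H] distrib_right sum_distrib_right mult.assoc)
  also have "\<dots> \<in> N"
  proof (rule rmod.subspace_sum[OF subspace_N])
    fix K assume K: "K \<in> Q - {H}"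
    have "rk K = rk H" "K \<in> \<L>" "H \<in> \<L>" "K \<noteq> H"
      using K assms(1,2) assms(3)[of K] by auto
    hence "\<not> K \<subseteq> H" "\<not> H \<subseteq> K"
      using flat_eqI[of K H] flat_eqI[of H K] by auto
    hence "x K * x H \<in> N"
      using K assms(1,2) by (intro incomparable) auto
    thus "c K * (x K * x H) \<in> N"
      by (rule N_closed(3))
  qed
  finally show ?thesis .
qed

text \<open>The reverse inclusion is \<open>J_killed_mult\<close>. Multiplying by \<open>x F\<close>
  raises the exponent, so \<open>r\<close> is known up to variables of flats \<open>H\<close> of
  corank \<open>Suc n\<close>. Their coefficients are isolated one at a time by multiplying with
  \<open>x H\<close>, which produces a multiplier of the smaller flat \<open>H\<close>. Then
  \<open>reduce\<close> turns all these terms into a multiple of \<open>x F\<close>, and the larger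
  exponent is applied once more, to the coefficient of \<open>x F\<close>.\<close>

theorem annihilator_socle_multiplier:
  "socle_multiplier F w \<Longrightarrow> r * (x F ^ n * w) \<in> N \<Longrightarrow> r \<in> J (killed n F)"
proof (induction "rk F" arbitrary: F w r n rule: less_induct)
  case less
  note outer = less.hyps and w = less.prems(1)
  have F: "F \<in> \<L>"
    using w socle_multiplier_flat by blast
  show ?case
    using less.prems(2)
  proof (induction "rk F - n" arbitrary: r n rule: less_induct)
    case less
    note Jn = subspace_J[of "killed n F"] N_subset_J[of "killed n F"]
    have hyp1: "x K * 1 \<in> J (killed n F)" if "K \<in> killed n F" for K
      using x_in_J that by simp
    consider "rk F \<le> n" | "rk F = Suc n" | "Suc n < rk F"
      by linarith
    thus ?case
    proof cases
      case a: 1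
      show ?thesis
      proof (cases "F = {}")
        \<comment> \<open>The rule \<open>step\<close> leads to nonempty flats only, so here
          \<open>E\<close> is empty and \<open>w\<close> is 1.\<close>
        case True
        hence "w = 1"
          using w by (auto elim: socle_multiplier.cases)
        hence "r \<in> N"
          using less.prems True by simp
        thus ?thesis
          using N_subset_J by auto
      next
        case False
        hence "{} \<in> killed n F"
          using a by (auto simp: killed_def)
        from x_in_J[OF this] have "r * 1 \<in> J (killed n F)"
          using J_closed(3) by (metis x_empty)
        thus ?thesis
          by simp
      qed
    next
      case b: 2
      obtain c where c: "r - c \<in> J (\<L> - {{}})"
        and flags: "c = 0 \<or> (\<forall>\<sigma>. \<sigma> \<subseteq> \<L> - {{}, E} \<longrightarrow> (\<forall>F\<in>\<sigma>. \<forall>G\<in>\<sigma>. F \<subseteq> G \<or> G \<subseteq> F) \<longrightarrow>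
          Suc (card \<sigma>) = rk E \<longrightarrow> c * (\<Prod>F\<in>\<sigma>. x F) \<notin> N)"
        using constant_part[of r] unfolding J_def by blast
      \<comment> \<open>At this exponent the only missing nonempty flat is \<open>F\<close>, and its
        variable is redundant.\<close>
      have "killed n F = \<L> - {{}, F}"
        using b rk_pos F rk_less[of _ F] by (force simp: killed_def)
      hence "\<L> - {{}, F} \<subseteq> killed n F" "killed n F \<subseteq> \<L> - {{}}"
        by blast+
      moreover have "F \<noteq> {}"
        using b by auto
      ultimately have eq: "J (killed n F) = J (\<L> - {{}})"
        by (intro J_all_but_self[OF F])
      have "(r - c) * (x F ^ n * w) \<in> N"
        using J_killed_mult[OF w] c eq by simp
      from N_closed(5)[OF less.prems this] have "c * (x F ^ n * w) \<in> N"
        by (simp add: algebra_simps)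
      hence "c = 0"
        using flags socle_multiplier_constant[OF w b[symmetric]] by blast
      thus ?thesis
        using c eq by simp
    next
      case c: 3
      let ?Q = "{H \<in> \<L>. H \<subset> F \<and> Suc (rk H + n) = rk F}"
      have IH_trunc: "r' \<in> J (killed (Suc n) F)" if "r' * (x F ^ Suc n * w) \<in> N" for r'
        using c by (intro less.hyps[OF _ that]) auto
      have "x F * (r * (x F ^ n * w)) \<in> N"
        by (rule N_closed(3)[OF less.prems])
      hence "r * (x F ^ Suc n * w) \<in> N"
        by (simp add: ac_simps)
      hence "r \<in> J (killed n F \<union> ?Q)"
        using IH_trunc J_killed_Suc[OF F] by auto
      then obtain d where d: "r - (\<Sum>H\<in>?Q. d H * x H) \<in> J (killed n F)"
        by (rule J_decompose) auto
      have "\<forall>H\<in>?Q. \<exists>t. d H * x H - t * x F \<in> J (killed n F)"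
      proof
        fix H assume H: "H \<in> ?Q"
        have Hne: "H \<noteq> {}"
          using H c by auto
        hence wH: "socle_multiplier H (x H * x F ^ n * w)"
          using H w by (intro socle_multiplier.step) auto
        have "(r - (\<Sum>H\<in>?Q. d H * x H)) * (x F ^ n * w) \<in> N"
          by (rule J_killed_mult[OF w d])
        from N_closed(5)[OF less.prems this] have "(\<Sum>H\<in>?Q. d H * x H) * (x F ^ n * w) \<in> N"
          by (simp add: left_diff_distrib)
        hence a: "x H * ((\<Sum>H\<in>?Q. d H * x H) * (x F ^ n * w)) \<in> N"
          by (rule N_closed(3))
        have "(\<Sum>H\<in>?Q. d H * x H) * x H - d H * x H * x H \<in> N"
          using H by (intro sum_incomparable_mult) auto
        hence "((\<Sum>H\<in>?Q. d H * x H) * x H - d H * x H * x H) * (x F ^ n * w) \<in> N"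
          by (rule N_closed(4))
        \<comment> \<open>Of the two factors \<open>x H\<close>, one belongs to the multiplier of
          \<open>H\<close>; the other is the exponent 1 for the outer induction.\<close>
        from N_closed(5)[OF a this] have "d H * (x H ^ 1 * (x H * x F ^ n * w)) \<in> N"
          by (simp add: algebra_simps)
        hence "d H \<in> J (killed 1 H)"
          using rk_less[of H F] H F by (intro outer[OF _ wH]) auto
        from reduce[OF Jn F hyp1 _ _ _ this] H obtain t where
          "d H * x H * 1 - t * x F * 1 \<in> J (killed n F)"
          by blast
        thus "\<exists>t. d H * x H - t * x F \<in> J (killed n F)"
          by auto
      qed
      from bchoice[OF this] obtain t where
        t: "\<forall>H\<in>?Q. d H * x H - t H * x F \<in> J (killed n F)"
        by blast
      let ?s = "\<Sum>H\<in>?Q. t H"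
      have "(\<Sum>H\<in>?Q. d H * x H - t H * x F) \<in> J (killed n F)"
        by (intro rmod.subspace_sum[OF subspace_J] bspec[OF t])
      from J_closed(2)[OF d this] have r: "r - ?s * x F \<in> J (killed n F)"
        by (simp add: sum_subtractf sum_distrib_right)
      from N_closed(5)[OF less.prems J_killed_mult[OF w this]] have "?s * (x F ^ Suc n * w) \<in> N"
        by (simp add: algebra_simps)
      hence s: "?s \<in> J (killed (Suc n) F)"
        by (rule IH_trunc)
      have "x K * x F \<in> J (killed n F)" if "K \<in> killed (Suc n) F" for K
        using kill_step[OF Jn F hyp1 that] by simp
      from J_mult_subset[OF Jn this s] have "?s * x F \<in> J (killed n F)" .
      from J_closed(2)[OF r this] show ?thesis
        by simp
    qed
  qed
qed

section \<open>Membership in ideals generated by coatoms\<close>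

lemma power_kill:
  assumes "G \<in> \<L>" "K \<in> killed n G"
  shows "x K * x G ^ n \<in> J (killed 0 G)"
proof -
  have "x K * x G ^ n * 1 \<in> J (killed 0 G)"
    using assms x_in_J by (intro kill[OF subspace_J N_subset_J, of G 0]) auto
  thus ?thesis
    by simp
qed

lemma J_killed_power:
  assumes "G \<in> \<L>" "r \<in> J (killed n G)"
  shows "r * x G ^ n \<in> J (killed 0 G)"
  using power_kill[OF assms(1)] by (intro J_mult_subset[OF subspace_J N_subset_J _ assms(2)])

text \<open>With \<open>x K\<close> in \<open>B\<close>, flats below \<open>K\<close> need one power
  of \<open>x G\<close> less than in \<open>power_kill\<close>. In the relation of \<open>i\<close>
  in \<open>K - M\<close>, the flats inside \<open>K\<close> are covered by induction. A flat
  \<open>L\<close> inside \<open>G\<close> but not inside \<open>K\<close> has rank at least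
  \<open>rk M + 2\<close>, because \<open>L \<inter> K\<close> lies strictly between
  \<open>M\<close> and \<open>L\<close>; so the power kills it.\<close>

lemma power_below_coatom:
  assumes G: "G \<in> \<L>" and K: "K \<in> \<L>" "K \<subset> G" "Suc (rk K) = rk G"
    and B: "rmod.subspace B" "J (killed 0 G) \<subseteq> B" "x K \<in> B"
  shows "M \<in> \<L> \<Longrightarrow> M \<subseteq> K \<Longrightarrow> rk G \<le> Suc (rk M + n) \<Longrightarrow> x M * x G ^ n \<in> B"
proof (induction n arbitrary: M)
  case 0
  hence "M = K"
    using K by (intro flat_eqI) auto
  thus ?case
    using B by simp
next
  case (Suc n)
  have NB: "N \<subseteq> B"
    using N_subset_J B(2) by blast
  show ?case
  proof (cases "M = K")
    case True
    thus ?thesis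
      using rmod_subspaceD(4)[OF B(1) B(3)] by simp
  next
    case False
    then obtain i where i: "i \<in> K" "i \<notin> M"
      using Suc.prems by blast
    have "x M * (\<Sum>L\<in>{G}. x L) * x G ^ n \<in> B"
    proof (rule expand[OF B(1) NB Suc.prems(1) _ i(2)])
      fix L assume L: "L \<in> \<L>" "M \<subset> L" "i \<in> L" "L \<notin> {G}"
      have rkL: "rk M < rk L"
        using L Suc.prems rk_less by auto
      have "x L * x G ^ n \<in> B"
      proof (cases "L \<subseteq> K")
        case True
        thus ?thesis
          using L rkL Suc.prems by (intro Suc.IH) auto
      next
        case nLK: False
        have "L \<in> killed n G"
        proof (cases "L \<subseteq> G")
          case True
          have "M \<subset> L \<inter> K"
            using L i Suc.prems by auto
          hence "rk M < rk (L \<inter> K)"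
            using L Suc.prems K Int_flat by (intro rk_less) auto
          moreover have "rk (L \<inter> K) < rk L"
            using L K nLK by (intro rk_less Int_flat) auto
          ultimately show ?thesis
            using L Suc.prems True by (auto simp: killed_def)
        qed (use L in \<open>auto simp: killed_def\<close>)
        thus ?thesis
          using power_kill[OF G] B(2) by blast
      qed
      hence "x M * (x L * x G ^ n) \<in> B"
        by (rule rmod_subspaceD(3)[OF B(1)])
      thus "x M * x L * x G ^ n \<in> B"
        by (simp only: mult.assoc)
    qed (use i K G Suc.prems flat_subset in auto)
    thus ?thesis
      by (simp add: mult.assoc)
  qed
qed

text \<open>The hypothesis tests \<^term>\<open>r\<close> against the variables that annihilate all coatoms in
  \<^term>\<open>T\<close>; the proof pushes \<^term>\<open>r\<close> into ever higher powers of \<^term>\<open>x G\<close>.\<close>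

lemma coatom_ideal_test:
  assumes w: "socle_multiplier G w"
    and T: "T \<subseteq> {K \<in> \<L>. K \<subset> G \<and> Suc (rk K) = rk G}"
    and test: "\<And>L. L \<in> \<L> \<Longrightarrow> L \<subseteq> G \<Longrightarrow> (\<And>K. K \<in> T \<Longrightarrow> \<not> L \<subseteq> K) \<Longrightarrow> r * x L * w \<in> N"
  shows "r \<in> J (killed 0 G \<union> T)"
proof (cases "T = {}")
  case True
  have "r * (x G ^ 0 * w) \<in> N"
    using test[OF empty_flat] True by simp
  thus ?thesis
    using annihilator_socle_multiplier[OF w] True by simp
next
  case False
  have G: "G \<in> \<L>"
    using w socle_multiplier_flat by blast
  let ?B = "J (killed 0 G \<union> T)"
  note B = subspace_J[of "killed 0 G \<union> T"] and B_closed = J_closed[where \<K> = "killed 0 G \<union> T"]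
  have J0: "J (killed 0 G) \<subseteq> ?B"
    by (intro J_mono) auto
  \<comment> \<open>Elements of the target ideal pass the test themselves, so the test carries over
    to what remains of \<open>r\<close> after subtracting them.\<close>
  have B_test: "b * x L * w \<in> N"
    if b: "b \<in> ?B" and L: "L \<in> \<L>" "L \<subseteq> G" "\<And>K. K \<in> T \<Longrightarrow> \<not> L \<subseteq> K" for b L
  proof -
    have "x K * (x L * w) \<in> N" if "K \<in> killed 0 G \<union> T" for K
    proof (cases "K \<in> killed 0 G")
      case True
      from N_closed(3)[OF socle_multiplier_kill0[OF w this], of "x L"] show ?thesis
        by (simp add: ac_simps)
    next
      case False
      hence K: "K \<in> T" "K \<in> \<L>" "K \<subset> G" "Suc (rk K) = rk G"
        using that T by auto
      show ?thesis
      proof (cases "K \<subseteq> L")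
        case True
        have "L = G"
        proof (intro flat_eqI G L)
          have "K \<subset> L"
            using True L(3)[OF K(1)] by auto
          thus "rk G \<le> rk L"
            using K(4) rk_less[OF K(2) L(1)] by simp
        qed
        moreover have "K \<in> killed 1 G"
          using K by (auto simp: killed_def)
        ultimately show ?thesis
          using socle_multiplier_kill[OF w, of K 1] by simp
      next
        case False
        hence "x K * x L \<in> N"
          using K L by (intro incomparable) auto
        from N_closed(4)[OF this, of w] show ?thesis
          by (simp add: mult.assoc)
      qed
    qed
    from J_mult_subset[OF subspace_N subset_refl this b] show ?thesis
      by (simp add: mult.assoc)
  qed
  have "\<exists>s. r - s * x G ^ n \<in> ?B" if "n \<le> rk G" for n
    using that
  proof (induction n)
    case 0
    show ?case
      using B_closed(1) by (intro exI[of _ r]) simp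
  next
    case (Suc n)
    then obtain s where s: "r - s * x G ^ n \<in> ?B"
      by auto
    have test_s: "s * x G ^ n * x L * w \<in> N"
      if L: "L \<in> \<L>" "L \<subseteq> G" "\<And>K. K \<in> T \<Longrightarrow> \<not> L \<subseteq> K" for L
      using N_closed(5)[OF test[OF L] B_test[OF s L]] by (simp add: algebra_simps)
    \<comment> \<open>\<open>G\<close> is an admissible test flat, being contained in none of its
      coatoms.\<close>
    have "s * x G ^ n * x G * w \<in> N"
      using T by (intro test_s G) auto
    hence "s * (x G ^ Suc n * w) \<in> N"
      by (simp add: ac_simps)
    hence "s \<in> J (killed (Suc n) G)"
      by (rule annihilator_socle_multiplier[OF w])
    let ?Q = "{H \<in> \<L>. H \<subset> G \<and> Suc (rk H + n) = rk G}"
    obtain d where d: "s - (\<Sum>M\<in>?Q. d M * x M) \<in> J (killed n G)"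
      by (rule J_decompose[of s "killed n G" ?Q]) (use \<open>s \<in> _\<close> J_killed_Suc[OF G] in auto)
    have "(s - (\<Sum>M\<in>?Q. d M * x M)) * x G ^ n \<in> ?B"
      using J_killed_power[OF G d] J0 by blast
    from B_closed(2)[OF s this] have r: "r - (\<Sum>M\<in>?Q. d M * x M) * x G ^ n \<in> ?B"
      by (simp add: algebra_simps)
    have "\<exists>t. d M * x M * x G ^ n - t * x G ^ Suc n \<in> ?B" (is "?P M") if M: "M \<in> ?Q" for M
    proof (cases "\<exists>K\<in>T. M \<subseteq> K")
      case True
      then obtain K where K: "K \<in> T" "M \<subseteq> K"
        by blast
      have "x M * x G ^ n \<in> ?B"
        using K T M by (intro power_below_coatom[OF G _ _ _ B J0 x_in_J, of K]) auto
      from B_closed(3)[OF this, of "d M"] show ?thesis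
        by (intro exI[of _ 0]) (simp add: mult.assoc)
    next
      \<comment> \<open>Now \<open>M\<close> is itself an admissible test flat, and its coefficient
        can be isolated.\<close>
      case nle: False
      have wM: "socle_multiplier M (x M * x G ^ n * w)"
        using M w nle False by (intro socle_multiplier.step) auto
      have a: "r * x M * w \<in> N"
        using M nle by (intro test) auto
      have "(r - (\<Sum>M\<in>?Q. d M * x M) * x G ^ n) * x M * w \<in> N"
        using M nle by (intro B_test[OF r]) auto
      from N_closed(5)[OF a this] have b: "(\<Sum>M\<in>?Q. d M * x M) * x M * (x G ^ n * w) \<in> N"
        by (simp add: algebra_simps)
      have "(\<Sum>K\<in>?Q. d K * x K) * x M - d M * x M * x M \<in> N"
        using M by (intro sum_incomparable_mult) auto
      from N_closed(5)[OF b N_closed(4)[OF this, of "x G ^ n * w"]]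
      have "d M * (x M ^ 1 * (x M * x G ^ n * w)) \<in> N"
        by (simp add: algebra_simps)
      hence "d M \<in> J (killed 1 M)"
        by (rule annihilator_socle_multiplier[OF wM])
      moreover have "x K * x G ^ n \<in> J (killed 0 G)" if "K \<in> killed n G" for K
        by (rule power_kill[OF G that])
      ultimately obtain t where "d M * x M * x G ^ n - t * x G * x G ^ n \<in> J (killed 0 G)"
        using reduce[OF subspace_J N_subset_J G, of n "x G ^ n" "killed 0 G" M "d M"] M by blast
      thus ?thesis
        using J0 by (intro exI[of _ t]) (auto simp: mult.assoc)
    qed
    hence "\<forall>M\<in>?Q. ?P M"
      by blast
    from bchoice[OF this] obtain t where
      t: "\<forall>M\<in>?Q. d M * x M * x G ^ n - t M * x G ^ Suc n \<in> ?B"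
      by blast
    have "(\<Sum>M\<in>?Q. d M * x M * x G ^ n - t M * x G ^ Suc n) \<in> ?B"
      by (intro rmod.subspace_sum[OF subspace_J] bspec[OF t])
    from B_closed(2)[OF r this] have "r - (\<Sum>M\<in>?Q. t M) * x G ^ Suc n \<in> ?B"
      by (simp add: sum_subtractf sum_distrib_right)
    thus ?case
      by blast
  qed
  then obtain s where s: "r - s * x G ^ rk G \<in> ?B"
    by blast
  \<comment> \<open>At exponent \<open>rk G\<close> the killed variables include
    \<open>x {} = 1\<close>, so the power itself lies in the ideal and the process ends.\<close>
  have "{} \<in> killed (rk G) G"
    using T False by (auto simp: killed_def)
  hence "x G ^ rk G \<in> ?B"
    using power_kill[OF G] J0 by fastforce
  from B_closed(2)[OF s B_closed(3)[OF this, of s]] show ?thesis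
    by simp
qed

end

section \<open>Colon ideals and the filtration\<close>

context chow_relations
begin

section \<open>The colon ideal of a single step\<close>

definition colon_flats :: "'a set \<Rightarrow> 'a set \<Rightarrow> 'a set set" where
  "colon_flats G A = {K \<in> \<L>. \<not> K \<subseteq> G} \<union> {K \<in> \<L>. K \<subset> G \<and> Suc (rk K) = rk G \<and> A \<subseteq> K}"

text \<open>Let \<open>L\<close> lie in \<open>G\<close> but in no coatom of \<open>G\<close>
  containing \<open>A\<close>, and multiply by \<open>x L * x F ^ n * v\<close>. The variables of
  \<open>killed n F\<close> vanish. So do those of \<open>S\<close>: if \<open>L\<close> were
  contained in a second flat \<open>K\<close> of the same rank with \<open>A\<close> inside, then
  \<open>L\<close> would lie in \<open>G \<inter> K\<close>, hence in a coatom of \<open>G\<close>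
  containing \<open>A\<close>. What remains is the hypothesis of
  \<open>coatom_ideal_test\<close>.\<close>

lemma colon_upper:
  assumes F: "F \<in> \<L>" and G: "G \<in> \<L>" "G \<noteq> {}" "G \<subset> F" "Suc (rk G + n) = rk F" "A \<subseteq> G"
    and S: "S \<subseteq> {H \<in> \<L>. H \<noteq> G \<and> rk H = rk G \<and> A \<subseteq> H}"
    and r: "r * x G \<in> J (killed n F \<union> S)"
  shows "r \<in> J (colon_flats G A)"
proof -
  have "F \<noteq> {}"
    using G by auto
  then obtain v where v: "socle_multiplier F v"
    using socle_multiplier_exists[OF F] by blast
  let ?w = "x G * x F ^ n * v" and ?T = "{K \<in> \<L>. K \<subset> G \<and> Suc (rk K) = rk G \<and> A \<subseteq> K}"
  have w: "socle_multiplier G ?w"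
    by (rule socle_multiplier.step[OF v G(1-4)])
  have "r \<in> J (killed 0 G \<union> ?T)"
  proof (rule coatom_ideal_test[OF w])
    fix L assume L: "L \<in> \<L>" "L \<subseteq> G" "\<And>K. K \<in> ?T \<Longrightarrow> \<not> L \<subseteq> K"
    have "x K * (x L * (x F ^ n * v)) \<in> N" if K: "K \<in> killed n F \<union> S" for K
    proof (cases "K \<in> killed n F")
      case True
      from N_closed(3)[OF socle_multiplier_kill[OF v this], of "x L"] show ?thesis
        by (simp add: ac_simps)
    next
      case False
      hence K: "K \<in> \<L>" "K \<noteq> G" "rk K = rk G" "A \<subseteq> K"
        using that S by auto
      have ne: "\<not> K \<subseteq> G" "\<not> G \<subseteq> K"
        using flat_eqI[OF K(1) G(1)] flat_eqI[OF G(1) K(1)] K by auto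
      have "\<not> L \<subseteq> K"
      proof
        assume "L \<subseteq> K"
        have "G \<inter> K \<in> \<L>" "G \<inter> K \<subset> G"
          using Int_flat[OF G(1) K(1)] ne by auto
        then obtain M where M: "M \<in> \<L>" "G \<inter> K \<subseteq> M" "M \<subset> G" "Suc (rk M) = rk G"
          using coatom_above[of "G \<inter> K" G] G(1) by blast
        hence "M \<in> ?T"
          using K(4) G(5) by auto
        from L(3)[OF this] show False
          using \<open>L \<subseteq> K\<close> L(2) M(2) by blast
      qed
      moreover have "\<not> K \<subseteq> L"
        using ne L(2) by blast
      ultimately have "x K * x L \<in> N"
        by (intro incomparable K(1) L(1))
      from N_closed(4)[OF this, of "x F ^ n * v"] show ?thesis
        by (simp add: mult.assoc)
    qed
    from J_mult_subset[OF subspace_N subset_refl this r] show "r * x L * ?w \<in> N"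
      by (simp add: ac_simps)
  qed auto
  thus ?thesis
    using killed_0[OF G(1)] by (simp add: colon_flats_def)
qed

text \<open>For a coatom \<open>K\<close> of \<open>G\<close> containing \<open>A\<close> two
  relations are combined. The flat spanned by \<open>K\<close> and \<open>m\<close> has the rank of
  \<open>G\<close> and contains \<open>insert m A\<close>, so it is present, and the relation of
  \<open>m\<close> puts \<open>x K * x F\<close> into the ideal. The relation of an element of
  \<open>G - K\<close> does the same for \<open>x K * x G + x K * x F\<close>. \<open>D\<close>
  marks flats that are to stay out; every flat required here contains \<open>G\<close> or
  \<open>insert m A\<close> and so is not inside \<open>D\<close>.\<close>

lemma colon_lower:
  assumes F: "F \<in> \<L>" and G: "G \<in> \<L>" "G \<subset> F" "Suc (rk G + n) = rk F" "A \<subseteq> G" "\<not> G \<subseteq> D"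
    and m: "m \<in> F" "m \<notin> G" "\<not> insert m A \<subseteq> D"
    and outside: "{K \<in> \<L>. \<not> K \<subseteq> F} \<subseteq> \<K>"
    and large: "{K \<in> killed n F. \<not> K \<subseteq> D} \<subseteq> \<K>"
    and level: "{H \<in> \<L>. H \<subset> F \<and> rk H = rk G \<and> insert m A \<subseteq> H} \<subseteq> \<K>"
    and r: "r \<in> J (colon_flats G A)"
  shows "r * x G \<in> J \<K>"
proof (rule J_mult_subset[OF subspace_J N_subset_J _ r])
  note BN = subspace_J[of \<K>] N_subset_J[of \<K>]
  have mE: "m \<in> E"
    using m F flat_subset by auto
  have above: "L \<in> \<K>" if L: "L \<in> \<L>" "rk G < rk L" "\<not> L \<subseteq> D" "L \<noteq> F" for L
  proof (cases "L \<subseteq> F")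
    case True
    hence "L \<in> killed n F"
      using L G(3) by (auto simp: killed_def)
    thus ?thesis
      using L large by blast
  next
    case False
    thus ?thesis
      using L outside by blast
  qed
  fix K assume "K \<in> colon_flats G A"
  then consider "K \<in> \<L>" "\<not> K \<subseteq> G" | "K \<in> \<L>" "K \<subset> G" "Suc (rk K) = rk G" "A \<subseteq> K"
    unfolding colon_flats_def by blast
  thus "x K * x G \<in> J \<K>"
  proof cases
    case K: 1
    show ?thesis
    proof (cases "G \<subseteq> K")
      case False
      thus ?thesis
        using incomparable[OF K(1) G(1) K(2)] N_subset_J by blast
    next
      case True
      hence GK: "G \<subset> K"
        using K by auto
      have "x K \<in> J \<K> \<or> K = F"
        using above[OF K(1) rk_less[OF G(1) K(1) GK]] GK G(5) x_in_J by blast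
      thus ?thesis
      proof
        assume "x K \<in> J \<K>"
        thus ?thesis
          by (rule J_closed(4))
      next
        assume KF: "K = F"
        have "x G * (\<Sum>L\<in>{F}. x L) * 1 \<in> J \<K>"
        proof (rule expand[OF BN G(1) mE m(2)])
          fix L assume L: "L \<in> \<L>" "G \<subset> L" "m \<in> L" "L \<notin> {F}"
          hence "L \<in> \<K>"
            using rk_less[OF G(1), of L] G(5) by (intro above) auto
          thus "x G * x L * 1 \<in> J \<K>"
            using J_closed(3)[OF x_in_J, of L \<K> "x G"] by simp
        qed (use F G m in auto)
        thus ?thesis
          using KF by (simp add: mult.commute)
      qed
    qed
  next
    case K: 2
    have mK: "m \<notin> K"
      using K m by auto
    hence "m \<in> E - K"
      using mE by blast
    from cover[OF K(1) this] obtain G' where G': "G' \<in> \<L>" "K \<subset> G'" "m \<in> G'" "rk G' = Suc (rk K)"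
      "\<forall>H\<in>\<L>. K \<subseteq> H \<longrightarrow> m \<in> H \<longrightarrow> G' \<subseteq> H"
      by meson
    have "G' \<subseteq> F"
      using G'(5) F K(2) G(2) m(1) by auto
    hence "G' \<subset> F"
      using G'(4) K(3) G(3) by auto
    hence "G' \<in> {H \<in> \<L>. H \<subset> F \<and> rk H = rk G \<and> insert m A \<subseteq> H}"
      using G'(1-4) K(3,4) by simp
    hence G'K: "G' \<in> \<K>"
      by (rule subsetD[OF level])
    have "x K * (\<Sum>L\<in>{F}. x L) * 1 \<in> J \<K>"
    proof (rule expand[OF BN K(1) mE mK])
      fix L assume L: "L \<in> \<L>" "K \<subset> L" "m \<in> L" "L \<notin> {F}"
      have sub: "G' \<subseteq> L"
        using G'(5) L by auto
      have "L \<in> \<K>"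
      proof (cases "L = G'")
        case True
        thus ?thesis
          using G'K by simp
      next
        case False
        hence "rk G' < rk L"
          using sub G' L by (intro rk_less) auto
        thus ?thesis
          using L G' K m(3) by (intro above) auto
      qed
      thus "x K * x L * 1 \<in> J \<K>"
        using J_closed(3)[OF x_in_J, of L \<K> "x K"] by simp
    qed (use F K G m in auto)
    hence KF: "x K * x F \<in> J \<K>"
      by simp
    obtain j where j: "j \<in> G" "j \<notin> K"
      using K by blast
    have "x K * (\<Sum>L\<in>{G, F}. x L) * 1 \<in> J \<K>"
    proof (rule expand[OF BN K(1) _ j(2)])
      fix L assume L: "L \<in> \<L>" "K \<subset> L" "j \<in> L" "L \<notin> {G, F}"
      have "K \<subset> L \<inter> G"
        using L j K by auto
      hence "rk K < rk (L \<inter> G)"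
        by (intro rk_less K Int_flat L G)
      hence "L \<inter> G = G"
        using K(3) by (intro flat_eqI Int_flat L G) auto
      hence GL: "G \<subset> L"
        using L by auto
      hence "L \<in> \<K>"
        using rk_less[OF G(1) L(1)] L G(5) by (intro above) auto
      thus "x K * x L * 1 \<in> J \<K>"
        using J_closed(3)[OF x_in_J, of L \<K> "x K"] by simp
    qed (use F K G j flat_subset in auto)
    hence "x K * x G + x K * x F \<in> J \<K>"
      using G(2) by (simp add: distrib_left)
    from J_closed(5)[OF this KF] show ?thesis
      by simp
  qed
qed

section \<open>The filtration in terms of sets of flats\<close>

definition proper_colon :: "'a set \<Rightarrow> 'a set \<Rightarrow> bool" where
  "proper_colon G A \<longleftrightarrow> G \<in> \<L> \<and> G \<noteq> {} \<and> A \<subseteq> G \<and> {} \<notin> colon_flats G A"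

text \<open>The rule \<open>absorb\<close> changes the generating set but not the ideal; it serves
  redundant variables. In \<open>extend\<close> the colon ideal is kept in a form that the rules
  reach again. The case excluded by \<open>proper_colon\<close>, \<open>A = {}\<close> with
  \<open>G\<close> of rank one, has the unit ideal as colon ideal, so \<open>x G\<close> is already
  present and \<open>absorb\<close> applies.\<close>

inductive filtration_flats :: "'a set set \<Rightarrow> bool" where
  empty: "filtration_flats {}"
| absorb: "filtration_flats \<K> \<Longrightarrow> G \<in> \<L> \<Longrightarrow> G \<noteq> {} \<Longrightarrow> x G \<in> J \<K> \<Longrightarrow>
    filtration_flats (insert G \<K>)"
| extend: "filtration_flats \<K> \<Longrightarrow> G \<in> \<L> \<Longrightarrow> G \<noteq> {} \<Longrightarrow> proper_colon G A \<Longrightarrow>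
    (\<And>r. r * x G \<in> J \<K> \<longleftrightarrow> r \<in> J (colon_flats G A)) \<Longrightarrow> filtration_flats (insert G \<K>)"

lemma filtration_flats_subset: "filtration_flats \<K> \<Longrightarrow> \<K> \<subseteq> \<L> - {{}}"
  by (induction rule: filtration_flats.induct) auto

text \<open>The state of the construction below \<open>F\<close>: complete down to corank
  \<open>n\<close>, and on the next level only the flats containing \<open>A\<close>. Leaving out
  the flats inside \<open>D\<close> allows two uses: \<open>F = E\<close> and \<open>D = G\<close>
  yields the flats not contained in \<open>G\<close>, while \<open>D = {}\<close> leaves out the
  empty flat alone.\<close>

definition stage :: "'a set \<Rightarrow> 'a set \<Rightarrow> nat \<Rightarrow> 'a set \<Rightarrow> 'a set set" where
  "stage F D n A = {K \<in> \<L>. \<not> K \<subseteq> F} \<union> {K \<in> killed n F. \<not> K \<subseteq> D} \<union>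
    {H \<in> \<L>. H \<subset> F \<and> Suc (rk H + n) = rk F \<and> A \<subseteq> H \<and> \<not> H \<subseteq> D}"

text \<open>The colon ideals do not depend on the order in which the flats containing
  \<open>A\<close> but not \<open>m\<close> are adjoined: the lower bound needs only the initial
  stage, and the upper bound tolerates all other flats of this rank containing
  \<open>A\<close>.\<close>

lemma stage_extend:
  assumes F: "F \<in> \<L>" and m: "m \<in> F" "m \<notin> A" "A \<subseteq> F" "\<not> insert m A \<subseteq> D"
    and start: "filtration_flats (stage F D n (insert m A))"
  shows "filtration_flats (stage F D n A)"
proof -
  let ?Q = "{H \<in> \<L>. H \<subset> F \<and> Suc (rk H + n) = rk F \<and> A \<subseteq> H \<and> m \<notin> H \<and> \<not> H \<subseteq> D}"
  have "finite P \<Longrightarrow> P \<subseteq> ?Q \<Longrightarrow> filtration_flats (stage F D n (insert m A) \<union> P)" for P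
  proof (induction P rule: finite_induct)
    case empty
    thus ?case
      using start by simp
  next
    case (insert G P)
    let ?K = "stage F D n (insert m A) \<union> P"
    have fam: "filtration_flats ?K"
      using insert by auto
    have G: "G \<in> \<L>" "G \<subset> F" "Suc (rk G + n) = rk F" "A \<subseteq> G" "m \<notin> G" "\<not> G \<subseteq> D" "G \<noteq> {}"
      using insert.prems by auto
    have lower: "r * x G \<in> J ?K" if "r \<in> J (colon_flats G A)" for r
    proof (rule colon_lower[OF F G(1-4,6) m(1) G(5) m(4) _ _ _ that])
      have "H \<in> ?K" if H: "H \<in> \<L>" "H \<subset> F" "rk H = rk G" "insert m A \<subseteq> H" for H
      proof -
        have "\<not> H \<subseteq> D"
          using H(4) m(4) by auto
        thus ?thesis
          using H G(3) unfolding stage_def by simp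
      qed
      thus "{H \<in> \<L>. H \<subset> F \<and> rk H = rk G \<and> insert m A \<subseteq> H} \<subseteq> ?K"
        by blast
    qed (auto simp: stage_def)
    have upper: "r \<in> J (colon_flats G A)" if r: "r * x G \<in> J ?K" for r
    proof (rule colon_upper[OF F G(1,7,2,3,4)])
      let ?S = "{H \<in> \<L>. H \<noteq> G \<and> rk H = rk G \<and> A \<subseteq> H}"
      have "H \<in> killed n F \<union> ?S" if "H \<in> stage F D n (insert m A)" for H
      proof -
        have "H \<noteq> G" if "insert m A \<subseteq> H"
          using that G(5) by auto
        thus ?thesis
          using that G(3) unfolding stage_def by (auto simp: killed_def)
      qed
      moreover have "H \<in> ?S" if "H \<in> P" for H
      proof -
        have "H \<in> ?Q" "H \<noteq> G"
          using that insert.hyps insert.prems by auto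
        thus ?thesis
          using G(3) by simp
      qed
      ultimately have "?K \<subseteq> killed n F \<union> ?S"
        by blast
      thus "r * x G \<in> J (killed n F \<union> ?S)"
        using r J_mono by blast
    qed simp
    have "filtration_flats (insert G ?K)"
    proof (cases "{} \<in> colon_flats G A")
      \<comment> \<open>The colon ideal contains \<open>x {} = 1\<close>, so \<open>x G\<close> is
        already in the ideal.\<close>
      case True
      hence "1 * x G \<in> J ?K"
        using x_in_J[OF True] by (intro lower) simp
      thus ?thesis
        using fam G by (intro absorb) auto
    next
      case False
      hence "proper_colon G A"
        using G by (simp add: proper_colon_def)
      thus ?thesis
        using fam G upper lower by (intro extend[of _ _ A]) blast+
    qed
    thus ?case
      by simp
  qed
  moreover have "finite ?Q"
    by simp
  ultimately have "filtration_flats (stage F D n (insert m A) \<union> ?Q)"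
    by blast
  moreover have "stage F D n (insert m A) \<union> ?Q = stage F D n A"
    unfolding stage_def by blast
  ultimately show ?thesis
    by simp
qed

text \<open>Elements are dropped from \<open>A = F\<close>, which is contained in no flat of the new
  level. The lower bound requires that \<open>insert m A\<close> is not inside \<open>D\<close>:
  this holds for any \<open>m\<close> if it holds for \<open>A\<close>, and for empty
  \<open>A\<close> one takes \<open>m\<close> in \<open>F - D\<close>.\<close>

lemma stage_level:
  assumes F: "F \<in> \<L>" and D: "D \<subset> F" and start: "filtration_flats (stage F D n F)"
  shows "A \<subseteq> F \<Longrightarrow> A = {} \<or> \<not> A \<subseteq> D \<Longrightarrow> filtration_flats (stage F D n A)"
proof (induction "card (F - A)" arbitrary: A rule: less_induct)
  case less
  have fin: "finite F"
    using F flat_subset finite_E finite_subset by blast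
  show ?case
  proof (cases "A = F")
    case True
    thus ?thesis
      using start by simp
  next
    case False
    obtain m where m: "m \<in> F" "m \<notin> A" "\<not> insert m A \<subseteq> D"
      using False less.prems D by blast
    have "F - insert m A \<subset> F - A"
      using m by auto
    hence "card (F - insert m A) < card (F - A)"
      using fin by (intro psubset_card_mono) auto
    hence "filtration_flats (stage F D n (insert m A))"
      using m less.prems by (intro less.hyps) auto
    thus ?thesis
      by (rule stage_extend[OF F m(1,2) less.prems(1) m(3)])
  qed
qed

lemma stage_all:
  assumes F: "F \<in> \<L>" and D: "D \<subset> F" and start: "filtration_flats (stage F D 0 F)"
  shows "filtration_flats (stage F D n F)"
proof (induction n)
  case (Suc n)
  \<comment> \<open>A full level is the initial stage of the next one.\<close>
  have "stage F D n {} = stage F D (Suc n) F"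
    unfolding stage_def J_killed_Suc[OF F] by auto
  thus ?case
    using stage_level[OF F D Suc, of "{}"] by simp
qed (rule start)

text \<open>Run the stages with \<open>F = E\<close> and \<open>D = G\<close> through all coranks.
  \<open>E\<close> comes last and is absorbed: in the relation of an element outside
  \<open>G\<close> it is the only flat not yet present.\<close>

lemma filtration_flats_above:
  assumes G: "G \<in> \<L>" "G \<noteq> {}"
  shows "filtration_flats {K \<in> \<L>. \<not> K \<subseteq> G}"
proof (cases "G = E")
  case True
  hence "{K \<in> \<L>. \<not> K \<subseteq> G} = {}"
    using flat_subset by auto
  thus ?thesis
    using filtration_flats.empty by metis
next
  case False
  hence GE: "G \<subset> E"
    by (rule psubsetI[OF flat_subset[OF G(1)]])
  have "stage E G 0 E = {}"
    unfolding stage_def killed_0[OF ground_flat] using flat_subset by auto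
  hence "filtration_flats (stage E G (rk E) E)"
    using stage_all[OF ground_flat GE] filtration_flats.empty by simp
  moreover have "stage E G (rk E) E = {K \<in> \<L>. \<not> K \<subseteq> G} - {E}"
    unfolding stage_def killed_def using flat_subset by auto
  ultimately have fam: "filtration_flats ({K \<in> \<L>. \<not> K \<subseteq> G} - {E})"
    by simp
  obtain e where e: "e \<in> E" "e \<notin> G"
    using GE by blast
  let ?K = "{K \<in> \<L>. \<not> K \<subseteq> G} - {E}"
  have "x {} * (\<Sum>L\<in>{E}. x L) * 1 \<in> J ?K"
  proof (rule expand[OF subspace_J N_subset_J empty_flat e(1)])
    fix L assume "L \<in> \<L>" "{} \<subset> L" "e \<in> L" "L \<notin> {E}"
    hence "L \<in> ?K"
      using e by auto
    thus "x {} * x L * 1 \<in> J ?K"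
      by (simp add: x_in_J)
  qed (use e in auto)
  hence "filtration_flats (insert E ?K)"
    using fam e by (intro absorb) auto
  moreover have "insert E ?K = {K \<in> \<L>. \<not> K \<subseteq> G}"
    using GE by auto
  ultimately show ?thesis
    by simp
qed

text \<open>One partial level below \<open>G\<close> on top of the flats not contained in
  \<open>G\<close>. By properness, leaving out the empty flat loses nothing.\<close>

lemma filtration_flats_colon:
  assumes "proper_colon G A"
  shows "filtration_flats (colon_flats G A)"
proof -
  have G: "G \<in> \<L>" "G \<noteq> {}" "A \<subseteq> G" "{} \<notin> colon_flats G A"
    using assms by (auto simp: proper_colon_def)
  have "stage G {} 0 G = {K \<in> \<L>. \<not> K \<subseteq> G}"
    unfolding stage_def killed_0[OF G(1)] by auto
  hence "filtration_flats (stage G {} 0 G)"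
    using filtration_flats_above[OF G(1,2)] by simp
  hence "filtration_flats (stage G {} 0 A)"
    using stage_level[OF G(1) _ _ G(3), of "{}" 0] G(2) by blast
  moreover have "stage G {} 0 A = colon_flats G A"
  proof -
    have "{H \<in> \<L>. H \<subset> G \<and> Suc (rk H) = rk G \<and> A \<subseteq> H} = {H \<in> \<L>. H \<subset> G \<and> Suc (rk H) = rk G \<and> A \<subseteq> H \<and> H \<noteq> {}}"
      by (rule Collect_cong) (use G(4) in \<open>auto simp: colon_flats_def\<close>)
    thus ?thesis
      unfolding stage_def colon_flats_def killed_0[OF G(1)] by auto
  qed
  ultimately show ?thesis
    by simp
qed

text \<open>The irrelevant ideal arises as a colon ideal: for \<open>A\<close> of rank one,
  \<open>colon_flats A A\<close> consists of all nonempty flats except \<open>A\<close>, and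
  \<open>x A\<close> is redundant.\<close>

lemma filtration_flats_irrelevant:
  obtains \<K> where "filtration_flats \<K>" "J \<K> = J (\<L> - {{}})"
proof (cases "E = {}")
  case True
  hence "\<L> - {{}} = {}"
    using flat_subset by auto
  thus ?thesis
    using that filtration_flats.empty by metis
next
  case False
  then obtain i where "i \<in> E - {}"
    by blast
  from cover[OF empty_flat this] obtain A where A: "A \<in> \<L>" "A \<noteq> {}" "rk A = 1"
    by auto
  have eq: "colon_flats A A = \<L> - {{}, A}"
  proof
    show "colon_flats A A \<subseteq> \<L> - {{}, A}"
      using A(2) by (auto simp: colon_flats_def)
    show "\<L> - {{}, A} \<subseteq> colon_flats A A"
    proof
      fix K assume K: "K \<in> \<L> - {{}, A}"
      hence "0 < rk K"
        using rk_pos by blast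
      hence "\<not> K \<subset> A"
        using rk_less[of K A] K A(1,3) by auto
      thus "K \<in> colon_flats A A"
        using K by (auto simp: colon_flats_def)
    qed
  qed
  hence "J (colon_flats A A) = J (\<L> - {{}})"
    by (intro J_all_but_self[OF A(1,2)]) auto
  moreover have "filtration_flats (colon_flats A A)"
    using A eq by (intro filtration_flats_colon) (simp add: proper_colon_def)
  ultimately show ?thesis
    using that by blast
qed

text \<open>Steps that do not enlarge the ideal are skipped, so the recursion stops at the last
  genuine one. Its colon ideal is covered by \<open>filtration_flats_colon\<close>.\<close>

theorem filtration_flats_step:
  assumes "filtration_flats \<K>" "J \<K> \<noteq> N"
  obtains \<K>' G \<K>'' where "filtration_flats \<K>'" "G \<in> \<L>" "G \<noteq> {}" "J \<K> = J (insert G \<K>')"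
    "x G \<notin> J \<K>'" "filtration_flats \<K>''" "\<And>r. r * x G \<in> J \<K>' \<longleftrightarrow> r \<in> J \<K>''"
proof -
  have "\<exists>\<K>' G \<K>''. filtration_flats \<K>' \<and> G \<in> \<L> \<and> G \<noteq> {} \<and> J \<K> = J (insert G \<K>') \<and>
    x G \<notin> J \<K>' \<and> filtration_flats \<K>'' \<and> (\<forall>r. r * x G \<in> J \<K>' \<longleftrightarrow> r \<in> J \<K>'')"
    using assms
  proof (induction rule: filtration_flats.induct)
    case empty
    thus ?case
      by (simp add: J_empty)
  next
    case (absorb \<K> G)
    have "J (insert G \<K>) = J \<K>"
      using absorb.hyps by (intro J_insert_absorb)
    thus ?case
      using absorb by simp
  next
    case (extend \<K> G A)
    show ?case
    proof (cases "x G \<in> J \<K>")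
      case True
      hence "J (insert G \<K>) = J \<K>"
        by (rule J_insert_absorb)
      thus ?thesis
        using extend by simp
    next
      case False
      thus ?thesis
        using extend.hyps filtration_flats_colon by blast
    qed
  qed
  thus ?thesis
    using that by blast
qed

end

section \<open>Balanced weights on flags\<close>

context flat_lattice
begin

definition proper_flats :: "'a set set" where
  "proper_flats = \<L> - {{}, E}"

definition flag :: "'a set set \<Rightarrow> bool" where
  "flag \<sigma> \<longleftrightarrow> \<sigma> \<subseteq> proper_flats \<and> (\<forall>F\<in>\<sigma>. \<forall>G\<in>\<sigma>. F \<subseteq> G \<or> G \<subseteq> F)"

definition star_sum :: "('a set set \<Rightarrow> rat) \<Rightarrow> 'a set set \<Rightarrow> 'a \<Rightarrow> rat" where
  "star_sum w \<sigma> i = (\<Sum>G\<in>{G \<in> proper_flats - \<sigma>. i \<in> G}. w (insert G \<sigma>))"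

text \<open>Minkowski weights on the Bergman fan subdivided by flags of flats, in all dimensions at
  once. The linear functionals that vanish on the rays of a flag are spanned by differences of
  coordinates \<open>i\<close> and \<open>j\<close> lying in the same gap, and these are the ones
  tested.\<close>

definition balanced :: "('a set set \<Rightarrow> rat) \<Rightarrow> bool" where
  "balanced w \<longleftrightarrow> (\<forall>\<sigma>. \<not> flag \<sigma> \<longrightarrow> w \<sigma> = 0) \<and>
    (\<forall>\<sigma> i j. flag \<sigma> \<longrightarrow> i \<in> E \<longrightarrow> j \<in> E \<longrightarrow> (\<forall>F\<in>\<sigma>. i \<in> F \<longleftrightarrow> j \<in> F) \<longrightarrow>
      star_sum w \<sigma> i = star_sum w \<sigma> j)"

text \<open>Together with a \<open>high\<close> element this picks the two gaps adjacent to
  \<open>F\<close>: a low and a high element are separated by \<open>F\<close> and by no other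
  member of the flag.\<close>

definition low :: "'a set set \<Rightarrow> 'a set \<Rightarrow> 'a \<Rightarrow> bool" where
  "low \<sigma> F a \<longleftrightarrow> a \<in> F \<and> (\<forall>H\<in>\<sigma>. H \<subset> F \<longrightarrow> a \<notin> H)"

definition high :: "'a set set \<Rightarrow> 'a set \<Rightarrow> 'a \<Rightarrow> bool" where
  "high \<sigma> F b \<longleftrightarrow> b \<in> E \<and> b \<notin> F \<and> (\<forall>H\<in>\<sigma>. F \<subset> H \<longrightarrow> b \<in> H)"

definition gap_sum :: "('a set set \<Rightarrow> rat) \<Rightarrow> 'a set set \<Rightarrow> 'a \<Rightarrow> 'a \<Rightarrow> rat" where
  "gap_sum w \<sigma> a b = (\<Sum>K\<in>{K \<in> proper_flats - \<sigma>. a \<in> K \<and> b \<notin> K}. w (insert K \<sigma>))"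

text \<open>The transpose of multiplication by \<^term>\<open>x F\<close> on square-free monomials; if \<^term>\<open>F\<close> already
  occurs in the flag, the linear relations of a low and a high element rewrite \<^term>\<open>x F\<close>.\<close>

definition cap :: "'a set \<Rightarrow> ('a set set \<Rightarrow> rat) \<Rightarrow> 'a set set \<Rightarrow> rat" where
  "cap F w \<sigma> = (if \<not> flag \<sigma> then 0 else if F \<notin> \<sigma> then w (insert F \<sigma>)
    else - gap_sum w \<sigma> (SOME a. low \<sigma> F a) (SOME b. high \<sigma> F b))"

lemma finite_proper_flats [simp]: "finite proper_flats"
  by (simp add: proper_flats_def)

lemma proper_flatD: "F \<in> proper_flats \<Longrightarrow> F \<in> \<L>" "F \<in> proper_flats \<Longrightarrow> F \<subset> E"
  "F \<in> proper_flats \<Longrightarrow> {} \<subset> F"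
  using flat_subset by (auto simp: proper_flats_def)

lemma flag_subset: "flag \<sigma> \<Longrightarrow> \<tau> \<subseteq> \<sigma> \<Longrightarrow> flag \<tau>"
  unfolding flag_def by blast

lemma flag_proper: "flag \<sigma> \<Longrightarrow> F \<in> \<sigma> \<Longrightarrow> F \<in> proper_flats"
  unfolding flag_def by blast

lemma flag_comparable: "flag \<sigma> \<Longrightarrow> F \<in> \<sigma> \<Longrightarrow> G \<in> \<sigma> \<Longrightarrow> F \<subseteq> G \<or> G \<subseteq> F"
  unfolding flag_def by blast

lemma flag_finite: "flag \<sigma> \<Longrightarrow> finite \<sigma>"
  unfolding flag_def using finite_subset finite_proper_flats by blast

lemma balanced_zero: "balanced w \<Longrightarrow> \<not> flag \<sigma> \<Longrightarrow> w \<sigma> = 0"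
  unfolding balanced_def by blast

lemma balanced_star: "balanced w \<Longrightarrow> flag \<sigma> \<Longrightarrow> i \<in> E \<Longrightarrow> j \<in> E \<Longrightarrow>
    (\<And>F. F \<in> \<sigma> \<Longrightarrow> i \<in> F \<longleftrightarrow> j \<in> F) \<Longrightarrow> star_sum w \<sigma> i = star_sum w \<sigma> j"
  unfolding balanced_def by blast

lemma cap_not_flag: "\<not> flag \<sigma> \<Longrightarrow> cap F w \<sigma> = 0"
  by (simp add: cap_def)

lemma cap_notin: "balanced w \<Longrightarrow> F \<notin> \<sigma> \<Longrightarrow> cap F w \<sigma> = w (insert F \<sigma>)"
  using balanced_zero[of w "insert F \<sigma>"] flag_subset[of "insert F \<sigma>" \<sigma>]
  by (auto simp: cap_def)

lemma chain_max_below: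
  assumes "flag \<sigma>" "S \<subseteq> insert {} \<sigma>" "S \<noteq> {}"
  obtains M where "M \<in> S" "\<And>H. H \<in> S \<Longrightarrow> H \<subseteq> M"
proof -
  have "finite S"
    using assms flag_finite finite_subset by blast
  then obtain M where M: "M \<in> S" "\<And>H. H \<in> S \<Longrightarrow> M \<subseteq> H \<Longrightarrow> M = H"
    using finite_has_maximal[of S] assms(3) by metis
  have "H \<subseteq> M" if "H \<in> S" for H
  proof (cases "H = {} \<or> M = {}")
    case True
    thus ?thesis
      using M(2)[OF that] by auto
  next
    case False
    hence "H \<in> \<sigma>" "M \<in> \<sigma>"
      using that M(1) assms(2) by auto
    thus ?thesis
      using flag_comparable[OF assms(1), of H M] M(2)[OF that] by auto
  qed
  thus ?thesis
    using that M(1) by blast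
qed

lemma chain_min_above:
  assumes "flag \<sigma>" "S \<subseteq> insert E \<sigma>" "S \<noteq> {}"
  obtains M where "M \<in> S" "\<And>H. H \<in> S \<Longrightarrow> M \<subseteq> H"
proof -
  have "finite S"
    using assms flag_finite finite_subset by blast
  then obtain M where M: "M \<in> S" "\<And>H. H \<in> S \<Longrightarrow> H \<subseteq> M \<Longrightarrow> M = H"
    using finite_has_minimal[of S] assms(3) by metis
  have sub: "H \<subseteq> E" if "H \<in> S" for H
    using that assms(1,2) flag_proper proper_flatD(2) by blast
  have "M \<subseteq> H" if "H \<in> S" for H
  proof (cases "H = E \<or> M = E")
    case True
    thus ?thesis
      using M(2)[OF that] sub that M(1) by auto
  next
    case False
    hence "H \<in> \<sigma>" "M \<in> \<sigma>"
      using that M(1) assms(2) by auto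
    thus ?thesis
      using flag_comparable[OF assms(1), of H M] M(2)[OF that] by auto
  qed
  thus ?thesis
    using that M(1) by blast
qed

lemma low_exists:
  assumes "flag \<sigma>" "F \<in> \<sigma>"
  obtains a where "low \<sigma> F a"
proof -
  have F: "{} \<subset> F"
    using assms flag_proper proper_flatD(3) by blast
  obtain M where M: "M \<in> {H \<in> insert {} \<sigma>. H \<subset> F}" "\<And>H. H \<in> {H \<in> insert {} \<sigma>. H \<subset> F} \<Longrightarrow> H \<subseteq> M"
    by (rule chain_max_below[OF assms(1), of "{H \<in> insert {} \<sigma>. H \<subset> F}"]) (use F in auto)
  then obtain a where "a \<in> F" "a \<notin> M"
    by blast
  hence "low \<sigma> F a"
    unfolding low_def using M(2) by blast
  thus ?thesis
    using that by blast
qed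

lemma high_exists:
  assumes "flag \<sigma>" "F \<subset> E"
  obtains b where "high \<sigma> F b"
proof -
  obtain M where M: "M \<in> {H \<in> insert E \<sigma>. F \<subset> H}" "\<And>H. H \<in> {H \<in> insert E \<sigma>. F \<subset> H} \<Longrightarrow> M \<subseteq> H"
    by (rule chain_min_above[OF assms(1), of "{H \<in> insert E \<sigma>. F \<subset> H}"]) (use assms in auto)
  then obtain b where b: "b \<in> M" "b \<notin> F"
    by blast
  moreover have "b \<in> E"
    using b M(2)[of E] assms(2) by auto
  ultimately have "high \<sigma> F b"
    unfolding high_def using M(2) by blast
  thus ?thesis
    using that by blast
qed

lemma low_in_E: "flag \<sigma> \<Longrightarrow> F \<in> \<sigma> \<Longrightarrow> low \<sigma> F a \<Longrightarrow> a \<in> E"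
  using flag_proper proper_flatD(2) unfolding low_def by blast

text \<open>A flat containing \<open>b\<close> but not \<open>a\<close> is incomparable with
  \<open>F\<close>; inserting it gives no flag, so its weight is zero.\<close>

lemma gap_sum_eq:
  assumes w: "balanced w" and \<sigma>: "flag \<sigma>" "F \<in> \<sigma>" and ab: "low \<sigma> F a" "high \<sigma> F b"
  shows "gap_sum w \<sigma> a b = star_sum w \<sigma> a - star_sum w \<sigma> b"
proof -
  let ?R = "proper_flats - \<sigma>"
  have "star_sum w \<sigma> b = (\<Sum>K\<in>{K \<in> ?R. a \<in> K \<and> b \<in> K}. w (insert K \<sigma>))"
    unfolding star_sum_def
  proof (rule sum.mono_neutral_right)
    show "\<forall>K\<in>{K \<in> ?R. b \<in> K} - {K \<in> ?R. a \<in> K \<and> b \<in> K}. w (insert K \<sigma>) = 0"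
    proof
      fix K assume K: "K \<in> {K \<in> ?R. b \<in> K} - {K \<in> ?R. a \<in> K \<and> b \<in> K}"
      hence "\<not> (K \<subseteq> F \<or> F \<subseteq> K)"
        using ab by (auto simp: low_def high_def)
      hence "\<not> flag (insert K \<sigma>)"
        using flag_comparable[of "insert K \<sigma>" K F] \<sigma>(2) by auto
      thus "w (insert K \<sigma>) = 0"
        using balanced_zero[OF w] by blast
    qed
  qed auto
  moreover have "star_sum w \<sigma> a = gap_sum w \<sigma> a b +
      (\<Sum>K\<in>{K \<in> ?R. a \<in> K \<and> b \<in> K}. w (insert K \<sigma>))"
  proof -
    have "{K \<in> ?R. a \<in> K} = {K \<in> ?R. a \<in> K \<and> b \<notin> K} \<union> {K \<in> ?R. a \<in> K \<and> b \<in> K}"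
      by blast
    thus ?thesis
      unfolding star_sum_def gap_sum_def by (simp only:) (rule sum.union_disjoint, auto)
  qed
  ultimately show ?thesis
    by simp
qed

text \<open>Two low elements lie in the same members of the flag, and so do two high ones; by
  balance the choice made in \<open>cap\<close> is immaterial.\<close>

lemma cap_in:
  assumes w: "balanced w" and \<sigma>: "flag \<sigma>" "F \<in> \<sigma>" and ab: "low \<sigma> F a" "high \<sigma> F b"
  shows "cap F w \<sigma> = - gap_sum w \<sigma> a b" "cap F w \<sigma> = star_sum w \<sigma> b - star_sum w \<sigma> a"
proof -
  let ?a = "SOME a. low \<sigma> F a" and ?b = "SOME b. high \<sigma> F b"
  have a: "low \<sigma> F ?a" and b: "high \<sigma> F ?b"
    using someI[of "low \<sigma> F"] someI[of "high \<sigma> F"] ab by auto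
  have comp: "H \<subseteq> F \<or> F \<subseteq> H" if "H \<in> \<sigma>" for H
    using flag_comparable[OF \<sigma>(1) that \<sigma>(2)] .
  have "star_sum w \<sigma> ?a = star_sum w \<sigma> a"
  proof (rule balanced_star[OF w \<sigma>(1)])
    show "?a \<in> E" "a \<in> E"
      using low_in_E[OF \<sigma>] a ab by auto
    show "?a \<in> H \<longleftrightarrow> a \<in> H" if "H \<in> \<sigma>" for H
      using comp[OF that] a ab(1) that unfolding low_def by blast
  qed
  moreover have "star_sum w \<sigma> ?b = star_sum w \<sigma> b"
  proof (rule balanced_star[OF w \<sigma>(1)])
    show "?b \<in> E" "b \<in> E"
      using b ab by (auto simp: high_def)
    show "?b \<in> H \<longleftrightarrow> b \<in> H" if "H \<in> \<sigma>" for H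
      using comp[OF that] b ab(2) that unfolding high_def by blast
  qed
  ultimately show "cap F w \<sigma> = - gap_sum w \<sigma> a b" "cap F w \<sigma> = star_sum w \<sigma> b - star_sum w \<sigma> a"
    using \<sigma> by (simp_all add: cap_def gap_sum_eq[OF w \<sigma> a b] gap_sum_eq[OF w \<sigma> ab])
qed

section \<open>Capping preserves balance\<close>

definition sep :: "'a \<Rightarrow> 'a \<Rightarrow> 'a set \<Rightarrow> rat" where
  "sep i j G = of_bool (i \<in> G) - of_bool (j \<in> G)"

lemma star_sum_diff:
  "star_sum w \<sigma> i - star_sum w \<sigma> j = (\<Sum>G\<in>proper_flats - \<sigma>. sep i j G * w (insert G \<sigma>))"
proof -
  have "star_sum w \<sigma> k = (\<Sum>G\<in>proper_flats - \<sigma>. of_bool (k \<in> G) * w (insert G \<sigma>))" for k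
    unfolding star_sum_def by (intro sum.mono_neutral_cong_left) auto
  thus ?thesis
    by (simp add: sep_def sum_subtractf left_diff_distrib)
qed

text \<open>With \<open>a\<close> and \<open>b\<close> adapted to \<open>i\<close> and
  \<open>j\<close>, each value of \<open>cap F w\<close> that counts becomes a sum over flats
  \<open>K\<close> that do not separate \<open>i\<close> from \<open>j\<close>. After interchanging
  the sums, the inner one is the balancing condition of \<open>w\<close> for \<open>i\<close> and
  \<open>j\<close> at \<open>insert K \<sigma>\<close>.\<close>

lemma sep_sum_cap_zero:
  assumes w: "balanced w" and \<sigma>: "flag \<sigma>" "F \<in> \<sigma>"
    and ij: "i \<in> E" "j \<in> E" "\<And>H. H \<in> \<sigma> \<Longrightarrow> i \<in> H \<longleftrightarrow> j \<in> H"
  shows "(\<Sum>G\<in>proper_flats - \<sigma>. sep i j G * cap F w (insert G \<sigma>)) = 0"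
proof -
  have FE: "F \<subset> E"
    using \<sigma> flag_proper proper_flatD(2) by blast
  obtain a0 b0 where ab0: "low \<sigma> F a0" "high \<sigma> F b0"
    using low_exists[OF \<sigma>] high_exists[OF \<sigma>(1) FE] by metis
  \<comment> \<open>If \<open>i\<close> lies in a gap adjacent to \<open>F\<close>, it must itself
    serve as the low or high element; otherwise any choice works.\<close>
  define a where "a = (if low \<sigma> F i then i else a0)"
  define b where "b = (if high \<sigma> F i then i else b0)"
  have ab: "low \<sigma> F a" "high \<sigma> F b"
    using ab0 by (auto simp: a_def b_def)
  have low_iff: "low \<sigma> F i \<longleftrightarrow> low \<sigma> F j"
    using ij \<sigma>(2) unfolding low_def by blast
  have high_iff: "high \<sigma> F i \<longleftrightarrow> high \<sigma> F j"
    using ij \<sigma>(2) unfolding high_def by blast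
  let ?R = "proper_flats - \<sigma>"
  let ?Q = "{K \<in> ?R. a \<in> K \<and> b \<notin> K \<and> (i \<in> K \<longleftrightarrow> j \<in> K)}"
  have main: "cap F w (insert G \<sigma>) = - (\<Sum>K\<in>?Q - {G}. w (insert K (insert G \<sigma>)))"
    if G: "G \<in> ?R" "sep i j G \<noteq> 0" for G
  proof (cases "flag (insert G \<sigma>)")
    case False
    hence "w (insert K (insert G \<sigma>)) = 0" for K
      using balanced_zero[OF w] flag_subset by blast
    thus ?thesis
      using False by (simp add: cap_not_flag)
  next
    case fG: True
    obtain p q where pq: "p \<in> G" "q \<notin> G" "{p, q} = {i, j}"
    proof (cases "i \<in> G")
      case True
      hence "j \<notin> G"
        using G(2) by (auto simp: sep_def)
      thus ?thesis
        using that[of i j] True by simp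
    next
      case False
      hence "j \<in> G"
        using G(2) by (auto simp: sep_def)
      thus ?thesis
        using that[of j i] False by (simp add: insert_commute)
    qed
    have pqH: "p \<in> H \<longleftrightarrow> q \<in> H" if "H \<in> \<sigma>" for H
      using ij(3)[OF that] pq(3) by (auto simp: doubleton_eq_iff)
    have pqE: "p \<in> E" "q \<in> E"
      using ij pq(3) by (auto simp: doubleton_eq_iff)
    have iffK: "(i \<in> K \<longleftrightarrow> j \<in> K) \<longleftrightarrow> (p \<in> K \<longleftrightarrow> q \<in> K)" for K
      using pq(3) by (auto simp: doubleton_eq_iff)
    have lowpq: "low \<sigma> F p \<longleftrightarrow> low \<sigma> F i" "low \<sigma> F q \<longleftrightarrow> low \<sigma> F i"
      using pq(3) low_iff by (auto simp: doubleton_eq_iff)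
    have highpq: "high \<sigma> F p \<longleftrightarrow> high \<sigma> F i" "high \<sigma> F q \<longleftrightarrow> high \<sigma> F i"
      using pq(3) high_iff by (auto simp: doubleton_eq_iff)
    have compG: "H \<subset> G \<or> G \<subset> H" if "H \<in> \<sigma>" for H
      using flag_comparable[OF fG, of H G] that G(1) by auto
    \<comment> \<open>Inserting \<open>G\<close> can spoil \<open>a\<close> or \<open>b\<close> when
      the pair lies in a gap adjacent to \<open>F\<close>. The element of the pair on the correct
      side of \<open>G\<close> then replaces it: \<open>q\<close> as low element, \<open>p\<close>
      as high element. The resulting condition on \<open>K\<close> describes one index set valid for
      all \<open>G\<close>.\<close>
    obtain a' b' where a'b': "low (insert G \<sigma>) F a'" "high (insert G \<sigma>) F b'"
      and K': "\<And>K. flag (insert K (insert G \<sigma>)) \<Longrightarrow>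
        (a' \<in> K \<and> b' \<notin> K) \<longleftrightarrow> (a \<in> K \<and> b \<notin> K \<and> (p \<in> K \<longleftrightarrow> q \<in> K))"
    proof -
      consider (low) "low \<sigma> F i" | (high) "high \<sigma> F i" | (none) "\<not> low \<sigma> F i" "\<not> high \<sigma> F i"
        by blast
      thus ?thesis
      proof cases
        case low
        hence qF: "q \<in> F" "p \<in> F"
          using lowpq unfolding low_def by auto
        hence GF: "G \<subset> F"
          using compG[OF \<sigma>(2)] pq(2) by blast
        have "low (insert G \<sigma>) F q"
          using low lowpq(2) pq(2) unfolding low_def by auto
        moreover have "high (insert G \<sigma>) F b"
          using ab(2) GF unfolding high_def by auto
        moreover have "(q \<in> K \<and> b \<notin> K) \<longleftrightarrow> (a \<in> K \<and> b \<notin> K \<and> (p \<in> K \<longleftrightarrow> q \<in> K))"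
          if "flag (insert K (insert G \<sigma>))" for K
        proof -
          have "K \<subseteq> G \<or> G \<subseteq> K"
            using flag_comparable[OF that] by blast
          moreover have "a = p \<or> a = q"
            using low pq(3) by (auto simp: a_def doubleton_eq_iff)
          ultimately show ?thesis
            using pq(1,2) by blast
        qed
        ultimately show ?thesis
          using that by blast
      next
        case high
        hence pF: "p \<notin> F" "q \<notin> F"
          using highpq unfolding high_def by auto
        hence GF: "F \<subset> G"
          using compG[OF \<sigma>(2)] pq(1) by blast
        have "high (insert G \<sigma>) F p"
          using high highpq(1) pq(1) unfolding high_def by auto
        moreover have "low (insert G \<sigma>) F a"
          using ab(1) GF unfolding low_def by auto
        moreover have "(a \<in> K \<and> p \<notin> K) \<longleftrightarrow> (a \<in> K \<and> b \<notin> K \<and> (p \<in> K \<longleftrightarrow> q \<in> K))"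
          if "flag (insert K (insert G \<sigma>))" for K
        proof -
          have "K \<subseteq> G \<or> G \<subseteq> K"
            using flag_comparable[OF that] by blast
          moreover have "b = p \<or> b = q"
            using high pq(3) by (auto simp: b_def doubleton_eq_iff)
          ultimately show ?thesis
            using pq(1,2) by blast
        qed
        ultimately show ?thesis
          using that by blast
      next
        case none
        have notF: "\<exists>H\<in>\<sigma>. H \<subset> F \<and> p \<in> H \<and> q \<in> H" if "p \<in> F \<or> q \<in> F"
        proof -
          have "p \<in> F"
            using that pqH[OF \<sigma>(2)] by blast
          then obtain H where "H \<in> \<sigma>" "H \<subset> F" "p \<in> H"
            using none(1) lowpq(1) unfolding low_def by blast
          thus ?thesis
            using pqH by blast
        qed
        have notF': "\<exists>H\<in>\<sigma>. F \<subset> H \<and> p \<notin> H \<and> q \<notin> H" if "p \<notin> F \<or> q \<notin> F"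
        proof -
          have "p \<notin> F"
            using that pqH[OF \<sigma>(2)] by blast
          then obtain H where "H \<in> \<sigma>" "F \<subset> H" "p \<notin> H"
            using none(2) highpq(1) pqE unfolding high_def by blast
          thus ?thesis
            using pqH by blast
        qed
        have "a \<notin> G" if GF: "G \<subset> F"
        proof -
          obtain H where H: "H \<in> \<sigma>" "H \<subset> F" "q \<in> H"
            using notF GF pq(1) by blast
          hence "G \<subset> H"
            using compG[OF H(1)] pq(2) by blast
          thus ?thesis
            using ab(1) H unfolding low_def by blast
        qed
        hence "low (insert G \<sigma>) F a"
          using ab(1) unfolding low_def by auto
        moreover have "b \<in> G" if FG: "F \<subset> G"
        proof -
          obtain H where H: "H \<in> \<sigma>" "F \<subset> H" "p \<notin> H"
            using notF' FG pq(2) by blast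
          hence "H \<subset> G"
            using compG[OF H(1)] pq(1) by blast
          thus ?thesis
            using ab(2) H unfolding high_def by blast
        qed
        hence "high (insert G \<sigma>) F b"
          using ab(2) unfolding high_def by auto
        moreover have "p \<in> K \<longleftrightarrow> q \<in> K"
          if K: "flag (insert K (insert G \<sigma>))" "a \<in> K" "b \<notin> K" for K
        proof (rule ccontr)
          assume neq: "\<not> ?thesis"
          have comp: "K \<subseteq> H \<or> H \<subseteq> K" if "H \<in> \<sigma>" for H
            using flag_comparable[OF K(1)] that by blast
          show False
          proof (cases "p \<in> F")
            case True
            then obtain H where H: "H \<in> \<sigma>" "H \<subset> F" "p \<in> H" "q \<in> H"
              using notF by blast
            hence "K \<subseteq> H"
              using comp[OF H(1)] neq by blast
            thus False
              using K(2) ab(1) H(1,2) unfolding low_def by blast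
          next
            case False
            then obtain H where H: "H \<in> \<sigma>" "F \<subset> H" "p \<notin> H" "q \<notin> H"
              using notF' by blast
            hence "H \<subseteq> K"
              using comp[OF H(1)] neq by blast
            thus False
              using K(3) ab(2) H(1,2) unfolding high_def by blast
          qed
        qed
        ultimately show ?thesis
          using that[of a b] by blast
      qed
    qed
    have "cap F w (insert G \<sigma>) = - gap_sum w (insert G \<sigma>) a' b'"
      using \<sigma> by (intro cap_in[OF w fG _ a'b']) auto
    also have "gap_sum w (insert G \<sigma>) a' b' = (\<Sum>K\<in>?Q - {G}. w (insert K (insert G \<sigma>)))"
    proof -
      let ?f = "\<lambda>K. w (insert K (insert G \<sigma>))"
      have "gap_sum w (insert G \<sigma>) a' b' = (\<Sum>K\<in>?R - {G}. if a' \<in> K \<and> b' \<notin> K then ?f K else 0)"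
        unfolding gap_sum_def by (intro sum.mono_neutral_cong_left) auto
      also have "\<dots> = (\<Sum>K\<in>?R - {G}. if K \<in> ?Q then ?f K else 0)"
      proof (rule sum.cong[OF refl])
        fix K assume "K \<in> ?R - {G}"
        thus "(if a' \<in> K \<and> b' \<notin> K then ?f K else 0) = (if K \<in> ?Q then ?f K else 0)"
          using K'[of K] iffK[of K] balanced_zero[OF w, of "insert K (insert G \<sigma>)"]
          by (cases "flag (insert K (insert G \<sigma>))") auto
      qed
      also have "\<dots> = (\<Sum>K\<in>?Q - {G}. ?f K)"
        by (intro sum.mono_neutral_cong_right) auto
      finally show ?thesis .
    qed
    finally show ?thesis .
  qed
  have "(\<Sum>G\<in>?R. sep i j G * cap F w (insert G \<sigma>)) =
      (\<Sum>G\<in>?R. - (\<Sum>K\<in>?Q - {G}. sep i j G * w (insert K (insert G \<sigma>))))"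
  proof (rule sum.cong[OF refl])
    fix G assume "G \<in> ?R"
    thus "sep i j G * cap F w (insert G \<sigma>) = - (\<Sum>K\<in>?Q - {G}. sep i j G * w (insert K (insert G \<sigma>)))"
      using main[of G] by (cases "sep i j G = 0") (simp_all add: sum_distrib_left)
  qed
  also have "\<dots> = - (\<Sum>G\<in>?R. \<Sum>K\<in>?Q - {G}. sep i j G * w (insert K (insert G \<sigma>)))"
    by (simp add: sum_negf)
  also have "(\<Sum>G\<in>?R. \<Sum>K\<in>?Q - {G}. sep i j G * w (insert K (insert G \<sigma>))) =
      (\<Sum>G\<in>?R. \<Sum>K\<in>?Q. if K = G then 0 else sep i j G * w (insert K (insert G \<sigma>)))"
    by (intro sum.cong refl sum.mono_neutral_cong_left) auto
  also have "\<dots> = (\<Sum>K\<in>?Q. \<Sum>G\<in>?R. if K = G then 0 else sep i j G * w (insert K (insert G \<sigma>)))"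
    by (rule sum.swap)
  also have "\<dots> = (\<Sum>K\<in>?Q. \<Sum>G\<in>proper_flats - insert K \<sigma>. sep i j G * w (insert G (insert K \<sigma>)))"
    by (intro sum.cong refl sum.mono_neutral_cong_right) (auto simp: insert_commute)
  also have "\<dots> = (\<Sum>K\<in>?Q. star_sum w (insert K \<sigma>) i - star_sum w (insert K \<sigma>) j)"
    by (simp add: star_sum_diff)
  also have "\<dots> = 0"
  proof (rule sum.neutral, rule ballI)
    fix K assume "K \<in> ?Q"
    hence K: "i \<in> K \<longleftrightarrow> j \<in> K"
      by simp
    show "star_sum w (insert K \<sigma>) i - star_sum w (insert K \<sigma>) j = 0"
    proof (cases "flag (insert K \<sigma>)")
      case True
      thus ?thesis
        using balanced_star[OF w True ij(1,2)] ij(3) K by auto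
    next
      case False
      hence "w (insert G (insert K \<sigma>)) = 0" for G
        using balanced_zero[OF w] flag_subset by blast
      thus ?thesis
        by (simp add: star_sum_diff)
    qed
  qed
  finally show ?thesis
    by simp
qed

text \<open>If \<open>F\<close> is not in the flag, the star sums of \<open>cap F w\<close> are
  those of \<open>w\<close> at \<open>insert F \<sigma>\<close> plus one term for \<open>F\<close>.
  When \<open>F\<close> separates \<open>i\<close> from \<open>j\<close>, one of them is low and the
  other high there, and the extra term is exactly the difference of their star sums.\<close>

lemma balanced_cap:
  assumes w: "balanced w" and F: "F \<in> proper_flats"
  shows "balanced (cap F w)"
  unfolding balanced_def
proof (intro conjI allI impI)
  show "cap F w \<sigma> = 0" if "\<not> flag \<sigma>" for \<sigma>
    using cap_not_flag that by blast
  fix \<sigma> i j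
  assume \<sigma>: "flag \<sigma>" and ij: "i \<in> E" "j \<in> E" "\<forall>H\<in>\<sigma>. i \<in> H \<longleftrightarrow> j \<in> H"
  show "star_sum (cap F w) \<sigma> i = star_sum (cap F w) \<sigma> j"
  proof (cases "F \<in> \<sigma>")
    case True
    hence "star_sum (cap F w) \<sigma> i - star_sum (cap F w) \<sigma> j = 0"
      unfolding star_sum_diff using ij by (intro sep_sum_cap_zero[OF w \<sigma>]) auto
    thus ?thesis
      by simp
  next
    case False
    have expand: "star_sum (cap F w) \<sigma> k = star_sum w (insert F \<sigma>) k + of_bool (k \<in> F) * cap F w (insert F \<sigma>)"
      for k
    proof -
      let ?S = "{G \<in> proper_flats - \<sigma>. k \<in> G}"
      have "(\<Sum>G\<in>?S. cap F w (insert G \<sigma>)) =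
          (\<Sum>G\<in>?S - {F}. cap F w (insert G \<sigma>)) + of_bool (k \<in> F) * cap F w (insert F \<sigma>)"
      proof (cases "k \<in> F")
        case True
        hence "F \<in> ?S"
          using F False by blast
        from sum.remove[OF _ this, of "\<lambda>G. cap F w (insert G \<sigma>)"] True show ?thesis
          by (simp only: finite_Diff finite_Collect_conjI finite_proper_flats) (simp add: add.commute)
      next
        case notin: False
        hence "?S - {F} = ?S"
          by blast
        thus ?thesis
          using notin by simp
      qed
      also have "(\<Sum>G\<in>?S - {F}. cap F w (insert G \<sigma>)) = (\<Sum>G\<in>?S - {F}. w (insert G (insert F \<sigma>)))"
      proof (rule sum.cong[OF refl])
        fix G assume "G \<in> ?S - {F}"
        hence "F \<notin> insert G \<sigma>"
          using False by blast
        thus "cap F w (insert G \<sigma>) = w (insert G (insert F \<sigma>))"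
          by (simp add: cap_notin[OF w] insert_commute)
      qed
      also have "?S - {F} = {G \<in> proper_flats - insert F \<sigma>. k \<in> G}"
        by blast
      finally show ?thesis
        unfolding star_sum_def .
    qed
    show ?thesis
    proof (cases "flag (insert F \<sigma>)")
      case notflag: False
      hence "w (insert G (insert F \<sigma>)) = 0" for G
        using balanced_zero[OF w] flag_subset by blast
      hence "star_sum w (insert F \<sigma>) k = 0" for k
        by (simp add: star_sum_def)
      thus ?thesis
        by (simp add: expand cap_not_flag[OF notflag])
    next
      case fF: True
      have comp: "H \<subset> F \<or> F \<subset> H" if "H \<in> \<sigma>" for H
        using flag_comparable[OF fF, of H F] that False by auto
      have cross: "star_sum (cap F w) \<sigma> k = star_sum (cap F w) \<sigma> l"
        if kl: "k \<in> E" "l \<in> E" "\<forall>H\<in>\<sigma>. k \<in> H \<longleftrightarrow> l \<in> H" "k \<in> F" "l \<notin> F" for k l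
      proof -
        have "low (insert F \<sigma>) F k"
          unfolding low_def using kl by blast
        moreover have "high (insert F \<sigma>) F l"
          unfolding high_def using kl by blast
        ultimately have "cap F w (insert F \<sigma>) = star_sum w (insert F \<sigma>) l - star_sum w (insert F \<sigma>) k"
          by (intro cap_in(2)[OF w fF]) auto
        thus ?thesis
          using kl by (simp add: expand)
      qed
      show ?thesis
      proof (cases "i \<in> F \<longleftrightarrow> j \<in> F")
        case True
        hence "star_sum w (insert F \<sigma>) i = star_sum w (insert F \<sigma>) j"
          using ij by (intro balanced_star[OF w fF]) auto
        thus ?thesis
          using True by (simp add: expand)
      next
        case neq: False
        show ?thesis
        proof (cases "i \<in> F")
        case True
        thus ?thesis
          using ij neq by (intro cross) auto
      next
        case False
        hence "star_sum (cap F w) \<sigma> j = star_sum (cap F w) \<sigma> i"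
          using ij neq by (intro cross) auto
        thus ?thesis
          by simp
      qed
      qed
    qed
  qed
qed

text \<open>The total of all terms in the linear relation of \<^term>\<open>i\<close> telescopes along the flag.\<close>

lemma sum_cap_flag:
  assumes w: "balanced w" and \<sigma>: "flag \<sigma>" and t: "t \<in> E" "\<And>F. F \<in> \<sigma> \<Longrightarrow> t \<notin> F"
  shows "i \<in> E \<Longrightarrow> (\<Sum>F\<in>{F \<in> \<sigma>. i \<in> F}. cap F w \<sigma>) = star_sum w \<sigma> t - star_sum w \<sigma> i"
proof (induction "card {F \<in> \<sigma>. i \<in> F}" arbitrary: i rule: less_induct)
  case less
  have fin: "finite \<sigma>"
    using \<sigma> flag_finite by blast
  show ?case
  proof (cases "{F \<in> \<sigma>. i \<in> F} = {}")
    case True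
    hence "star_sum w \<sigma> t = star_sum w \<sigma> i"
      using t less.prems by (intro balanced_star[OF w \<sigma>]) auto
    thus ?thesis
      unfolding True by simp
  next
    case False
    obtain F where F: "F \<in> {F \<in> \<sigma>. i \<in> F}" "\<And>H. H \<in> {F \<in> \<sigma>. i \<in> F} \<Longrightarrow> F \<subseteq> H"
      by (rule chain_min_above[OF \<sigma>, of "{F \<in> \<sigma>. i \<in> F}"]) (use False in auto)
    have FE: "F \<subset> E"
      using F \<sigma> flag_proper proper_flatD(2) by blast
    obtain b where b: "high \<sigma> F b"
      using high_exists[OF \<sigma> FE] .
    have low: "low \<sigma> F i"
      using F unfolding low_def by blast
    have eq: "{H \<in> \<sigma>. b \<in> H} = {H \<in> \<sigma>. i \<in> H} - {F}"
    proof (intro subset_antisym subsetI)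
      fix H assume H: "H \<in> {H \<in> \<sigma>. b \<in> H}"
      hence "F \<subset> H"
        using flag_comparable[OF \<sigma>, of H F] F(1) b unfolding high_def by blast
      thus "H \<in> {H \<in> \<sigma>. i \<in> H} - {F}"
        using H F(1) by blast
    next
      fix H assume H: "H \<in> {H \<in> \<sigma>. i \<in> H} - {F}"
      hence "F \<subset> H"
        using F(2)[of H] by blast
      thus "H \<in> {H \<in> \<sigma>. b \<in> H}"
        using H b unfolding high_def by blast
    qed
    have "card {H \<in> \<sigma>. b \<in> H} < card {H \<in> \<sigma>. i \<in> H}"
      unfolding eq using fin F(1) by (intro card_Diff1_less) auto
    hence IH: "(\<Sum>H\<in>{H \<in> \<sigma>. b \<in> H}. cap H w \<sigma>) = star_sum w \<sigma> t - star_sum w \<sigma> b"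
      using b by (intro less.hyps) (auto simp: high_def)
    have "(\<Sum>H\<in>{H \<in> \<sigma>. i \<in> H}. cap H w \<sigma>) = cap F w \<sigma> + (\<Sum>H\<in>{H \<in> \<sigma>. b \<in> H}. cap H w \<sigma>)"
      unfolding eq using fin F(1) by (intro sum.remove) auto
    also have "cap F w \<sigma> = star_sum w \<sigma> b - star_sum w \<sigma> i"
      using F(1) by (intro cap_in(2)[OF w \<sigma> _ low b]) auto
    finally show ?thesis
      using IH by simp
  qed
qed

text \<open>The value does not involve \<open>i\<close>: \<open>t\<close> is any element outside the
  whole flag. Its negative will be the action of the variable of \<open>E\<close>.\<close>

lemma sum_cap:
  assumes w: "balanced w" and \<sigma>: "flag \<sigma>" and t: "t \<in> E" "\<And>F. F \<in> \<sigma> \<Longrightarrow> t \<notin> F" and i: "i \<in> E"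
  shows "(\<Sum>F\<in>{F \<in> proper_flats. i \<in> F}. cap F w \<sigma>) = star_sum w \<sigma> t"
proof -
  have "{F \<in> proper_flats. i \<in> F} = {F \<in> \<sigma>. i \<in> F} \<union> {F \<in> proper_flats - \<sigma>. i \<in> F}"
    using \<sigma> flag_proper by blast
  hence "(\<Sum>F\<in>{F \<in> proper_flats. i \<in> F}. cap F w \<sigma>) =
      (\<Sum>F\<in>{F \<in> \<sigma>. i \<in> F}. cap F w \<sigma>) + (\<Sum>F\<in>{F \<in> proper_flats - \<sigma>. i \<in> F}. cap F w \<sigma>)"
    using flag_finite[OF \<sigma>] by (simp only:) (rule sum.union_disjoint, auto)
  also have "(\<Sum>F\<in>{F \<in> proper_flats - \<sigma>. i \<in> F}. cap F w \<sigma>) = star_sum w \<sigma> i"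
    unfolding star_sum_def by (intro sum.cong refl) (auto simp: cap_notin[OF w])
  finally show ?thesis
    using sum_cap_flag[OF w \<sigma> t i] by simp
qed

text \<open>Choose the two elements for \<open>F\<close> after inserting \<open>G\<close>. They stay
  low and high without \<open>G\<close>, and \<open>G\<close> does not separate them, so both sides
  are the same gap sum.\<close>

lemma cap_commute_mixed:
  assumes w: "balanced w" and F: "F \<in> proper_flats" and G: "G \<in> proper_flats"
    and \<sigma>: "flag \<sigma>" "F \<in> \<sigma>" "G \<notin> \<sigma>"
  shows "cap F (cap G w) \<sigma> = cap G (cap F w) \<sigma>"
proof -
  have wG: "balanced (cap G w)" and wF: "balanced (cap F w)"
    using balanced_cap w F G by auto
  have R: "cap G (cap F w) \<sigma> = cap F w (insert G \<sigma>)"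
    by (rule cap_notin[OF wF \<sigma>(3)])
  have FE: "F \<subset> E"
    using F proper_flatD(2) by blast
  show ?thesis
  proof (cases "flag (insert G \<sigma>)")
    case False
    obtain a b where ab: "low \<sigma> F a" "high \<sigma> F b"
      using low_exists[OF \<sigma>(1,2)] high_exists[OF \<sigma>(1) FE] by metis
    have "cap G w (insert K \<sigma>) = 0" for K
    proof (cases "K = G")
      case True
      thus ?thesis
        using False by (simp add: cap_not_flag)
    next
      case ne: False
      have "\<not> flag (insert G (insert K \<sigma>))"
        using False flag_subset[of "insert G (insert K \<sigma>)" "insert G \<sigma>"] by auto
      thus ?thesis
        using ne \<sigma>(3) balanced_zero[OF w] by (simp add: cap_notin[OF w])
    qed
    hence "cap F (cap G w) \<sigma> = 0"
      by (simp add: cap_in(1)[OF wG \<sigma>(1,2) ab] gap_sum_def)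
    thus ?thesis
      using R False by (simp add: cap_not_flag)
  next
    case fG: True
    obtain a b where ab: "low (insert G \<sigma>) F a" "high (insert G \<sigma>) F b"
      using low_exists[OF fG insertI2[OF \<sigma>(2)]] high_exists[OF fG FE] by metis
    have ab': "low \<sigma> F a" "high \<sigma> F b"
      using ab unfolding low_def high_def by auto
    have "G \<subset> F \<or> F \<subset> G"
      using flag_comparable[OF fG, of G F] \<sigma> by auto
    hence nG: "\<not> (a \<in> G \<and> b \<notin> G)"
      using ab unfolding low_def high_def by blast
    have "gap_sum (cap G w) \<sigma> a b = gap_sum w (insert G \<sigma>) a b"
      unfolding gap_sum_def
    proof (rule sum.cong)
      show "{K \<in> proper_flats - \<sigma>. a \<in> K \<and> b \<notin> K} = {K \<in> proper_flats - insert G \<sigma>. a \<in> K \<and> b \<notin> K}"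
        using nG by blast
      fix K assume "K \<in> {K \<in> proper_flats - insert G \<sigma>. a \<in> K \<and> b \<notin> K}"
      hence "G \<notin> insert K \<sigma>"
        using \<sigma>(3) by auto
      thus "cap G w (insert K \<sigma>) = w (insert K (insert G \<sigma>))"
        by (simp add: cap_notin[OF w] insert_commute)
    qed
    thus ?thesis
      using R cap_in(1)[OF wG \<sigma>(1,2) ab'] cap_in(1)[OF w fG _ ab] \<sigma>(2) by simp
  qed
qed

text \<open>Choose \<open>b\<close> high for \<open>F\<close> and \<open>a'\<close> low for
  \<open>G\<close> such that every flat compatible with the flag that contains \<open>a'\<close>
  contains \<open>b\<close>: a member strictly between \<open>F\<close> and \<open>G\<close> forces
  this, and without one a single element of \<open>G - F\<close> serves as both. Inserting a flat
  counted at one of \<open>F\<close> and \<open>G\<close> then keeps the elements chosen for the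
  other low and high, and both sides are the same double sum.\<close>

lemma cap_commute_nested:
  assumes w: "balanced w" and \<sigma>: "flag \<sigma>" "F \<in> \<sigma>" "G \<in> \<sigma>" "F \<subset> G"
  shows "cap F (cap G w) \<sigma> = cap G (cap F w) \<sigma>"
proof -
  have FG: "F \<in> proper_flats" "G \<in> proper_flats" "F \<subset> E" "G \<subset> E"
    using \<sigma> flag_proper proper_flatD(2) by blast+
  have wG: "balanced (cap G w)" and wF: "balanced (cap F w)"
    using balanced_cap w FG by auto
  obtain a b' where ab': "low \<sigma> F a" "high \<sigma> G b'"
    using low_exists[OF \<sigma>(1,2)] high_exists[OF \<sigma>(1) FG(4)] by metis
  obtain b a' where ba': "high \<sigma> F b" "low \<sigma> G a'"
    and M: "\<And>M. flag (insert M \<sigma>) \<Longrightarrow> a' \<in> M \<Longrightarrow> b \<in> M"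
  proof (cases "\<exists>H\<in>\<sigma>. F \<subset> H \<and> H \<subset> G")
    case True
    then obtain H where H: "H \<in> \<sigma>" "F \<subset> H" "H \<subset> G"
      by blast
    obtain b a' where ba: "high \<sigma> F b" "low \<sigma> G a'"
      using low_exists[OF \<sigma>(1,3)] high_exists[OF \<sigma>(1) FG(3)] by metis
    have "b \<in> M" if "flag (insert M \<sigma>)" "a' \<in> M" for M
    proof -
      have "a' \<notin> H" "b \<in> H"
        using H ba unfolding low_def high_def by auto
      moreover have "M \<subseteq> H \<or> H \<subseteq> M"
        using flag_comparable[OF that(1)] H(1) by blast
      ultimately show ?thesis
        using that(2) by blast
    qed
    thus ?thesis
      using that ba by blast
  next
    case False
    obtain e where e: "e \<in> G" "e \<notin> F"
      using \<sigma>(4) by blast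
    have "high \<sigma> F e"
      unfolding high_def
    proof (intro conjI ballI impI)
      show "e \<in> H" if "H \<in> \<sigma>" "F \<subset> H" for H
        using flag_comparable[OF \<sigma>(1) that(1) \<sigma>(3)] that False e by blast
    qed (use e FG in auto)
    moreover have "low \<sigma> G e"
      unfolding low_def
    proof (intro conjI ballI impI)
      show "e \<notin> H" if "H \<in> \<sigma>" "H \<subset> G" for H
        using flag_comparable[OF \<sigma>(1) that(1) \<sigma>(2)] that False e by blast
    qed (use e in auto)
    ultimately show ?thesis
      using that by blast
  qed
  let ?R = "proper_flats - \<sigma>"
  let ?K = "{K \<in> ?R. a \<in> K \<and> b \<notin> K}" and ?L = "{L \<in> ?R. a' \<in> L \<and> b' \<notin> L}"
  have zero: "w (insert L (insert K \<sigma>)) = 0" if "\<not> flag (insert K \<sigma>)" for K L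
    using balanced_zero[OF w] flag_subset that by blast
  have 1: "cap G w (insert K \<sigma>) = - (\<Sum>L\<in>?L - {K}. w (insert L (insert K \<sigma>)))" if K: "K \<in> ?K" for K
  proof (cases "flag (insert K \<sigma>)")
    case True
    have "a' \<notin> K"
      using M[OF True] K by blast
    hence low: "low (insert K \<sigma>) G a'"
      using ba'(2) unfolding low_def by blast
    have high: "high (insert K \<sigma>) G b'"
      using ab'(2) ba'(2) \<open>a' \<notin> K\<close> unfolding low_def high_def by blast
    from cap_in(1)[OF w True _ low high] show ?thesis
      using \<sigma>(3) unfolding gap_sum_def by (auto intro!: sum.cong)
  next
    case False
    thus ?thesis
      using zero by (simp add: cap_not_flag)
  qed
  have 2: "cap F w (insert L \<sigma>) = - (\<Sum>K\<in>?K - {L}. w (insert K (insert L \<sigma>)))" if L: "L \<in> ?L" for L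
  proof (cases "flag (insert L \<sigma>)")
    case True
    have "b \<in> L"
      using M[OF True] L by blast
    hence high: "high (insert L \<sigma>) F b"
      using ba'(1) unfolding high_def by blast
    have low: "low (insert L \<sigma>) F a"
      using ab'(1) ba'(1) \<open>b \<in> L\<close> unfolding low_def high_def by blast
    from cap_in(1)[OF w True _ low high] show ?thesis
      using \<sigma>(2) unfolding gap_sum_def by (auto intro!: sum.cong)
  next
    case False
    thus ?thesis
      using zero by (simp add: cap_not_flag)
  qed
  have "cap F (cap G w) \<sigma> = (\<Sum>K\<in>?K. \<Sum>L\<in>?L - {K}. w (insert L (insert K \<sigma>)))"
    unfolding cap_in(1)[OF wG \<sigma>(1,2) ab'(1) ba'(1)] gap_sum_def using 1 by (simp add: sum_negf)
  also have "\<dots> = (\<Sum>K\<in>?K. \<Sum>L\<in>?L. if L = K then 0 else w (insert L (insert K \<sigma>)))"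
    by (intro sum.cong refl sum.mono_neutral_cong_left) auto
  also have "\<dots> = (\<Sum>L\<in>?L. \<Sum>K\<in>?K. if L = K then 0 else w (insert L (insert K \<sigma>)))"
    by (rule sum.swap)
  also have "\<dots> = (\<Sum>L\<in>?L. \<Sum>K\<in>?K - {L}. w (insert K (insert L \<sigma>)))"
    by (intro sum.cong refl sum.mono_neutral_cong_right) (auto simp: insert_commute)
  also have "\<dots> = cap G (cap F w) \<sigma>"
    unfolding cap_in(1)[OF wF \<sigma>(1,3) ba'(2) ab'(2)] gap_sum_def using 2 by (simp add: sum_negf)
  finally show ?thesis .
qed

lemma cap_commute:
  assumes w: "balanced w" and F: "F \<in> proper_flats" and G: "G \<in> proper_flats"
  shows "cap F (cap G w) \<sigma> = cap G (cap F w) \<sigma>"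
proof (cases "F = G \<or> \<not> flag \<sigma>")
  case True
  thus ?thesis
    by (auto simp: cap_not_flag)
next
  case False
  hence \<sigma>: "flag \<sigma>" and ne: "F \<noteq> G"
    by auto
  have wG: "balanced (cap G w)" and wF: "balanced (cap F w)"
    using balanced_cap w F G by auto
  consider "F \<in> \<sigma>" "G \<in> \<sigma>" | "F \<in> \<sigma>" "G \<notin> \<sigma>" | "F \<notin> \<sigma>" "G \<in> \<sigma>" | "F \<notin> \<sigma>" "G \<notin> \<sigma>"
    by blast
  thus ?thesis
  proof cases
    case 1
    thus ?thesis
      using cap_commute_nested[OF w \<sigma>] flag_comparable[OF \<sigma>] ne by (metis psubsetI)
  next
    case 4
    thus ?thesis
      using ne by (simp add: cap_notin[OF wG] cap_notin[OF wF] cap_notin[OF w] insert_commute)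
  qed (use cap_commute_mixed[OF w F G \<sigma>] cap_commute_mixed[OF w G F \<sigma>] in auto)
qed

lemma cap_incomparable:
  assumes w: "balanced w" and F: "F \<in> proper_flats" and G: "G \<in> proper_flats"
    and ne: "\<not> F \<subseteq> G" "\<not> G \<subseteq> F"
  shows "cap F (cap G w) \<sigma> = 0"
proof -
  have no_flag: "\<not> flag \<tau>" if "F \<in> \<tau>" "G \<in> \<tau>" for \<tau>
    using flag_comparable[of \<tau> F G] that ne by blast
  have *: "cap F (cap G w) \<sigma> = 0"
    if "F \<notin> \<sigma>" "F \<in> proper_flats" "G \<in> proper_flats" "F \<noteq> G" "\<And>\<tau>. F \<in> \<tau> \<Longrightarrow> G \<in> \<tau> \<Longrightarrow> \<not> flag \<tau>" for F G
  proof -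
    have "cap F (cap G w) \<sigma> = cap G w (insert F \<sigma>)"
      using that by (intro cap_notin balanced_cap w)
    also have "\<dots> = 0"
    proof (cases "G \<in> insert F \<sigma>")
      case True
      thus ?thesis
        using that(5)[of "insert F \<sigma>"] by (simp add: cap_not_flag)
    next
      case False
      thus ?thesis
        using that(5)[of "insert G (insert F \<sigma>)"] balanced_zero[OF w] by (simp add: cap_notin[OF w])
    qed
    finally show ?thesis .
  qed
  consider "F \<notin> \<sigma>" | "G \<notin> \<sigma>" | "F \<in> \<sigma>" "G \<in> \<sigma>"
    by blast
  thus ?thesis
  proof cases
    case 1
    thus ?thesis
      using F G ne no_flag by (intro *) auto
  next
    case 2
    have "cap G (cap F w) \<sigma> = 0"
      using 2 F G ne no_flag by (intro *) auto
    thus ?thesis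
      using cap_commute[OF w F G] by simp
  next
    case 3
    thus ?thesis
      using no_flag by (simp add: cap_not_flag)
  qed
qed

lemma cap_uminus_sum:
  "cap F (\<lambda>\<tau>. - (\<Sum>H\<in>S. f H \<tau>)) \<sigma> = - (\<Sum>H\<in>S. cap F (f H) \<sigma>)"
proof -
  have "(\<Sum>K\<in>A. \<Sum>H\<in>S. f H (insert K \<sigma>)) = (\<Sum>H\<in>S. \<Sum>K\<in>A. f H (insert K \<sigma>))" for A
    by (rule sum.swap)
  thus ?thesis
    by (simp add: cap_def gap_sum_def sum_negf)
qed

lemma balanced_uminus_sum:
  assumes "\<And>H. H \<in> S \<Longrightarrow> balanced (f H)"
  shows "balanced (\<lambda>\<tau>. - (\<Sum>H\<in>S. f H \<tau>))"
proof -
  have eq: "star_sum (\<lambda>\<tau>. - (\<Sum>H\<in>S. f H \<tau>)) \<sigma> i = - (\<Sum>H\<in>S. star_sum (f H) \<sigma> i)" for \<sigma> i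
    unfolding star_sum_def by (simp add: sum_negf) (rule sum.swap)
  show ?thesis
    unfolding balanced_def eq
  proof (intro conjI allI impI)
    show "- (\<Sum>H\<in>S. f H \<sigma>) = 0" if "\<not> flag \<sigma>" for \<sigma>
      using balanced_zero[OF assms that] by simp
    fix \<sigma> i j assume ij: "flag \<sigma>" "i \<in> E" "j \<in> E" "\<forall>F\<in>\<sigma>. i \<in> F \<longleftrightarrow> j \<in> F"
    have "star_sum (f H) \<sigma> i = star_sum (f H) \<sigma> j" if "H \<in> S" for H
      using ij by (intro balanced_star[OF assms[OF that]]) auto
    thus "- (\<Sum>H\<in>S. star_sum (f H) \<sigma> i) = - (\<Sum>H\<in>S. star_sum (f H) \<sigma> j)"
      by simp
  qed
qed

lemma balanced_zero_weight: "balanced (\<lambda>_. 0)"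
  by (simp add: balanced_def star_sum_def)

section \<open>The weight of complete flags\<close>

definition complete_flag_weight :: "'a set set \<Rightarrow> rat" where
  "complete_flag_weight \<sigma> = of_bool (flag \<sigma> \<and> Suc (card \<sigma>) = rk E)"

lemma rk_inj_on_flag: "flag \<sigma> \<Longrightarrow> inj_on rk \<sigma>"
proof (rule inj_onI)
  fix F G assume "flag \<sigma>" "F \<in> \<sigma>" "G \<in> \<sigma>" "rk F = rk G"
  thus "F = G"
    using flag_comparable[of \<sigma> F G] flat_eqI[of F G] flat_eqI[of G F] flag_proper proper_flatD(1)
    by (metis order_refl)
qed

lemma rk_complete_flag:
  assumes "flag \<tau>" "Suc (card \<tau>) = rk E"
  shows "rk ` \<tau> = {1..<rk E}"
proof (rule card_subset_eq)
  show "rk ` \<tau> \<subseteq> {1..<rk E}"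
  proof safe
    fix F assume "F \<in> \<tau>"
    hence F: "F \<in> \<L>" "F \<subset> E" "{} \<subset> F"
      using assms(1) flag_proper proper_flatD by blast+
    show "rk F \<in> {1..<rk E}"
      using rk_less[OF F(1) ground_flat F(2)] rk_less[OF empty_flat F(1,3)] by simp
  qed
  show "card (rk ` \<tau>) = card {1..<rk E}"
    using assms card_image[OF rk_inj_on_flag[OF assms(1)]] by simp
qed simp

text \<open>If two elements of one gap are separated by a completing flat, the gap has rank two, and
  each of the two elements lies in exactly one completing flat.\<close>

lemma complete_flag_exchange:
  assumes \<sigma>: "flag \<sigma>" "Suc (Suc (card \<sigma>)) = rk E"
    and ij: "i \<in> E" "j \<in> E" "\<And>H. H \<in> \<sigma> \<Longrightarrow> i \<in> H \<longleftrightarrow> j \<in> H"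
    and G: "G \<in> proper_flats - \<sigma>" "flag (insert G \<sigma>)" "i \<in> G" "j \<notin> G"
  shows "\<And>G2. G2 \<in> proper_flats - \<sigma> \<Longrightarrow> flag (insert G2 \<sigma>) \<Longrightarrow> i \<in> G2 \<Longrightarrow> G2 = G"
    "\<exists>G'\<in>proper_flats - \<sigma>. flag (insert G' \<sigma>) \<and> j \<in> G' \<and> i \<notin> G'"
proof -
  have fin: "finite \<sigma>"
    using \<sigma> flag_finite by blast
  have ranks: "rk ` \<sigma> = {1..<rk E} - {rk H}" "rk H \<in> {1..<rk E}"
    if H: "H \<in> proper_flats - \<sigma>" "flag (insert H \<sigma>)" for H
  proof -
    have "Suc (card (insert H \<sigma>)) = rk E"
      using H(1) \<sigma>(2) fin by simp
    from rk_complete_flag[OF H(2) this] have im: "insert (rk H) (rk ` \<sigma>) = {1..<rk E}"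
      by simp
    have "rk H \<notin> rk ` \<sigma>"
      using rk_inj_on_flag[OF H(2)] H(1) by (auto dest: inj_onD)
    thus "rk ` \<sigma> = {1..<rk E} - {rk H}" "rk H \<in> {1..<rk E}"
      using im by blast+
  qed
  have flats: "H \<in> \<L>" if "H \<in> \<sigma>" for H
    using that \<sigma>(1) flag_proper proper_flatD(1) by blast
  have GL: "G \<in> \<L>" "G \<subset> E"
    using G(1) proper_flatD by auto
  have below: "H \<subset> G" if "H \<in> \<sigma>" "rk H < rk G" for H
    using flag_comparable[OF G(2), of H G] that rk_le[OF GL(1) flats[OF that(1)]] G(1) by auto
  have above: "G \<subset> H" if "H \<in> \<sigma>" "rk G < rk H" for H
    using flag_comparable[OF G(2), of H G] that rk_le[OF flats[OF that(1)] GL(1)] G(1) by auto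
  \<comment> \<open>The rank missing from the flag is that of \<open>G\<close>; \<open>M\<close> and
    \<open>N\<close> are its neighbours, with \<open>{}\<close> and \<open>E\<close> as possible
    ends.\<close>
  obtain M where M: "M \<in> insert {} \<sigma>" "M \<in> \<L>" "M \<subset> G" "Suc (rk M) = rk G"
  proof (cases "rk G = 1")
    case True
    thus ?thesis
      using that[of "{}"] G(3) by auto
  next
    case False
    hence "rk G - 1 \<in> {1..<rk E} - {rk G}"
      using ranks(2)[OF G(1,2)] by auto
    hence "rk G - 1 \<in> rk ` \<sigma>"
      by (simp only: ranks(1)[OF G(1,2)])
    then obtain M where "M \<in> \<sigma>" "Suc (rk M) = rk G"
      using ranks(2)[OF G(1,2)] by auto
    thus ?thesis
      using that[of M] below[of M] flats by auto
  qed
  obtain N where N: "N \<in> insert E \<sigma>" "N \<in> \<L>" "G \<subset> N" "rk N = Suc (rk G)"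
  proof (cases "Suc (rk G) = rk E")
    case True
    thus ?thesis
      using that[of E] GL(2) by auto
  next
    case False
    hence "Suc (rk G) \<in> rk ` \<sigma>"
      using ranks[OF G(1,2)] by auto
    then obtain N where "N \<in> \<sigma>" "rk N = Suc (rk G)"
      by auto
    thus ?thesis
      using that[of N] above[of N] flats by auto
  qed
  have iM: "i \<notin> M" "j \<notin> M"
    using M ij(3) G(4) by auto
  have jN: "j \<in> N"
    using N(1,3) ij G(3) by auto
  show "G2 = G" if G2: "G2 \<in> proper_flats - \<sigma>" "flag (insert G2 \<sigma>)" "i \<in> G2" for G2
  proof -
    have G2L: "G2 \<in> \<L>"
      using G2(1) proper_flatD by auto
    have rk2: "rk G2 = rk G"
    proof -
      have "rk G2 \<notin> rk ` \<sigma>"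
        unfolding ranks(1)[OF G2(1,2)] by simp
      thus ?thesis
        unfolding ranks(1)[OF G(1,2)] using ranks(2)[OF G2(1,2)] by simp
    qed
    have "M \<subseteq> G2"
    proof (cases "M = {}")
      case False
      hence "M \<in> \<sigma>"
        using M(1) by blast
      hence "M \<subseteq> G2 \<or> G2 \<subseteq> M"
        using flag_comparable[OF G2(2)] by blast
      thus ?thesis
        using iM(1) G2(3) by blast
    qed simp
    have "i \<in> E - M"
      using ij iM by blast
    \<comment> \<open>The least flat containing \<open>M\<close> and \<open>i\<close> is contained
      in both flats and has their rank, so all three coincide.\<close>
    from cover[OF M(2) this] obtain C where C: "C \<in> \<L>" "rk C = Suc (rk M)"
      "\<forall>H\<in>\<L>. M \<subseteq> H \<longrightarrow> i \<in> H \<longrightarrow> C \<subseteq> H"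
      by meson
    have "C = G2"
      using C G2L G2(3) \<open>M \<subseteq> G2\<close> M(4) rk2 by (intro flat_eqI) auto
    moreover have "C = G"
      using C GL(1) G(3) M(3,4) by (intro flat_eqI) auto
    ultimately show ?thesis
      by simp
  qed
  have "j \<in> E - M"
    using ij iM by blast
  from cover[OF M(2) this] obtain G' where G': "G' \<in> \<L>" "M \<subset> G'" "j \<in> G'" "rk G' = Suc (rk M)"
    "\<forall>H\<in>\<L>. M \<subseteq> H \<longrightarrow> j \<in> H \<longrightarrow> G' \<subseteq> H"
    by meson
  have "G' \<subseteq> N"
    using G'(5) N jN M(3) by auto
  hence G'N: "G' \<subset> N"
    using G'(4) M(4) N(4) by auto
  have "N \<subseteq> E"
    using N(2) flat_subset by blast
  hence proper: "G' \<in> proper_flats"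
    using G' G'N by (auto simp: proper_flats_def)
  have notin: "G' \<notin> \<sigma>"
    using ranks(1)[OF G(1,2)] G'(4) M(4) by auto
  have i': "i \<notin> G'"
  proof
    assume "i \<in> G'"
    have "i \<in> E - M"
      using ij iM by blast
    from cover[OF M(2) this] obtain C where C: "C \<in> \<L>" "rk C = Suc (rk M)"
      "\<forall>H\<in>\<L>. M \<subseteq> H \<longrightarrow> i \<in> H \<longrightarrow> C \<subseteq> H"
      by meson
    have "C = G'"
      using C G' \<open>i \<in> G'\<close> by (intro flat_eqI) auto
    moreover have "C = G"
      using C GL(1) G(3) M(3,4) by (intro flat_eqI) auto
    ultimately show False
      using G'(3) G(4) by simp
  qed
  have "H \<subseteq> G' \<or> G' \<subseteq> H" if H: "H \<in> \<sigma>" for H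
  proof -
    have "rk H \<noteq> rk G"
      using ranks(1)[OF G(1,2)] H by blast
    then consider "rk H < rk G" | "rk G < rk H"
      by linarith
    thus ?thesis
    proof cases
      case 1
      show ?thesis
      proof (cases "M = {}")
        case True
        hence "rk H = 0"
          using 1 M(4) by simp
        thus ?thesis
          using rk_pos[OF flats[OF H]] by auto
      next
        case False
        hence MS: "M \<in> \<sigma>"
          using M(1) by blast
        have "H \<subseteq> M"
        proof (rule ccontr)
          assume "\<not> H \<subseteq> M"
          hence "M \<subset> H"
            using flag_comparable[OF \<sigma>(1) H MS] by blast
          thus False
            using rk_less[OF M(2) flats[OF H]] 1 M(4) by simp
        qed
        thus ?thesis
          using G'(2) by blast
      qed
    next
      case 2
      show ?thesis
      proof (cases "N = E")
        case True
        have "H \<subset> E"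
          using H \<sigma>(1) flag_proper proper_flatD(2) by blast
        thus ?thesis
          using rk_less[OF flats[OF H] ground_flat] 2 N(4) True by simp
      next
        case False
        hence NS: "N \<in> \<sigma>"
          using N(1) by blast
        have "N \<subseteq> H"
        proof (rule ccontr)
          assume "\<not> N \<subseteq> H"
          hence "H \<subset> N"
            using flag_comparable[OF \<sigma>(1) H NS] by blast
          thus False
            using rk_less[OF flats[OF H] N(2)] 2 N(4) by simp
        qed
        thus ?thesis
          using G'N by blast
      qed
    qed
  qed
  hence "flag (insert G' \<sigma>)"
    using \<sigma>(1) proper unfolding flag_def by auto
  thus "\<exists>G'\<in>proper_flats - \<sigma>. flag (insert G' \<sigma>) \<and> j \<in> G' \<and> i \<notin> G'"
    using proper notin G'(3) i' by blast
qed

text \<open>Only flags lacking a single flat matter, and a star sum counts the completing flats that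
  contain the given element. If these collections differ for \<open>i\<close> and \<open>j\<close>,
  some completing flat separates the two, and by the exchange both counts are one.\<close>

lemma balanced_complete_flag_weight: "balanced complete_flag_weight"
  unfolding balanced_def
proof (intro conjI allI impI)
  show "complete_flag_weight \<sigma> = 0" if "\<not> flag \<sigma>" for \<sigma>
    using that by (simp add: complete_flag_weight_def)
  fix \<sigma> i j
  assume \<sigma>: "flag \<sigma>" and ij: "i \<in> E" "j \<in> E" "\<forall>H\<in>\<sigma>. i \<in> H \<longleftrightarrow> j \<in> H"
  have fin: "finite \<sigma>"
    using \<sigma> flag_finite by blast
  show "star_sum complete_flag_weight \<sigma> i = star_sum complete_flag_weight \<sigma> j"
  proof (cases "Suc (Suc (card \<sigma>)) = rk E")
    case False
    hence "star_sum complete_flag_weight \<sigma> k = 0" for k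
      unfolding star_sum_def complete_flag_weight_def using fin by (intro sum.neutral) auto
    thus ?thesis
      by simp
  next
    case True
    let ?A = "\<lambda>k. {G \<in> proper_flats - \<sigma>. flag (insert G \<sigma>) \<and> k \<in> G}"
    have count: "star_sum complete_flag_weight \<sigma> k = of_nat (card (?A k))" for k
    proof -
      have "star_sum complete_flag_weight \<sigma> k = (\<Sum>G\<in>?A k. 1)"
        unfolding star_sum_def complete_flag_weight_def using True fin
        by (intro sum.mono_neutral_cong_right) auto
      thus ?thesis
        by simp
    qed
    have ex: "?A k = {G} \<and> ?A l = {G'}"
      if kl: "k \<in> E" "l \<in> E" "\<And>H. H \<in> \<sigma> \<Longrightarrow> k \<in> H \<longleftrightarrow> l \<in> H" and G: "G \<in> ?A k" "l \<notin> G"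
        and G': "G' \<in> ?A l" "k \<notin> G'" for k l G G'
    proof -
      have "G2 = G" if "G2 \<in> ?A k" for G2
        using complete_flag_exchange(1)[OF \<sigma> True kl, of G G2] G that by auto
      moreover have "G2 = G'" if "G2 \<in> ?A l" for G2
        using complete_flag_exchange(1)[OF \<sigma> True kl(2,1) kl(3)[symmetric], of G' G2] G' that by auto
      ultimately show ?thesis
        using G(1) G'(1) by blast
    qed
    have "card (?A k) = card (?A l)"
      if kl: "k \<in> E" "l \<in> E" "\<And>H. H \<in> \<sigma> \<Longrightarrow> k \<in> H \<longleftrightarrow> l \<in> H" and G: "G \<in> ?A k" "l \<notin> G" for k l G
    proof -
      obtain G' where "G' \<in> ?A l" "k \<notin> G'"
        using complete_flag_exchange(2)[OF \<sigma> True kl, of G] G by blast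
      from ex[OF kl G this] show ?thesis
        by simp
    qed
    hence sep: "card (?A i) = card (?A j)" if "?A i \<noteq> ?A j"
      using that ij by (smt (verit, best) Collect_cong mem_Collect_eq)
    show ?thesis
      unfolding count using sep by (cases "?A i = ?A j") auto
  qed
qed

end

section \<open>The degree functional\<close>

lemma poly_mapping_sum_singles:
  "p = (\<Sum>k\<in>Poly_Mapping.keys p. Poly_Mapping.single k (Poly_Mapping.lookup p k))"
  (is "p = ?q")
proof (rule poly_mapping_eqI)
  fix m
  have "Poly_Mapping.lookup ?q m = (\<Sum>k\<in>Poly_Mapping.keys p. if k = m then Poly_Mapping.lookup p k else 0)"
    unfolding lookup_sum by (intro sum.cong refl) (simp add: lookup_single when_def)
  thus "Poly_Mapping.lookup p m = Poly_Mapping.lookup ?q m"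
    by (simp add: in_keys_iff)
qed

lemma keys_add_nat:
  fixes m k :: "'v \<Rightarrow>\<^sub>0 nat"
  shows "Poly_Mapping.keys (m + k) = Poly_Mapping.keys m \<union> Poly_Mapping.keys k"
  by (auto simp: in_keys_iff lookup_add)

lemma single_times_mpoly_var:
  "Poly_Mapping.single m c * mpoly_var v = Poly_Mapping.single (Poly_Mapping.single v 1 + m) c"
  by (simp add: mpoly_var_def mult_single add.commute)

lemma split_variable:
  fixes m :: "'v \<Rightarrow>\<^sub>0 nat"
  assumes "v \<in> Poly_Mapping.keys m"
  shows "m = Poly_Mapping.single v 1 + (m - Poly_Mapping.single v 1)"
proof (rule poly_mapping_eqI)
  fix k
  show "Poly_Mapping.lookup m k = Poly_Mapping.lookup (Poly_Mapping.single v 1 + (m - Poly_Mapping.single v 1)) k"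
    using assms by (auto simp: lookup_add lookup_minus lookup_single when_def in_keys_iff)
qed

text \<open>Since the operators commute, the extra application at \<open>v\<close> can be pulled to
  the front past all earlier ones.\<close>

lemma foldr_funpow_Suc:
  assumes "\<And>F G w. f F (f G w) = f G (f F w)" "distinct xs" "v \<in> set xs"
    "\<And>F. n' F = (if F = v then Suc (n F) else n F)"
  shows "foldr (\<lambda>F. f F ^^ n' F) xs w = f v (foldr (\<lambda>F. f F ^^ n F) xs w)"
  using assms(2,3)
proof (induction xs)
  case (Cons y ys)
  have pow: "(f F ^^ k) (f v w) = f v ((f F ^^ k) w)" for F k w
    using assms(1) by (induction k) auto
  show ?case
  proof (cases "y = v")
    case True
    hence "foldr (\<lambda>F. f F ^^ n' F) ys w = foldr (\<lambda>F. f F ^^ n F) ys w"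
      using Cons.prems assms(4) by (intro foldr_cong) auto
    thus ?thesis
      using True assms(4) by simp
  next
    case False
    thus ?thesis
      using Cons assms(4) by (simp add: pow)
  qed
qed simp

section \<open>The action of monomials and the degree\<close>

context flat_lattice
begin

text \<open>The last branch is meant for \<open>E\<close>: the linear relation forces this value,
  and \<open>sum_cap\<close> makes it independent of the element. Sending unbalanced weights to zero
  lets the operators commute without hypotheses, as iteration along a list requires.\<close>

definition cap_op :: "'a set \<Rightarrow> ('a set set \<Rightarrow> rat) \<Rightarrow> 'a set set \<Rightarrow> rat" where
  "cap_op F w = (if \<not> balanced w then (\<lambda>_. 0) else if F \<in> proper_flats then cap F w
    else (\<lambda>\<sigma>. - (\<Sum>G\<in>{G \<in> proper_flats. (SOME i. i \<in> E) \<in> G}. cap G w \<sigma>)))"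

lemma balanced_cap_op: "balanced (cap_op F w)"
  by (auto simp: cap_op_def balanced_zero_weight intro: balanced_cap balanced_uminus_sum)

lemma cap_zero: "cap F (\<lambda>_. 0) = (\<lambda>_. 0)"
  by (simp add: cap_def gap_sum_def fun_eq_iff)

lemma cap_op_zero: "cap_op F (\<lambda>_. 0) = (\<lambda>_. 0)"
  by (simp add: cap_op_def cap_zero)

lemma cap_op_commute: "cap_op F (cap_op G w) = cap_op G (cap_op F w)"
proof (cases "balanced w")
  case False
  thus ?thesis
    by (simp add: cap_op_def[of _ w] cap_op_zero)
next
  case w: True
  let ?S = "{G \<in> proper_flats. (SOME i. i \<in> E) \<in> G}"
  have mixed: "cap_op F (cap_op G w) = cap_op G (cap_op F w)"
    if F: "F \<in> proper_flats" and G: "G \<notin> proper_flats" for F G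
  proof
    fix \<sigma>
    have bF: "balanced (cap F w)"
      by (rule balanced_cap[OF w F])
    have b: "balanced (\<lambda>\<tau>. - (\<Sum>H\<in>?S. cap H w \<tau>))"
      by (intro balanced_uminus_sum balanced_cap[OF w]) auto
    have "cap_op F (cap_op G w) \<sigma> = cap F (\<lambda>\<tau>. - (\<Sum>H\<in>?S. cap H w \<tau>)) \<sigma>"
      using F G w b by (simp add: cap_op_def)
    also have "\<dots> = - (\<Sum>H\<in>?S. cap F (cap H w) \<sigma>)"
      by (rule cap_uminus_sum)
    also have "\<dots> = - (\<Sum>H\<in>?S. cap H (cap F w) \<sigma>)"
      by (intro arg_cong[of _ _ uminus] sum.cong refl cap_commute[OF w F]) auto
    also have "\<dots> = cap_op G (cap_op F w) \<sigma>"
      using F G w bF by (simp add: cap_op_def)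
    finally show "cap_op F (cap_op G w) \<sigma> = cap_op G (cap_op F w) \<sigma>" .
  qed
  consider "F \<in> proper_flats" "G \<in> proper_flats" | "F \<in> proper_flats" "G \<notin> proper_flats"
    | "F \<notin> proper_flats" "G \<in> proper_flats" | "F \<notin> proper_flats" "G \<notin> proper_flats"
    by blast
  thus ?thesis
  proof cases
    case 1
    thus ?thesis
      using w balanced_cap[OF w] cap_commute[OF w] by (auto simp: cap_op_def)
  next
    case 4
    have "cap_op F = cap_op G"
      using 4 by (simp add: cap_op_def fun_eq_iff)
    thus ?thesis
      by simp
  qed (use mixed[of F G] mixed[of G F] in auto)
qed

lemma cap_op_proper: "balanced w \<Longrightarrow> F \<in> proper_flats \<Longrightarrow> cap_op F w = cap F w"
  by (simp add: cap_op_def)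

lemma cap_op_incomparable:
  assumes "F \<in> \<L> - {{}}" "G \<in> \<L> - {{}}" "\<not> F \<subseteq> G" "\<not> G \<subseteq> F"
  shows "cap_op F (cap_op G w) \<sigma> = 0"
proof (cases "balanced w")
  case True
  have "F \<in> proper_flats" "G \<in> proper_flats"
    using assms flat_subset[of F] flat_subset[of G] unfolding proper_flats_def by blast+
  thus ?thesis
    using assms True by (simp add: cap_op_proper balanced_cap cap_incomparable)
next
  case False
  thus ?thesis
    by (simp add: cap_op_def[of G w] cap_op_zero)
qed

lemma cap_op_linear:
  assumes i: "i \<in> E"
  shows "(\<Sum>F\<in>{F \<in> \<L> - {{}}. i \<in> F}. cap_op F w \<sigma>) = 0"
proof (cases "balanced w \<and> flag \<sigma>")
  case True
  hence w: "balanced w" and \<sigma>: "flag \<sigma>"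
    by auto
  have "{F \<in> \<L> - {{}}. i \<in> F} = insert E {F \<in> proper_flats. i \<in> F}"
    using i by (auto simp: proper_flats_def)
  hence "(\<Sum>F\<in>{F \<in> \<L> - {{}}. i \<in> F}. cap_op F w \<sigma>) =
      cap_op E w \<sigma> + (\<Sum>F\<in>{F \<in> proper_flats. i \<in> F}. cap F w \<sigma>)"
    using w by (simp add: cap_op_proper proper_flats_def)
  moreover obtain t where t: "t \<in> E" "\<And>F. F \<in> \<sigma> \<Longrightarrow> t \<notin> F"
  proof -
    obtain M where M: "M \<in> insert {} \<sigma>" "\<And>H. H \<in> insert {} \<sigma> \<Longrightarrow> H \<subseteq> M"
      by (rule chain_max_below[OF \<sigma>, of "insert {} \<sigma>"]) auto
    have "M \<subset> E"
      using M(1) i \<sigma> flag_proper proper_flatD(2) by blast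
    then obtain t where "t \<in> E" "t \<notin> M"
      by blast
    thus ?thesis
      using that M(2) by blast
  qed
  moreover have "(SOME i. i \<in> E) \<in> E"
    using i by (rule someI)
  ultimately show ?thesis
    using w i by (simp add: cap_op_def sum_cap[OF w \<sigma> t] proper_flats_def[symmetric])
      (simp add: proper_flats_def)
next
  case False
  have "cap_op F w \<sigma> = 0" for F
  proof (cases "balanced w")
    case True
    hence "\<not> flag \<sigma>"
      using False by simp
    thus ?thesis
      using balanced_zero[OF balanced_cap_op] by blast
  qed (simp add: cap_op_def)
  thus ?thesis
    by simp
qed

definition flat_list :: "'a set list" where
  "flat_list = (SOME xs. set xs = \<L> - {{}} \<and> distinct xs)"

lemma flat_list: "set flat_list = \<L> - {{}}" "distinct flat_list"
  using someI_ex[OF finite_distinct_list[of "\<L> - {{}}"]] finite_flats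
  unfolding flat_list_def by auto

text \<open>Commutativity makes the order of \<open>flat_list\<close> irrelevant; each variable acts
  as often as its exponent says.\<close>

definition monomial_weight :: "('a set \<Rightarrow>\<^sub>0 nat) \<Rightarrow> 'a set set \<Rightarrow> rat" where
  "monomial_weight m = foldr (\<lambda>F. cap_op F ^^ Poly_Mapping.lookup m F) flat_list complete_flag_weight"

lemma monomial_weight_0: "monomial_weight 0 = complete_flag_weight"
proof -
  have "foldr (\<lambda>F. cap_op F ^^ Poly_Mapping.lookup 0 F) xs w = w" for xs w
    by (induction xs) auto
  thus ?thesis
    by (simp add: monomial_weight_def)
qed

lemma monomial_weight_add_single:
  assumes "F \<in> \<L> - {{}}"
  shows "monomial_weight (Poly_Mapping.single F 1 + m) = cap_op F (monomial_weight m)"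
  unfolding monomial_weight_def
  using assms flat_list by (intro foldr_funpow_Suc cap_op_commute)
    (auto simp: lookup_add lookup_single when_def)

text \<open>The degree map, normalized to one on products of complete flags and extended by zero to
  monomials with a variable that is not a nonempty flat.\<close>

definition degree_functional :: "'a chow_poly \<Rightarrow> rat" where
  "degree_functional p = (\<Sum>m\<in>Poly_Mapping.keys p. Poly_Mapping.lookup p m *
    (if Poly_Mapping.keys m \<subseteq> \<L> - {{}} then monomial_weight m {} else 0))"

lemma degree_functional_superset:
  assumes "finite S" "Poly_Mapping.keys p \<subseteq> S"
  shows "degree_functional p = (\<Sum>m\<in>S. Poly_Mapping.lookup p m *
    (if Poly_Mapping.keys m \<subseteq> \<L> - {{}} then monomial_weight m {} else 0))"
  unfolding degree_functional_def
  by (rule sum.mono_neutral_left) (use assms in \<open>auto simp: in_keys_iff\<close>)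

lemma degree_functional_add: "degree_functional (p + q) = degree_functional p + degree_functional q"
proof -
  let ?S = "Poly_Mapping.keys p \<union> Poly_Mapping.keys q"
  have "degree_functional r = (\<Sum>m\<in>?S. Poly_Mapping.lookup r m *
      (if Poly_Mapping.keys m \<subseteq> \<L> - {{}} then monomial_weight m {} else 0))" if "r \<in> {p, q, p + q}" for r
    using that by (intro degree_functional_superset) (auto dest: subsetD[OF keys_add])
  thus ?thesis
    by (simp add: lookup_add distrib_right sum.distrib)
qed

lemma degree_functional_0 [simp]: "degree_functional 0 = 0"
  by (simp add: degree_functional_def)

lemma degree_functional_sum: "degree_functional (sum f S) = (\<Sum>s\<in>S. degree_functional (f s))"
  by (induction S rule: infinite_finite_induct) (auto simp: degree_functional_add)

lemma degree_functional_single: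
  "degree_functional (Poly_Mapping.single m c) =
    c * (if Poly_Mapping.keys m \<subseteq> \<L> - {{}} then monomial_weight m {} else 0)"
  by (simp add: degree_functional_def)

text \<open>The largest ideal on which the functional vanishes; that it contains the relations can
  therefore be checked on generators.\<close>

definition degree_kernel :: "'a chow_poly set" where
  "degree_kernel = {p. \<forall>q. degree_functional (q * p) = 0}"

lemma subspace_degree_kernel: "rmod.subspace degree_kernel"
proof (rule rmod.subspaceI)
  show "c * p \<in> degree_kernel" if "p \<in> degree_kernel" for c p
  proof -
    have "degree_functional ((q * c) * p) = 0" for q
      using that by (auto simp: degree_kernel_def)
    thus ?thesis
      by (simp add: degree_kernel_def mult.assoc)
  qed
qed (auto simp: degree_kernel_def distrib_left degree_functional_add)

lemma degree_kernelI:
  assumes "\<And>m c. degree_functional (Poly_Mapping.single m c * p) = 0"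
  shows "p \<in> degree_kernel"
  unfolding degree_kernel_def
proof (intro CollectI allI)
  fix q
  have "q * p = (\<Sum>k\<in>Poly_Mapping.keys q. Poly_Mapping.single k (Poly_Mapping.lookup q k) * p)"
    by (subst (1) poly_mapping_sum_singles[of q]) (rule sum_distrib_right)
  thus "degree_functional (q * p) = 0"
    using assms by (simp add: degree_functional_sum)
qed

lemma degree_functional_single_var:
  assumes "F \<in> \<L> - {{}}"
  shows "degree_functional (Poly_Mapping.single m c * mpoly_var F) =
    c * (if Poly_Mapping.keys m \<subseteq> \<L> - {{}} then cap_op F (monomial_weight m) {} else 0)"
  using assms by (simp add: single_times_mpoly_var degree_functional_single keys_add_nat
      monomial_weight_add_single del: One_nat_def)

lemma outside_var_in_kernel: "F \<notin> \<L> - {{}} \<Longrightarrow> mpoly_var F \<in> degree_kernel"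
  by (rule degree_kernelI) (auto simp: single_times_mpoly_var degree_functional_single keys_add_nat)

lemma incomparable_in_kernel:
  assumes "F \<in> \<L> - {{}}" "G \<in> \<L> - {{}}" "\<not> F \<subseteq> G" "\<not> G \<subseteq> F"
  shows "mpoly_var F * mpoly_var G \<in> degree_kernel"
proof (rule degree_kernelI)
  fix m :: "'a set \<Rightarrow>\<^sub>0 nat" and c :: rat
  have "Poly_Mapping.single m c * (mpoly_var F * mpoly_var G) =
      Poly_Mapping.single (Poly_Mapping.single G 1 + m) c * mpoly_var F"
    by (subst single_times_mpoly_var[symmetric]) (simp only: ac_simps)
  thus "degree_functional (Poly_Mapping.single m c * (mpoly_var F * mpoly_var G)) = 0"
    by (simp add: degree_functional_single_var[OF assms(1)]
        monomial_weight_add_single[OF assms(2)] cap_op_incomparable[OF assms] del: One_nat_def)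
qed

lemma linear_in_kernel:
  assumes "i \<in> E"
  shows "(\<Sum>F\<in>{F \<in> \<L> - {{}}. i \<in> F}. mpoly_var F) \<in> degree_kernel"
proof (rule degree_kernelI)
  fix m :: "'a set \<Rightarrow>\<^sub>0 nat" and c :: rat
  let ?S = "{F \<in> \<L> - {{}}. i \<in> F}"
  have "degree_functional (Poly_Mapping.single m c * (\<Sum>F\<in>?S. mpoly_var F)) =
      (\<Sum>F\<in>?S. degree_functional (Poly_Mapping.single m c * mpoly_var F))"
    by (simp only: sum_distrib_left degree_functional_sum)
  also have "\<dots> = (\<Sum>F\<in>?S. c * (if Poly_Mapping.keys m \<subseteq> \<L> - {{}} then cap_op F (monomial_weight m) {} else 0))"
    by (intro sum.cong refl degree_functional_single_var) auto
  also have "\<dots> = c * (if Poly_Mapping.keys m \<subseteq> \<L> - {{}} then \<Sum>F\<in>?S. cap_op F (monomial_weight m) {} else 0)"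
    by (simp add: sum_distrib_left)
  also have "\<dots> = 0"
    using cap_op_linear[OF assms] by simp
  finally show "degree_functional (Poly_Mapping.single m c * (\<Sum>F\<in>?S. mpoly_var F)) = 0" .
qed

text \<open>Capping by a flat outside the flag merely inserts it, so for a square-free product over
  flats disjoint from \<open>\<tau>\<close> the gap sums never occur.\<close>

lemma monomial_weight_flag:
  assumes "finite \<sigma>" "flag (\<sigma> \<union> \<tau>)" "\<sigma> \<inter> \<tau> = {}"
  shows "monomial_weight (\<Sum>F\<in>\<sigma>. Poly_Mapping.single F 1) \<tau> = complete_flag_weight (\<sigma> \<union> \<tau>)"
  using assms
proof (induction \<sigma> arbitrary: \<tau> rule: finite_induct)
  case empty
  thus ?case
    by (simp add: monomial_weight_0)
next
  case (insert F \<sigma>)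
  let ?m = "\<Sum>F\<in>\<sigma>. Poly_Mapping.single F (1::nat)"
  have F: "F \<in> proper_flats"
    using insert.prems(1) by (auto simp: flag_def)
  hence F': "F \<in> \<L> - {{}}"
    by (auto simp: proper_flats_def)
  have bal: "balanced (monomial_weight ?m)"
  proof (cases flat_list)
    case Nil
    thus ?thesis
      by (simp add: monomial_weight_def balanced_complete_flag_weight)
  next
    case (Cons y ys)
    have pow: "balanced w \<Longrightarrow> balanced ((cap_op G ^^ k) w)" for G k w
      by (induction k) (auto simp: balanced_cap_op)
    have "balanced (foldr (\<lambda>F. cap_op F ^^ Poly_Mapping.lookup ?m F) xs complete_flag_weight)" for xs
      by (induction xs) (auto simp: balanced_complete_flag_weight pow)
    thus ?thesis
      by (simp add: monomial_weight_def)
  qed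
  have "monomial_weight (\<Sum>F\<in>insert F \<sigma>. Poly_Mapping.single F 1) \<tau> = cap_op F (monomial_weight ?m) \<tau>"
    using insert.hyps monomial_weight_add_single[OF F', of ?m] by simp
  also have "\<dots> = monomial_weight ?m (insert F \<tau>)"
    unfolding cap_op_proper[OF bal F]
    by (rule cap_notin[OF bal]) (use insert.prems(2) in auto)
  also have "\<dots> = complete_flag_weight (\<sigma> \<union> insert F \<tau>)"
    using insert.prems insert.hyps by (intro insert.IH) auto
  finally show ?case
    by simp
qed

lemma prod_mpoly_var:
  "finite \<sigma> \<Longrightarrow> (\<Prod>F\<in>\<sigma>. mpoly_var F :: 'a chow_poly) =
    Poly_Mapping.single (\<Sum>F\<in>\<sigma>. Poly_Mapping.single F 1) 1"
  by (induction \<sigma> rule: finite_induct) (auto simp: mpoly_var_def mult_single)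

lemma complete_flag_not_in_kernel:
  assumes "flag \<sigma>" "Suc (card \<sigma>) = rk E"
  shows "(\<Prod>F\<in>\<sigma>. mpoly_var F) \<notin> degree_kernel"
proof
  assume "(\<Prod>F\<in>\<sigma>. mpoly_var F) \<in> degree_kernel"
  hence "degree_functional (1 * (\<Prod>F\<in>\<sigma>. mpoly_var F)) = 0"
    unfolding degree_kernel_def by blast
  moreover have fin: "finite \<sigma>"
    using assms(1) flag_finite by blast
  moreover have "Poly_Mapping.keys (\<Sum>F\<in>\<sigma>. Poly_Mapping.single F (1::nat)) \<subseteq> \<L> - {{}}"
  proof
    fix F assume "F \<in> Poly_Mapping.keys (\<Sum>F\<in>\<sigma>. Poly_Mapping.single F (1::nat))"
    hence "(\<Sum>G\<in>\<sigma>. Poly_Mapping.lookup (Poly_Mapping.single G (1::nat)) F) \<noteq> 0"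
      by (simp add: in_keys_iff lookup_sum)
    then obtain G where "G \<in> \<sigma>" "Poly_Mapping.lookup (Poly_Mapping.single G (1::nat)) F \<noteq> 0"
      by (meson sum.neutral)
    hence "F \<in> \<sigma>"
      by (auto simp: lookup_single when_def split: if_splits)
    thus "F \<in> \<L> - {{}}"
      using assms(1) by (auto simp: flag_def proper_flats_def)
  qed
  ultimately have "monomial_weight (\<Sum>F\<in>\<sigma>. Poly_Mapping.single F 1) {} = 0"
    by (simp add: prod_mpoly_var degree_functional_single)
  thus False
    using monomial_weight_flag[OF fin, of "{}"] assms by (simp add: complete_flag_weight_def)
qed

end

section \<open>The relations of a simple matroid\<close>

context simple_matroid
begin

sublocale flats: flat_lattice E "{F. flat F}" rank
  by (rule flat_lattice)

lemma nonempty_flats_eq: "{F. flat F} - {{}} = nonempty_flats"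
  by (auto simp: nonempty_flats_def)

definition chow_generators :: "'a chow_poly set" where
  "chow_generators = {(\<Sum>F\<in>{F \<in> nonempty_flats. i \<in> F}. mpoly_var F) | i. i \<in> E} \<union>
    {mpoly_var F * mpoly_var G | F G.
        F \<in> nonempty_flats \<and> G \<in> nonempty_flats \<and> \<not> F \<subseteq> G \<and> \<not> G \<subseteq> F}"

text \<open>The ideal in the polynomial ring with a variable for every set; the superfluous variables
  are generators.\<close>

definition full_chow_ideal :: "'a chow_poly set" where
  "full_chow_ideal = rmod.span (chow_generators \<union> mpoly_var ` (- nonempty_flats))"

definition flat_var :: "'a set \<Rightarrow> 'a chow_poly" where
  "flat_var F = (if F = {} then 1 else mpoly_var F)"

lemma full_chow_ideal_kernel: "full_chow_ideal \<subseteq> flats.degree_kernel"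
  unfolding full_chow_ideal_def
proof (rule rmod.span_minimal[OF _ flats.subspace_degree_kernel], intro Un_least)
  show "chow_generators \<subseteq> flats.degree_kernel"
    unfolding chow_generators_def
    using flats.linear_in_kernel flats.incomparable_in_kernel unfolding nonempty_flats_eq by blast
  show "mpoly_var ` (- nonempty_flats) \<subseteq> flats.degree_kernel"
    using flats.outside_var_in_kernel unfolding nonempty_flats_eq by blast
qed

text \<open>The constant in the last axiom is the coefficient of the empty monomial. If nonzero it
  is an invertible rational, so annihilating the product of a complete flag would put that product
  into the kernel of the degree functional.\<close>

sublocale chow: chow_relations E "{F. flat F}" rank flat_var full_chow_ideal
proof
  show "rmod.subspace full_chow_ideal"
    by (simp add: full_chow_ideal_def)
  show "flat_var {} = 1"
    by (simp add: flat_var_def)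
  show "flat_var F * flat_var G \<in> full_chow_ideal"
    if "F \<in> {F. flat F}" "G \<in> {F. flat F}" "\<not> F \<subseteq> G" "\<not> G \<subseteq> F" for F G
  proof -
    have "F \<noteq> {}" "G \<noteq> {}" "F \<in> nonempty_flats" "G \<in> nonempty_flats"
      using that by (auto simp: nonempty_flats_def)
    hence "flat_var F * flat_var G \<in> chow_generators"
      using that unfolding chow_generators_def flat_var_def by auto
    thus ?thesis
      unfolding full_chow_ideal_def by (intro rmod.span_base) auto
  qed
  show "(\<Sum>F\<in>{F \<in> {F. flat F}. i \<in> F}. flat_var F) \<in> full_chow_ideal" if "i \<in> E" for i
  proof -
    have "(\<Sum>F\<in>{F \<in> {F. flat F}. i \<in> F}. flat_var F) = (\<Sum>F\<in>{F \<in> nonempty_flats. i \<in> F}. mpoly_var F)"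
      by (intro sum.cong) (auto simp: nonempty_flats_def flat_var_def)
    also have "\<dots> \<in> full_chow_ideal"
      unfolding full_chow_ideal_def chow_generators_def using that by (intro rmod.span_base) blast
    finally show ?thesis .
  qed
  fix r :: "'a chow_poly"
  let ?B = "rmod.span (full_chow_ideal \<union> flat_var ` ({F. flat F} - {{}}))"
  let ?c = "Poly_Mapping.lookup r 0"
  have var: "mpoly_var F \<in> ?B" for F
  proof (cases "F \<in> nonempty_flats")
    case True
    hence "mpoly_var F \<in> flat_var ` ({F. flat F} - {{}})"
      by (force simp: nonempty_flats_def flat_var_def)
    thus ?thesis
      by (intro rmod.span_base) blast
  next
    case False
    hence "mpoly_var F \<in> full_chow_ideal"
      unfolding full_chow_ideal_def by (intro rmod.span_base) blast
    thus ?thesis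
      by (intro rmod.span_base) blast
  qed
  have single: "Poly_Mapping.single m a \<in> ?B" if "m \<noteq> 0" for m :: "'a set \<Rightarrow>\<^sub>0 nat" and a
  proof -
    obtain v where "v \<in> Poly_Mapping.keys m"
      using \<open>m \<noteq> 0\<close> keys_eq_empty by blast
    hence "Poly_Mapping.single m a = Poly_Mapping.single (m - Poly_Mapping.single v 1) a * mpoly_var v"
      using split_variable[of v m] single_times_mpoly_var by metis
    thus ?thesis
      using rmod.span_scale[OF var] by metis
  qed
  have "r - Poly_Mapping.single 0 ?c \<in> ?B"
  proof -
    have "r = (\<Sum>k\<in>insert 0 (Poly_Mapping.keys r). Poly_Mapping.single k (Poly_Mapping.lookup r k))"
      by (subst poly_mapping_sum_singles[of r], rule sum.mono_neutral_left)
        (auto simp: in_keys_iff)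
    also have "\<dots> = Poly_Mapping.single 0 ?c +
        (\<Sum>k\<in>Poly_Mapping.keys r - {0}. Poly_Mapping.single k (Poly_Mapping.lookup r k))"
      by (simp add: sum.insert_remove)
    finally have "r - Poly_Mapping.single 0 ?c =
        (\<Sum>k\<in>Poly_Mapping.keys r - {0}. Poly_Mapping.single k (Poly_Mapping.lookup r k))"
      by (simp add: algebra_simps)
    also have "\<dots> \<in> ?B"
      by (intro rmod.span_sum single) auto
    finally show ?thesis .
  qed
  moreover have "Poly_Mapping.single 0 ?c * (\<Prod>F\<in>\<sigma>. flat_var F) \<notin> full_chow_ideal"
    if "?c \<noteq> 0" and \<sigma>: "\<sigma> \<subseteq> {F. flat F} - {{}, E}" "\<forall>F\<in>\<sigma>. \<forall>G\<in>\<sigma>. F \<subseteq> G \<or> G \<subseteq> F"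
      "Suc (card \<sigma>) = rank E" for \<sigma>
  proof
    assume "Poly_Mapping.single 0 ?c * (\<Prod>F\<in>\<sigma>. flat_var F) \<in> full_chow_ideal"
    hence "Poly_Mapping.single 0 (1 / ?c) * (Poly_Mapping.single 0 ?c * (\<Prod>F\<in>\<sigma>. flat_var F)) \<in> full_chow_ideal"
      unfolding full_chow_ideal_def by (rule rmod.span_scale)
    also have "Poly_Mapping.single 0 (1 / ?c) * (Poly_Mapping.single 0 ?c * (\<Prod>F\<in>\<sigma>. flat_var F)) =
        (\<Prod>F\<in>\<sigma>. flat_var F)"
      using \<open>?c \<noteq> 0\<close> by (simp add: mult.assoc[symmetric] mult_single)
    also have "\<dots> = (\<Prod>F\<in>\<sigma>. mpoly_var F)"
      using \<sigma>(1) by (intro prod.cong) (auto simp: flat_var_def)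
    finally have "(\<Prod>F\<in>\<sigma>. mpoly_var F) \<in> flats.degree_kernel"
      using full_chow_ideal_kernel by blast
    moreover have "flats.flag \<sigma>"
      using \<sigma> by (simp add: flats.flag_def flats.proper_flats_def)
    ultimately show False
      using flats.complete_flag_not_in_kernel \<sigma>(3) by blast
  qed
  ultimately show "\<exists>c. r - c \<in> ?B \<and> (c = 0 \<or> (\<forall>\<sigma>. \<sigma> \<subseteq> {F. flat F} - {{}, E} \<longrightarrow>
      (\<forall>F\<in>\<sigma>. \<forall>G\<in>\<sigma>. F \<subseteq> G \<or> G \<subseteq> F) \<longrightarrow> Suc (card \<sigma>) = rank E \<longrightarrow>
      c * (\<Prod>F\<in>\<sigma>. flat_var F) \<notin> full_chow_ideal))"
    by (intro exI[of _ "Poly_Mapping.single 0 ?c"]) (cases "?c = 0"; simp)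
qed

end

section \<open>Polynomial rings\<close>

lemma mpoly_ring_simps [simp]:
  "carrier (mpoly_ring V) = {p. \<forall>m\<in>Poly_Mapping.keys p. Poly_Mapping.keys m \<subseteq> V}"
  "mult (mpoly_ring V) = (*)" "one (mpoly_ring V) = 1" "zero (mpoly_ring V) = 0"
  "add (mpoly_ring V) = (+)"
  by (simp_all add: mpoly_ring_def)

lemma mpoly_carrier_mult:
  fixes p q :: "('v \<Rightarrow>\<^sub>0 nat) \<Rightarrow>\<^sub>0 'k::comm_ring_1"
  assumes "p \<in> carrier (mpoly_ring V)" "q \<in> carrier (mpoly_ring V)"
  shows "p * q \<in> carrier (mpoly_ring V)"
proof -
  have "Poly_Mapping.keys m \<subseteq> V" if m: "m \<in> Poly_Mapping.keys (p * q)" for m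
  proof -
    obtain a b where "m = a + b" "a \<in> Poly_Mapping.keys p" "b \<in> Poly_Mapping.keys q"
      using subsetD[OF keys_mult m] by blast
    thus ?thesis
      using assms by (auto simp: keys_add_nat)
  qed
  thus ?thesis
    by simp
qed

lemma mpoly_carrier_add:
  "p \<in> carrier (mpoly_ring V) \<Longrightarrow> q \<in> carrier (mpoly_ring V) \<Longrightarrow> p + q \<in> carrier (mpoly_ring V)"
  using keys_add[of p q] by auto

lemma mpoly_carrier_uminus: "p \<in> carrier (mpoly_ring V) \<Longrightarrow> - p \<in> carrier (mpoly_ring V)"
  by simp

lemma mpoly_carrier_diff:
  "p \<in> carrier (mpoly_ring V) \<Longrightarrow> q \<in> carrier (mpoly_ring V) \<Longrightarrow> p - q \<in> carrier (mpoly_ring V)"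
  using keys_diff[of p q] by auto

lemma mpoly_carrier_single:
  "Poly_Mapping.keys m \<subseteq> V \<Longrightarrow> Poly_Mapping.single m c \<in> carrier (mpoly_ring V)"
  by simp

lemma mpoly_carrier_var: "v \<in> V \<Longrightarrow> mpoly_var v \<in> carrier (mpoly_ring V)"
  by (simp add: mpoly_var_def)

lemma mpoly_carrier_sum:
  "(\<And>s. s \<in> S \<Longrightarrow> f s \<in> carrier (mpoly_ring V)) \<Longrightarrow> sum f S \<in> carrier (mpoly_ring V)"
proof (induction S rule: infinite_finite_induct)
  case (insert s S)
  thus ?case
    using mpoly_carrier_add[of "f s" V "sum f S"] by (simp del: mpoly_ring_simps(1))
qed simp_all

lemma cring_mpoly_ring: "cring (mpoly_ring V :: (('v \<Rightarrow>\<^sub>0 nat) \<Rightarrow>\<^sub>0 'k::comm_ring_1) ring)"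
proof (rule cringI)
  let ?P = "mpoly_ring V :: (('v \<Rightarrow>\<^sub>0 nat) \<Rightarrow>\<^sub>0 'k) ring"
  show "abelian_group ?P"
  proof (rule abelian_groupI)
    fix x assume "x \<in> carrier ?P"
    thus "\<exists>y\<in>carrier ?P. y \<oplus>\<^bsub>?P\<^esub> x = \<zero>\<^bsub>?P\<^esub>"
      by (intro bexI[of _ "- x"]) simp_all
  next
    fix x y assume "x \<in> carrier ?P" "y \<in> carrier ?P"
    thus "x \<oplus>\<^bsub>?P\<^esub> y \<in> carrier ?P"
      using mpoly_carrier_add[of x V y] by (simp del: mpoly_ring_simps(1))
  qed (simp_all add: add.assoc add.commute)
  show "Group.comm_monoid ?P"
  proof (rule Group.comm_monoidI)
    fix x y assume "x \<in> carrier ?P" "y \<in> carrier ?P"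
    thus "x \<otimes>\<^bsub>?P\<^esub> y \<in> carrier ?P"
      using mpoly_carrier_mult[of x V y] by (simp del: mpoly_ring_simps(1))
  next
    show "\<one>\<^bsub>?P\<^esub> \<in> carrier ?P"
      using mpoly_carrier_single[of 0 V 1] by (simp del: mpoly_ring_simps(1))
  qed (simp_all add: mult.assoc mult.commute)
qed (simp add: distrib_right)

lemma mpoly_ring_a_inv:
  assumes "p \<in> carrier (mpoly_ring V)"
  shows "\<ominus>\<^bsub>mpoly_ring V\<^esub> p = - p"
proof -
  interpret cring "mpoly_ring V"
    by (rule cring_mpoly_ring)
  show ?thesis
    using assms mpoly_carrier_uminus[OF assms] by (intro minus_equality) auto
qed

lemma mpoly_ring_minus:
  assumes "p \<in> carrier (mpoly_ring V)" "q \<in> carrier (mpoly_ring V)"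
  shows "p \<ominus>\<^bsub>mpoly_ring V\<^esub> q = p - q"
  by (simp add: a_minus_def mpoly_ring_a_inv[OF assms(2)])

lemma mpoly_ring_idealI:
  fixes I :: "(('v \<Rightarrow>\<^sub>0 nat) \<Rightarrow>\<^sub>0 'k::comm_ring_1) set"
  assumes "I \<subseteq> carrier (mpoly_ring V)" "0 \<in> I" "\<And>p q. p \<in> I \<Longrightarrow> q \<in> I \<Longrightarrow> p + q \<in> I"
    "\<And>c p. c \<in> carrier (mpoly_ring V) \<Longrightarrow> p \<in> I \<Longrightarrow> c * p \<in> I"
  shows "ideal I (mpoly_ring V)"
proof (rule idealI)
  interpret cring "mpoly_ring V :: (('v \<Rightarrow>\<^sub>0 nat) \<Rightarrow>\<^sub>0 'k) ring"
    by (rule cring_mpoly_ring)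
  show "ring (mpoly_ring V :: (('v \<Rightarrow>\<^sub>0 nat) \<Rightarrow>\<^sub>0 'k) ring)"
    by (rule ring_axioms)
  show "subgroup I (add_monoid (mpoly_ring V))"
  proof (rule add.subgroupI)
    fix p assume p: "p \<in> I"
    hence pc: "p \<in> carrier (mpoly_ring V)"
      using assms(1) by blast
    have "- 1 \<in> carrier (mpoly_ring V :: (('v \<Rightarrow>\<^sub>0 nat) \<Rightarrow>\<^sub>0 'k) ring)"
      using mpoly_carrier_uminus one_closed by (metis mpoly_ring_simps(3))
    from assms(4)[OF this p] show "\<ominus>\<^bsub>mpoly_ring V\<^esub> p \<in> I"
      by (simp only: mpoly_ring_a_inv[OF pc] mult_minus1)
  qed (use assms in auto)
  show "p \<otimes>\<^bsub>mpoly_ring V\<^esub> c \<in> I" if "p \<in> I" "c \<in> carrier (mpoly_ring V)" for p c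
    using assms(4)[OF that(2,1)] by (simp add: mult.commute)
qed (use assms(4) in auto)

section \<open>Ideals in the variables of V and in all variables\<close>

definition outside_polys :: "'v set \<Rightarrow> (('v \<Rightarrow>\<^sub>0 nat) \<Rightarrow>\<^sub>0 'k::comm_ring_1) set" where
  "outside_polys V = {p. \<forall>m\<in>Poly_Mapping.keys p. \<not> Poly_Mapping.keys m \<subseteq> V}"

lemma subspace_outside_polys: "rmod.subspace (outside_polys V)"
proof (rule rmod.subspaceI)
  show "c * p \<in> outside_polys V" if "p \<in> outside_polys V" for c p
  proof -
    have "\<not> Poly_Mapping.keys m \<subseteq> V" if m: "m \<in> Poly_Mapping.keys (c * p)" for m
    proof -
      obtain a b where "m = a + b" "b \<in> Poly_Mapping.keys p"
        using subsetD[OF keys_mult m] by blast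
      thus ?thesis
        using \<open>p \<in> _\<close> by (auto simp: outside_polys_def keys_add_nat)
    qed
    thus ?thesis
      by (simp add: outside_polys_def)
  qed
  show "p + q \<in> outside_polys V" if "p \<in> outside_polys V" "q \<in> outside_polys V" for p q
    using that keys_add[of p q] by (auto simp: outside_polys_def)
qed (simp add: outside_polys_def)

lemma outside_var: "v \<notin> V \<Longrightarrow> mpoly_var v \<in> outside_polys V"
  by (simp add: outside_polys_def mpoly_var_def)

lemma split_poly:
  obtains q n where "p = q + n" "q \<in> carrier (mpoly_ring V)" "n \<in> outside_polys V"
    "n \<in> rmod.span (mpoly_var ` (- V))"
proof -
  let ?f = "\<lambda>k. Poly_Mapping.single k (Poly_Mapping.lookup p k)"
  let ?A = "{k \<in> Poly_Mapping.keys p. Poly_Mapping.keys k \<subseteq> V}"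
  let ?B = "{k \<in> Poly_Mapping.keys p. \<not> Poly_Mapping.keys k \<subseteq> V}"
  have "Poly_Mapping.keys p = ?A \<union> ?B"
    by blast
  hence "p = sum ?f (?A \<union> ?B)"
    using poly_mapping_sum_singles[of p] by metis
  also have "\<dots> = sum ?f ?A + sum ?f ?B"
    by (rule sum.union_disjoint) auto
  finally have "p = sum ?f ?A + sum ?f ?B" .
  moreover have "sum ?f ?A \<in> carrier (mpoly_ring V)"
    by (rule mpoly_carrier_sum) simp
  moreover have "sum ?f ?B \<in> outside_polys V"
    by (rule rmod.subspace_sum[OF subspace_outside_polys]) (simp add: outside_polys_def)
  moreover have "sum ?f ?B \<in> rmod.span (mpoly_var ` (- V))"
  proof (rule rmod.span_sum)
    fix k assume "k \<in> ?B"
    then obtain v where v: "v \<in> Poly_Mapping.keys k" "v \<notin> V"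
      by blast
    have "?f k = Poly_Mapping.single (k - Poly_Mapping.single v 1) (Poly_Mapping.lookup p k) * mpoly_var v"
      using split_variable[OF v(1)] single_times_mpoly_var by metis
    moreover have "mpoly_var v \<in> rmod.span (mpoly_var ` (- V))"
      using v(2) by (intro rmod.span_base) blast
    ultimately show "?f k \<in> rmod.span (mpoly_var ` (- V))"
      using rmod.span_scale by metis
  qed
  ultimately show ?thesis
    using that by blast
qed

lemma carrier_Int_outside_polys:
  "p \<in> carrier (mpoly_ring V) \<Longrightarrow> p \<in> outside_polys V \<Longrightarrow> p = 0"
  using keys_eq_empty[of p] by (auto simp: outside_polys_def)

text \<open>In the ring with all variables the foreign ones are added as generators. Every element
  of the resulting ideal is a member of the ideal generated over \<open>V\<close> plus a polynomial
  each of whose monomials contains a foreign variable; for an element of the carrier the second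
  summand vanishes.\<close>

lemma genideal_iff_span:
  fixes A :: "(('v \<Rightarrow>\<^sub>0 nat) \<Rightarrow>\<^sub>0 'k::comm_ring_1) set"
  assumes A: "A \<subseteq> carrier (mpoly_ring V)" and p: "p \<in> carrier (mpoly_ring V)"
  shows "p \<in> genideal (mpoly_ring V) A \<longleftrightarrow> p \<in> rmod.span (A \<union> mpoly_var ` (- V))"
proof
  interpret cring "mpoly_ring V :: (('v \<Rightarrow>\<^sub>0 nat) \<Rightarrow>\<^sub>0 'k) ring"
    by (rule cring_mpoly_ring)
  let ?S = "rmod.span (A \<union> mpoly_var ` (- V))"
  show "p \<in> ?S" if "p \<in> genideal (mpoly_ring V) A"
  proof -
    have "ideal (carrier (mpoly_ring V) \<inter> ?S) (mpoly_ring V)"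
    proof (rule mpoly_ring_idealI)
      show "c * q \<in> carrier (mpoly_ring V) \<inter> ?S"
        if "c \<in> carrier (mpoly_ring V)" "q \<in> carrier (mpoly_ring V) \<inter> ?S" for c q
        using that mpoly_carrier_mult rmod.span_scale by blast
      show "q + r \<in> carrier (mpoly_ring V) \<inter> ?S"
        if "q \<in> carrier (mpoly_ring V) \<inter> ?S" "r \<in> carrier (mpoly_ring V) \<inter> ?S" for q r
        using that mpoly_carrier_add rmod.span_add by blast
    qed (use rmod.span_zero in auto)
    moreover have "A \<subseteq> carrier (mpoly_ring V) \<inter> ?S"
      using A by (auto intro: rmod.span_base)
    ultimately show ?thesis
      using genideal_minimal that by blast
  qed
  show "p \<in> genideal (mpoly_ring V) A" if pS: "p \<in> ?S"
  proof -
    interpret I: ideal "genideal (mpoly_ring V) A" "mpoly_ring V"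
      using A by (rule genideal_ideal)
    let ?U = "{q + n | q n. q \<in> genideal (mpoly_ring V) A \<and> n \<in> outside_polys V}"
    have add: "q + r \<in> genideal (mpoly_ring V) A"
      if "q \<in> genideal (mpoly_ring V) A" "r \<in> genideal (mpoly_ring V) A" for q r
      using I.a_closed[OF that] by simp
    have mult: "c * q \<in> genideal (mpoly_ring V) A"
      if "q \<in> genideal (mpoly_ring V) A" "c \<in> carrier (mpoly_ring V)" for c q
      using I.I_l_closed[OF that] by simp
    have zero: "0 \<in> genideal (mpoly_ring V) A"
      using I.zero_closed by simp
    have "?S \<subseteq> ?U"
    proof (rule rmod.span_minimal)
      show "rmod.subspace ?U"
      proof (rule rmod.subspaceI)
        show "0 \<in> ?U"
          using zero rmod.subspace_0[OF subspace_outside_polys] by force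
        show "a + b \<in> ?U" if ab: "a \<in> ?U" "b \<in> ?U" for a b
        proof -
          obtain q n r m where "a = q + n" "b = r + m" "q \<in> genideal (mpoly_ring V) A"
            "r \<in> genideal (mpoly_ring V) A" "n \<in> outside_polys V" "m \<in> outside_polys V"
            using ab by blast
          moreover from this have "a + b = (q + r) + (n + m)"
            by simp
          ultimately show ?thesis
            using add rmod.subspace_add[OF subspace_outside_polys] by blast
        qed
        show "c * a \<in> ?U" if ca: "a \<in> ?U" for c a
        proof -
          obtain q n where a: "a = q + n" "q \<in> genideal (mpoly_ring V) A" "n \<in> outside_polys V"
            using ca by blast
          obtain d e where c: "c = d + e" "d \<in> carrier (mpoly_ring V)" "e \<in> outside_polys V"
            by (rule split_poly)
          have "c * a = d * q + (e * q + c * n)"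
            using a(1) c(1) by (simp add: algebra_simps)
          moreover have "e * q + c * n \<in> outside_polys V"
            using a(3) c(3) by (intro rmod.subspace_add[OF subspace_outside_polys]
                rmod_subspaceD(3,4)[OF subspace_outside_polys])
          ultimately show ?thesis
            using mult[OF a(2) c(2)] by blast
        qed
      qed
      have "a \<in> ?U" if "a \<in> A" for a
      proof -
        have "a = a + 0" "a \<in> genideal (mpoly_ring V) A"
          using genideal_self[OF A] that by auto
        thus ?thesis
          using rmod.subspace_0[OF subspace_outside_polys] by blast
      qed
      moreover have "mpoly_var v \<in> ?U" if "v \<notin> V" for v
      proof -
        have "mpoly_var v = 0 + mpoly_var v"
          by simp
        thus ?thesis
          using zero outside_var[OF that] by blast
      qed
      ultimately show "A \<union> mpoly_var ` (- V) \<subseteq> ?U"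
        by blast
    qed
    then obtain q n where qn: "p = q + n" "q \<in> genideal (mpoly_ring V) A" "n \<in> outside_polys V"
      using pS by blast
    have "n = p - q"
      using qn(1) by simp
    hence "n \<in> carrier (mpoly_ring V)"
      using mpoly_carrier_diff[OF p, of q] I.Icarr[OF qn(2)] by simp
    hence "n = 0"
      using qn(3) by (intro carrier_Int_outside_polys)
    thus ?thesis
      using qn by simp
  qed
qed

section \<open>Homogeneous parts of polynomials\<close>

definition homogeneous_part :: "nat \<Rightarrow> (('v \<Rightarrow>\<^sub>0 nat) \<Rightarrow>\<^sub>0 'k::comm_ring_1) \<Rightarrow> ('v \<Rightarrow>\<^sub>0 nat) \<Rightarrow>\<^sub>0 'k" where
  "homogeneous_part d p = (\<Sum>m\<in>{m \<in> Poly_Mapping.keys p. monom_degree m = d}.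
    Poly_Mapping.single m (Poly_Mapping.lookup p m))"

lemma lookup_homogeneous_part:
  "Poly_Mapping.lookup (homogeneous_part d p) m = (if monom_degree m = d then Poly_Mapping.lookup p m else 0)"
proof -
  have "Poly_Mapping.lookup (homogeneous_part d p) m =
      (\<Sum>k\<in>{m \<in> Poly_Mapping.keys p. monom_degree m = d}. if k = m then Poly_Mapping.lookup p k else 0)"
    unfolding homogeneous_part_def lookup_sum
    by (intro sum.cong refl) (simp add: lookup_single when_def)
  thus ?thesis
    by (auto simp: in_keys_iff)
qed

lemma homogeneous_part_add:
  "homogeneous_part d (p + q) = homogeneous_part d p + homogeneous_part d q"
  by (rule poly_mapping_eqI) (simp add: lookup_homogeneous_part lookup_add)

lemma homogeneous_part_diff:
  "homogeneous_part d (p - q) = homogeneous_part d p - homogeneous_part d q"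
  by (rule poly_mapping_eqI) (simp add: lookup_homogeneous_part lookup_minus)

lemma homogeneous_part_0 [simp]: "homogeneous_part d 0 = 0"
  by (rule poly_mapping_eqI) (simp add: lookup_homogeneous_part)

lemma homogeneous_part_sum: "homogeneous_part d (sum f S) = (\<Sum>s\<in>S. homogeneous_part d (f s))"
  by (induction S rule: infinite_finite_induct) (auto simp: homogeneous_part_add)

lemma homogeneous_part_single:
  "homogeneous_part d (Poly_Mapping.single m c) = (if monom_degree m = d then Poly_Mapping.single m c else 0)"
  by (rule poly_mapping_eqI) (auto simp: lookup_homogeneous_part lookup_single when_def)

lemma monom_degree_superset:
  "finite S \<Longrightarrow> Poly_Mapping.keys m \<subseteq> S \<Longrightarrow> monom_degree m = (\<Sum>v\<in>S. Poly_Mapping.lookup m v)"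
  unfolding monom_degree_def by (rule sum.mono_neutral_left) (auto simp: in_keys_iff)

lemma monom_degree_add: "monom_degree (m + k) = monom_degree m + monom_degree k"
proof -
  let ?S = "Poly_Mapping.keys m \<union> Poly_Mapping.keys k"
  have "monom_degree l = (\<Sum>v\<in>?S. Poly_Mapping.lookup l v)" if "l \<in> {m, k, m + k}" for l
    using that by (intro monom_degree_superset) (auto simp: keys_add_nat)
  thus ?thesis
    by (simp add: lookup_add sum.distrib)
qed

lemma monom_degree_single [simp]: "monom_degree (Poly_Mapping.single v n) = n"
  by (simp add: monom_degree_def)

lemma monom_degree_0 [simp]: "monom_degree 0 = 0"
  by (simp add: monom_degree_def)

lemma monom_degree_eq_0: "monom_degree m = 0 \<longleftrightarrow> m = 0"
  unfolding monom_degree_def by (metis finite_keys in_keys_iff keys_eq_empty ex_in_conv sum_eq_0_iff)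

lemma homogeneous_part_single_mult:
  "homogeneous_part d (Poly_Mapping.single m c * p) =
    (if monom_degree m \<le> d then Poly_Mapping.single m c * homogeneous_part (d - monom_degree m) p else 0)"
proof -
  have "Poly_Mapping.single m c * p =
      (\<Sum>k\<in>Poly_Mapping.keys p. Poly_Mapping.single (m + k) (c * Poly_Mapping.lookup p k))"
    by (subst (1) poly_mapping_sum_singles[of p]) (simp add: sum_distrib_left mult_single)
  hence "homogeneous_part d (Poly_Mapping.single m c * p) =
      (\<Sum>k\<in>Poly_Mapping.keys p. if monom_degree m + monom_degree k = d
        then Poly_Mapping.single (m + k) (c * Poly_Mapping.lookup p k) else 0)"
    by (simp add: homogeneous_part_sum homogeneous_part_single monom_degree_add)
  also have "\<dots> = (\<Sum>k\<in>{k \<in> Poly_Mapping.keys p. monom_degree m + monom_degree k = d}.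
        Poly_Mapping.single (m + k) (c * Poly_Mapping.lookup p k))"
    by (intro sum.mono_neutral_cong_right) auto
  finally have eq: "homogeneous_part d (Poly_Mapping.single m c * p) =
      (\<Sum>k\<in>{k \<in> Poly_Mapping.keys p. monom_degree m + monom_degree k = d}.
        Poly_Mapping.single (m + k) (c * Poly_Mapping.lookup p k))" .
  show ?thesis
  proof (cases "monom_degree m \<le> d")
    case True
    hence "{k \<in> Poly_Mapping.keys p. monom_degree m + monom_degree k = d} =
        {k \<in> Poly_Mapping.keys p. monom_degree k = d - monom_degree m}"
      by auto
    thus ?thesis
      unfolding eq using True
      by (simp add: homogeneous_part_def[of "d - monom_degree m"] sum_distrib_left mult_single)
  next
    case False
    thus ?thesis
      unfolding eq by (auto intro!: sum.neutral)
  qed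
qed

text \<open>The polynomials all of whose parts lie in the ideal form an ideal containing the
  generators. For closure under multiplication the factor is split into terms, each of which only
  shifts degrees.\<close>

lemma homogeneous_parts_in_span:
  assumes A: "\<And>a. a \<in> A \<Longrightarrow> \<exists>e. \<forall>d. homogeneous_part d a = (if d = e then a else 0)"
    and p: "p \<in> rmod.span A"
  shows "homogeneous_part d p \<in> rmod.span A"
proof -
  let ?S = "{p. \<forall>d. homogeneous_part d p \<in> rmod.span A}"
  have "rmod.span A \<subseteq> ?S"
  proof (rule rmod.span_minimal)
    show "A \<subseteq> ?S"
    proof safe
      fix a d assume a: "a \<in> A"
      then obtain e where "\<forall>d. homogeneous_part d a = (if d = e then a else 0)"
        using A by blast
      thus "homogeneous_part d a \<in> rmod.span A"
        using a rmod.span_base rmod.span_zero by auto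
    qed
    show "rmod.subspace ?S"
    proof (rule rmod.subspaceI)
      show "c * p \<in> ?S" if p: "p \<in> ?S" for c p
      proof safe
        fix d
        have "c * p = (\<Sum>k\<in>Poly_Mapping.keys c. Poly_Mapping.single k (Poly_Mapping.lookup c k) * p)"
          by (subst (1) poly_mapping_sum_singles[of c]) (rule sum_distrib_right)
        moreover have "homogeneous_part d (Poly_Mapping.single k b * p) \<in> rmod.span A" for k b
          using p by (auto simp: homogeneous_part_single_mult intro: rmod.span_scale rmod.span_zero)
        ultimately show "homogeneous_part d (c * p) \<in> rmod.span A"
          by (simp add: homogeneous_part_sum rmod.span_sum)
      qed
    qed (auto simp: homogeneous_part_add rmod.span_zero intro: rmod.span_add)
  qed
  thus ?thesis
    using p by blast
qed

lemma sum_homogeneous_parts: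
  assumes "finite D" "monom_degree ` Poly_Mapping.keys p \<subseteq> D"
  shows "(\<Sum>d\<in>D. homogeneous_part d p) = p"
proof (rule poly_mapping_eqI)
  fix m
  have "Poly_Mapping.lookup (\<Sum>d\<in>D. homogeneous_part d p) m =
      (\<Sum>d\<in>D. if monom_degree m = d then Poly_Mapping.lookup p m else 0)"
    by (simp add: lookup_sum lookup_homogeneous_part)
  also have "\<dots> = (if monom_degree m \<in> D then Poly_Mapping.lookup p m else 0)"
    using assms(1) by simp
  also have "\<dots> = Poly_Mapping.lookup p m"
    using subsetD[OF assms(2) imageI[of m "Poly_Mapping.keys p" monom_degree]]
    by (auto simp: in_keys_iff)
  finally show "Poly_Mapping.lookup (\<Sum>d\<in>D. homogeneous_part d p) m = Poly_Mapping.lookup p m" .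
qed

lemma homogeneous_part_mem:
  assumes "p \<in> carrier (mpoly_ring V)"
  shows "homogeneous_part d p \<in> mpoly_homogeneous V d"
  using assms by (auto simp: mpoly_homogeneous_def in_keys_iff lookup_homogeneous_part split: if_splits)

lemma homogeneous_part_homogeneous:
  assumes "p \<in> mpoly_homogeneous V e"
  shows "homogeneous_part d p = (if d = e then p else 0)"
proof (rule poly_mapping_eqI)
  fix m
  show "Poly_Mapping.lookup (homogeneous_part d p) m = Poly_Mapping.lookup (if d = e then p else 0) m"
  proof (cases "m \<in> Poly_Mapping.keys p")
    case True
    hence "monom_degree m = e"
      using assms by (simp add: mpoly_homogeneous_def)
    thus ?thesis
      by (simp add: lookup_homogeneous_part)
  next
    case False
    hence "Poly_Mapping.lookup p m = 0"
      by (simp add: in_keys_iff)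
    thus ?thesis
      by (simp add: lookup_homogeneous_part)
  qed
qed

lemma homogeneous_part_0_const: "homogeneous_part 0 p = Poly_Mapping.single 0 (Poly_Mapping.lookup p 0)"
  by (rule poly_mapping_eqI)
    (auto simp: lookup_homogeneous_part monom_degree_eq_0 lookup_single when_def)

text \<open>Degrees of monomials add and are nonnegative, so the empty monomial is a product of
  empty monomials only.\<close>

lemma lookup_mult_0:
  assumes "Poly_Mapping.lookup p 0 = (0 :: 'k::comm_ring_1)"
  shows "Poly_Mapping.lookup (c * p :: ('v \<Rightarrow>\<^sub>0 nat) \<Rightarrow>\<^sub>0 'k) 0 = 0"
proof (rule ccontr)
  assume "Poly_Mapping.lookup (c * p) 0 \<noteq> 0"
  hence "0 \<in> Poly_Mapping.keys (c * p)"
    by (simp add: in_keys_iff)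
  then obtain a b where ab: "0 = a + b" "b \<in> Poly_Mapping.keys p"
    using keys_mult by blast
  have "monom_degree a + monom_degree b = 0"
    using arg_cong[OF ab(1), of monom_degree] by (simp add: monom_degree_add)
  hence "b = 0"
    using monom_degree_eq_0 by auto
  thus False
    using ab(2) assms by (simp add: in_keys_iff)
qed

declare mpoly_ring_simps(1) [simp del]

lemma mpoly_var_homogeneous: "F \<in> V \<Longrightarrow> mpoly_var F \<in> mpoly_homogeneous V 1"
  using mpoly_carrier_var[of F V] by (simp add: mpoly_homogeneous_def mpoly_var_def)

lemma mem_homogeneous_carrier: "p \<in> mpoly_homogeneous V d \<Longrightarrow> p \<in> carrier (mpoly_ring V)"
  by (simp add: mpoly_homogeneous_def)

lemma homogeneous_0:
  assumes "p \<in> mpoly_homogeneous V 0"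
  obtains c where "p = Poly_Mapping.single 0 c"
proof -
  have "p = Poly_Mapping.single 0 (Poly_Mapping.lookup p 0)"
    using homogeneous_part_homogeneous[OF assms, of 0] homogeneous_part_0_const[of p] by simp
  thus ?thesis
    by (rule that)
qed

lemma const_homogeneous: "Poly_Mapping.single 0 c \<in> mpoly_homogeneous V 0"
  by (simp add: mpoly_homogeneous_def mpoly_ring_simps(1))

lemma mpoly_homogeneous_add:
  assumes "p \<in> mpoly_homogeneous V d" "q \<in> mpoly_homogeneous V d"
  shows "p + q \<in> mpoly_homogeneous V d"
  unfolding mpoly_homogeneous_def
proof (intro CollectI conjI ballI)
  show "p + q \<in> carrier (mpoly_ring V)"
    using assms by (intro mpoly_carrier_add) (simp_all add: mpoly_homogeneous_def)
  show "monom_degree m = d" if "m \<in> Poly_Mapping.keys (p + q)" for m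
    using subsetD[OF keys_add that] assms by (auto simp: mpoly_homogeneous_def)
qed

lemma mpoly_homogeneous_mult:
  assumes "p \<in> mpoly_homogeneous V d" "q \<in> mpoly_homogeneous V e"
  shows "p * q \<in> mpoly_homogeneous V (d + e)"
proof -
  have "monom_degree m = d + e" if m: "m \<in> Poly_Mapping.keys (p * q)" for m
  proof -
    obtain a b where "m = a + b" "a \<in> Poly_Mapping.keys p" "b \<in> Poly_Mapping.keys q"
      using subsetD[OF keys_mult m] by blast
    thus ?thesis
      using assms by (simp add: mpoly_homogeneous_def monom_degree_add)
  qed
  moreover have "p * q \<in> carrier (mpoly_ring V)"
    using assms by (intro mpoly_carrier_mult) (simp_all add: mpoly_homogeneous_def)
  ultimately show ?thesis
    unfolding mpoly_homogeneous_def by blast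
qed

section \<open>The Chow ring\<close>

context simple_matroid
begin

abbreviation poly_carrier :: "'a chow_poly set" where
  "poly_carrier \<equiv> carrier (mpoly_ring nonempty_flats)"

lemma finite_nonempty_flats: "finite nonempty_flats"
  using flats.finite_flats nonempty_flats_eq by (metis finite_Diff)

lemma flat_var_eq: "F \<in> nonempty_flats \<Longrightarrow> flat_var F = mpoly_var F"
  by (auto simp: flat_var_def nonempty_flats_def)

lemma flat_var_carrier: "F \<in> nonempty_flats \<Longrightarrow> flat_var F \<in> poly_carrier"
  by (simp only: flat_var_eq mpoly_carrier_var)

lemma chow_generators_carrier: "chow_generators \<subseteq> poly_carrier"
proof -
  have "(\<Sum>F\<in>{F \<in> nonempty_flats. i \<in> F}. mpoly_var F) \<in> poly_carrier" for i
    by (intro mpoly_carrier_sum mpoly_carrier_var) auto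
  moreover have "mpoly_var F * mpoly_var G \<in> poly_carrier"
    if "F \<in> nonempty_flats" "G \<in> nonempty_flats" for F G
    using that by (intro mpoly_carrier_mult mpoly_carrier_var)
  ultimately show ?thesis
    unfolding chow_generators_def by blast
qed

lemma cring_poly: "cring chow_poly_ring"
  unfolding chow_poly_ring_def by (rule cring_mpoly_ring)

text \<open>Rewriting the sum of the two ideals as one ideal with joint generators makes
  \<open>genideal_iff_span\<close> applicable; later membership questions then move to the ring with
  all variables, where \<open>chow.J\<close> lives.\<close>

lemma ideal_chow_ideal: "ideal chow_ideal chow_poly_ring"
  and chow_ideal_genideal: "chow_ideal = genideal chow_poly_ring chow_generators"
proof -
  interpret cring chow_poly_ring
    by (rule cring_poly)
  let ?A = "{(\<Sum>F\<in>{F \<in> nonempty_flats. i \<in> F}. mpoly_var F) | i. i \<in> E} :: 'a chow_poly set"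
  let ?B = "{mpoly_var F * mpoly_var G | F G. F \<in> nonempty_flats \<and> G \<in> nonempty_flats \<and>
    \<not> F \<subseteq> G \<and> \<not> G \<subseteq> F} :: 'a chow_poly set"
  have AB: "?A \<subseteq> carrier chow_poly_ring" "?B \<subseteq> carrier chow_poly_ring"
    "chow_generators \<subseteq> carrier chow_poly_ring" "chow_generators = ?A \<union> ?B"
    using chow_generators_carrier unfolding chow_generators_def chow_poly_ring_def by blast+
  interpret A: ideal "Idl\<^bsub>chow_poly_ring\<^esub> ?A" chow_poly_ring
    by (rule genideal_ideal[OF AB(1)])
  interpret B: ideal "Idl\<^bsub>chow_poly_ring\<^esub> ?B" chow_poly_ring
    by (rule genideal_ideal[OF AB(2)])
  interpret AB: ideal "Idl\<^bsub>chow_poly_ring\<^esub> chow_generators" chow_poly_ring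
    by (rule genideal_ideal[OF AB(3)])
  have eq: "chow_ideal = Idl\<^bsub>chow_poly_ring\<^esub> ?A <+>\<^bsub>chow_poly_ring\<^esub> Idl\<^bsub>chow_poly_ring\<^esub> ?B"
    unfolding chow_ideal_def chow_linear_ideal_def chow_quadratic_ideal_def ..
  show I: "ideal chow_ideal chow_poly_ring"
    unfolding eq by (rule add_ideals[OF A.ideal_axioms B.ideal_axioms])
  show "chow_ideal = Idl\<^bsub>chow_poly_ring\<^esub> chow_generators"
  proof
    have "Idl\<^bsub>chow_poly_ring\<^esub> ?A \<subseteq> Idl\<^bsub>chow_poly_ring\<^esub> chow_generators" "Idl\<^bsub>chow_poly_ring\<^esub> ?B \<subseteq> Idl\<^bsub>chow_poly_ring\<^esub> chow_generators"
      using genideal_self[OF AB(3)] AB(4) by (intro genideal_minimal AB.ideal_axioms; blast)+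
    thus "chow_ideal \<subseteq> Idl\<^bsub>chow_poly_ring\<^esub> chow_generators"
      unfolding eq set_add_def' using AB.a_closed by blast
    have "?A \<subseteq> chow_ideal"
    proof
      fix a assume a: "a \<in> ?A"
      hence "a \<in> carrier chow_poly_ring"
        using AB(1) by (rule subsetD[rotated])
      hence "a = a \<oplus>\<^bsub>chow_poly_ring\<^esub> \<zero>\<^bsub>chow_poly_ring\<^esub>"
        by (rule r_zero[symmetric])
      moreover have "a \<in> Idl\<^bsub>chow_poly_ring\<^esub> ?A"
        using genideal_self[OF AB(1)] a by blast
      ultimately show "a \<in> chow_ideal"
        unfolding eq set_add_def' using B.zero_closed by blast
    qed
    moreover have "?B \<subseteq> chow_ideal"
    proof
      fix b assume b: "b \<in> ?B"
      hence "b \<in> carrier chow_poly_ring"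
        using AB(2) by (rule subsetD[rotated])
      hence "b = \<zero>\<^bsub>chow_poly_ring\<^esub> \<oplus>\<^bsub>chow_poly_ring\<^esub> b"
        by (rule l_zero[symmetric])
      moreover have "b \<in> Idl\<^bsub>chow_poly_ring\<^esub> ?B"
        using genideal_self[OF AB(2)] b by blast
      ultimately show "b \<in> chow_ideal"
        unfolding eq set_add_def' using A.zero_closed by blast
    qed
    ultimately have "chow_generators \<subseteq> chow_ideal"
      unfolding AB(4) by (rule Un_least)
    thus "Idl\<^bsub>chow_poly_ring\<^esub> chow_generators \<subseteq> chow_ideal"
      by (rule genideal_minimal[OF I])
  qed
qed

lemma chow_ideal_iff: "p \<in> poly_carrier \<Longrightarrow> p \<in> chow_ideal \<longleftrightarrow> p \<in> full_chow_ideal"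
  unfolding chow_ideal_genideal full_chow_ideal_def chow_poly_ring_def
  by (rule genideal_iff_span[OF chow_generators_carrier])

section \<open>The quotient map\<close>

definition proj :: "'a chow_poly \<Rightarrow> 'a chow_poly set" where
  "proj p = chow_ideal +>\<^bsub>chow_poly_ring\<^esub> p"

lemma cring_chow_ring: "cring chow_ring"
  unfolding chow_ring_def by (rule ideal.quotient_is_cring[OF ideal_chow_ideal cring_poly])

lemma proj_hom: "proj \<in> ring_hom chow_poly_ring chow_ring"
proof -
  have "proj = (+>\<^bsub>chow_poly_ring\<^esub>) chow_ideal"
    by (simp add: fun_eq_iff proj_def)
  thus ?thesis
    unfolding chow_ring_def using ideal.rcos_ring_hom[OF ideal_chow_ideal] by simp
qed

lemma proj_closed: "p \<in> poly_carrier \<Longrightarrow> proj p \<in> carrier chow_ring"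
  and proj_mult: "p \<in> poly_carrier \<Longrightarrow> q \<in> poly_carrier \<Longrightarrow> proj p \<otimes>\<^bsub>chow_ring\<^esub> proj q = proj (p * q)"
  and proj_add: "p \<in> poly_carrier \<Longrightarrow> q \<in> poly_carrier \<Longrightarrow> proj p \<oplus>\<^bsub>chow_ring\<^esub> proj q = proj (p + q)"
  and proj_one: "\<one>\<^bsub>chow_ring\<^esub> = proj 1"
  using ring_hom_closed[OF proj_hom] ring_hom_mult[OF proj_hom] ring_hom_add[OF proj_hom]
    ring_hom_one[OF proj_hom]
  by (simp_all add: chow_poly_ring_def)

lemma proj_var_closed:
  assumes "\<K> \<subseteq> nonempty_flats"
  shows "proj ` mpoly_var ` \<K> \<subseteq> carrier chow_ring"
proof safe
  fix F assume "F \<in> \<K>"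
  hence "F \<in> nonempty_flats"
    using assms by blast
  thus "proj (mpoly_var F) \<in> carrier chow_ring"
    by (intro proj_closed mpoly_carrier_var)
qed

lemma carrier_chow_ring: "carrier chow_ring = proj ` poly_carrier"
  unfolding chow_ring_def FactRing_def A_RCOSETS_def' proj_def
  by (auto simp: chow_poly_ring_def)

lemma poly_carrier_0: "0 \<in> poly_carrier" and poly_carrier_1: "1 \<in> poly_carrier"
  by (simp_all add: mpoly_ring_simps(1))

lemma proj_eq_iff:
  assumes "p \<in> poly_carrier" "q \<in> poly_carrier"
  shows "proj p = proj q \<longleftrightarrow> p - q \<in> full_chow_ideal"
proof -
  interpret cring chow_poly_ring
    by (rule cring_poly)
  have pq: "p \<in> carrier chow_poly_ring" "q \<in> carrier chow_poly_ring"
    using assms by (simp_all add: chow_poly_ring_def)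
  have "proj p = proj q \<longleftrightarrow> p \<ominus>\<^bsub>chow_poly_ring\<^esub> q \<in> chow_ideal"
    unfolding proj_def by (rule quotient_eq_iff_same_a_r_cos[OF ideal_chow_ideal pq, symmetric])
  thus ?thesis
    unfolding chow_poly_ring_def mpoly_ring_minus[OF assms]
    using chow_ideal_iff[OF mpoly_carrier_diff[OF assms]] by simp
qed

lemma proj_zero: "\<zero>\<^bsub>chow_ring\<^esub> = proj 0"
proof -
  interpret cring chow_ring
    by (rule cring_chow_ring)
  have "proj 0 \<oplus>\<^bsub>chow_ring\<^esub> proj 0 = proj 0"
    using proj_add[OF poly_carrier_0 poly_carrier_0] by simp
  thus ?thesis
    using proj_closed[OF poly_carrier_0] add.l_cancel_one by metis
qed

lemma proj_eq_zero_iff: "p \<in> poly_carrier \<Longrightarrow> proj p = \<zero>\<^bsub>chow_ring\<^esub> \<longleftrightarrow> p \<in> full_chow_ideal"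
  using proj_eq_iff[OF _ poly_carrier_0] by (simp add: proj_zero)

lemma proj_uminus: "p \<in> poly_carrier \<Longrightarrow> \<ominus>\<^bsub>chow_ring\<^esub> proj p = proj (- p)"
proof -
  assume p: "p \<in> poly_carrier"
  interpret cring chow_ring
    by (rule cring_chow_ring)
  have "proj (- p) \<oplus>\<^bsub>chow_ring\<^esub> proj p = \<zero>\<^bsub>chow_ring\<^esub>"
    using proj_add[OF mpoly_carrier_uminus[OF p] p] by (simp add: proj_zero)
  thus ?thesis
    using proj_closed[OF p] proj_closed[OF mpoly_carrier_uminus[OF p]] by (rule minus_equality)
qed

lemma proj_minus:
  assumes "p \<in> poly_carrier" "q \<in> poly_carrier"
  shows "proj p \<ominus>\<^bsub>chow_ring\<^esub> proj q = proj (p - q)"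
  unfolding a_minus_def proj_uminus[OF assms(2)]
  using proj_add[OF assms(1) mpoly_carrier_uminus[OF assms(2)]] by simp

lemma proj_sum:
  assumes "finite S" "\<And>s. s \<in> S \<Longrightarrow> f s \<in> poly_carrier"
  shows "(\<Oplus>\<^bsub>chow_ring\<^esub>s\<in>S. proj (f s)) = proj (sum f S)"
proof -
  interpret cring chow_ring
    by (rule cring_chow_ring)
  show ?thesis
    using assms
  proof (induction S rule: finite_induct)
    case empty
    thus ?case
      by (simp add: proj_zero)
  next
    case (insert s S)
    have S: "(\<lambda>s. proj (f s)) \<in> S \<rightarrow> carrier chow_ring"
      using insert.prems proj_closed by blast
    have s: "proj (f s) \<in> carrier chow_ring"
      using insert.prems proj_closed by blast
    have "(\<Oplus>\<^bsub>chow_ring\<^esub>s\<in>insert s S. proj (f s)) = proj (f s) \<oplus>\<^bsub>chow_ring\<^esub> proj (sum f S)"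
      using add.finprod_insert[OF insert.hyps S s] insert.IH insert.prems by simp
    also have "\<dots> = proj (f s + sum f S)"
      using insert.prems by (intro proj_add mpoly_carrier_sum) auto
    finally show ?case
      using insert.hyps by simp
  qed
qed

text \<open>No generator has a constant term, and polynomials without constant term form an ideal.
  In particular nonzero constants survive in the Chow ring.\<close>

lemma irrelevant_lookup_0:
  assumes "p \<in> chow.J nonempty_flats"
  shows "Poly_Mapping.lookup p 0 = 0"
proof -
  let ?Z = "{p :: 'a chow_poly. Poly_Mapping.lookup p 0 = 0}"
  have Z: "rmod.subspace ?Z"
    by (intro rmod.subspaceI) (auto simp: lookup_add lookup_mult_0)
  have var: "mpoly_var F \<in> ?Z" for F
  proof -
    have "Poly_Mapping.single F (1::nat) \<noteq> 0"
      by (metis monom_degree_0 monom_degree_single zero_neq_one)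
    thus ?thesis
      by (simp add: mpoly_var_def lookup_single when_def)
  qed
  have "mpoly_var F * mpoly_var G \<in> ?Z" for F G
    using lookup_mult_0 var by blast
  moreover have "sum mpoly_var S \<in> ?Z" for S :: "'a set set"
    by (rule rmod.subspace_sum[OF Z var])
  ultimately have "full_chow_ideal \<subseteq> ?Z"
    unfolding full_chow_ideal_def chow_generators_def using var
    by (intro rmod.span_minimal Z) blast
  moreover have "flat_var ` nonempty_flats \<subseteq> ?Z"
    using flat_var_eq var by auto
  ultimately show ?thesis
    using chow.J_minimal[OF Z] assms by blast
qed

lemma full_chow_ideal_lookup_0: "p \<in> full_chow_ideal \<Longrightarrow> Poly_Mapping.lookup p 0 = 0"
  using irrelevant_lookup_0 chow.N_subset_J by blast

lemma irrelevantI: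
  assumes "Poly_Mapping.lookup p 0 = 0"
  shows "p \<in> chow.J nonempty_flats"
proof -
  have var: "mpoly_var F \<in> chow.J nonempty_flats" for F
  proof (cases "F \<in> nonempty_flats")
    case True
    thus ?thesis
      using chow.x_in_J[OF True] flat_var_eq by metis
  next
    case False
    hence "mpoly_var F \<in> full_chow_ideal"
      unfolding full_chow_ideal_def by (intro rmod.span_base) blast
    thus ?thesis
      using chow.N_subset_J by blast
  qed
  have "(\<Sum>k\<in>Poly_Mapping.keys p. Poly_Mapping.single k (Poly_Mapping.lookup p k)) \<in> chow.J nonempty_flats"
  proof (rule rmod.subspace_sum[OF chow.subspace_J])
    fix k assume "k \<in> Poly_Mapping.keys p"
    hence "k \<noteq> 0"
      using assms by (auto simp: in_keys_iff)
    then obtain v where v: "v \<in> Poly_Mapping.keys k"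
      using keys_eq_empty by blast
    have "Poly_Mapping.single k (Poly_Mapping.lookup p k) =
        Poly_Mapping.single (k - Poly_Mapping.single v 1) (Poly_Mapping.lookup p k) * mpoly_var v"
      using split_variable[OF v] single_times_mpoly_var by metis
    thus "Poly_Mapping.single k (Poly_Mapping.lookup p k) \<in> chow.J nonempty_flats"
      using chow.J_closed(3)[OF var] by metis
  qed
  thus ?thesis
    using poly_mapping_sum_singles[of p] by metis
qed

text \<open>All generators are homogeneous: the linear forms and the outside variables of degree
  one, the products of degree two.\<close>

lemma homogeneous_part_full_chow_ideal:
  assumes "p \<in> full_chow_ideal"
  shows "homogeneous_part d p \<in> full_chow_ideal"
proof -
  let ?v = "mpoly_var :: 'a set \<Rightarrow> 'a chow_poly"
  have var: "homogeneous_part d (?v F) = (if d = 1 then ?v F else 0)" for d F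
    by (rule homogeneous_part_homogeneous[OF mpoly_var_homogeneous[OF UNIV_I]])
  have sum: "homogeneous_part d (sum ?v S) = (if d = 1 then sum ?v S else 0)" for d S
    unfolding homogeneous_part_sum var by simp
  have prod: "homogeneous_part d (?v F * ?v G) = (if d = 2 then ?v F * ?v G else 0)" for d F G
    unfolding mpoly_var_def mult_single homogeneous_part_single monom_degree_add by simp
  have "\<exists>e. \<forall>d. homogeneous_part d a = (if d = e then a else 0)"
    if "a \<in> chow_generators \<union> mpoly_var ` (- nonempty_flats)" for a
  proof -
    consider F where "a = ?v F" | S where "a = sum ?v S" | F G where "a = ?v F * ?v G"
      using \<open>a \<in> _\<close> unfolding chow_generators_def by blast
    thus ?thesis
      using var sum prod by cases metis+
  qed
  thus ?thesis
    using assms unfolding full_chow_ideal_def by (rule homogeneous_parts_in_span)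
qed

section \<open>The Chow ring as a standard graded algebra\<close>

lemma chow_grading_eq: "chow_grading d = proj ` mpoly_homogeneous nonempty_flats d"
  unfolding chow_grading_def proj_def ..

lemma proj_var_grading:
  assumes "\<K> \<subseteq> nonempty_flats"
  shows "proj ` mpoly_var ` \<K> \<subseteq> chow_grading 1"
proof safe
  fix F assume "F \<in> \<K>"
  hence "mpoly_var F \<in> mpoly_homogeneous nonempty_flats 1"
    using assms by (intro mpoly_var_homogeneous) blast
  thus "proj (mpoly_var F) \<in> chow_grading 1"
    unfolding chow_grading_eq by (rule imageI)
qed

lemma chow_grading_carrier: "chow_grading d \<subseteq> carrier chow_ring"
  unfolding chow_grading_eq using proj_closed mem_homogeneous_carrier by blast

lemma proj_const_eq_zero: "proj (Poly_Mapping.single 0 c) = \<zero>\<^bsub>chow_ring\<^esub> \<longleftrightarrow> c = 0"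
proof -
  have "Poly_Mapping.single 0 c \<in> poly_carrier"
    by (rule mpoly_carrier_single) simp
  hence "proj (Poly_Mapping.single 0 c) = \<zero>\<^bsub>chow_ring\<^esub> \<longleftrightarrow> Poly_Mapping.single 0 c \<in> full_chow_ideal"
    by (rule proj_eq_zero_iff)
  moreover have "Poly_Mapping.single 0 c \<in> full_chow_ideal \<Longrightarrow> c = 0"
    using full_chow_ideal_lookup_0 by fastforce
  moreover have "0 \<in> full_chow_ideal"
    using chow.N_closed(1) .
  ultimately show ?thesis
    by auto
qed

lemma additive_subgroup_chow_grading: "additive_subgroup (chow_grading d) chow_ring"
proof (rule additive_subgroupI)
  interpret cring chow_ring
    by (rule cring_chow_ring)
  show "subgroup (chow_grading d) (add_monoid chow_ring)"
  proof (rule add.subgroupI)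
    show "chow_grading d \<subseteq> carrier chow_ring"
      by (rule chow_grading_carrier)
    have "0 \<in> mpoly_homogeneous nonempty_flats d"
      using mpoly_carrier_single[of 0 nonempty_flats 0] by (simp add: mpoly_homogeneous_def)
    thus "chow_grading d \<noteq> {}"
      unfolding chow_grading_eq by blast
    fix x assume "x \<in> chow_grading d"
    then obtain p where p: "x = proj p" "p \<in> mpoly_homogeneous nonempty_flats d"
      unfolding chow_grading_eq by blast
    have "- p \<in> mpoly_homogeneous nonempty_flats d"
      using p(2) mpoly_carrier_uminus[of p] by (simp add: mpoly_homogeneous_def)
    thus "\<ominus>\<^bsub>chow_ring\<^esub> x \<in> chow_grading d"
      unfolding p(1) proj_uminus[OF mem_homogeneous_carrier[OF p(2)]] chow_grading_eq by blast
    fix y assume "y \<in> chow_grading d"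
    then obtain q where q: "y = proj q" "q \<in> mpoly_homogeneous nonempty_flats d"
      unfolding chow_grading_eq by blast
    show "x \<oplus>\<^bsub>chow_ring\<^esub> y \<in> chow_grading d"
      unfolding p(1) q(1) proj_add[OF mem_homogeneous_carrier[OF p(2)] mem_homogeneous_carrier[OF q(2)]]
        chow_grading_eq
      using mpoly_homogeneous_add[OF p(2) q(2)] by blast
  qed
qed

lemma chow_grading_mult:
  assumes "x \<in> chow_grading i" "y \<in> chow_grading j"
  shows "x \<otimes>\<^bsub>chow_ring\<^esub> y \<in> chow_grading (i + j)"
proof -
  obtain p q where pq: "x = proj p" "p \<in> mpoly_homogeneous nonempty_flats i"
    "y = proj q" "q \<in> mpoly_homogeneous nonempty_flats j"
    using assms unfolding chow_grading_eq by blast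
  show ?thesis
    unfolding pq(1,3) proj_mult[OF mem_homogeneous_carrier[OF pq(2)] mem_homogeneous_carrier[OF pq(4)]]
      chow_grading_eq
    using mpoly_homogeneous_mult[OF pq(2,4)] by blast
qed

lemma subfield_chow_grading_0: "subfield (chow_grading 0) chow_ring"
proof -
  interpret cring chow_ring
    by (rule cring_chow_ring)
  have K: "chow_grading 0 = range (\<lambda>c. proj (Poly_Mapping.single 0 c))"
  proof
    show "chow_grading 0 \<subseteq> range (\<lambda>c. proj (Poly_Mapping.single 0 c))"
    proof
      fix x assume "x \<in> chow_grading 0"
      then obtain p where p: "x = proj p" "p \<in> mpoly_homogeneous nonempty_flats 0"
        unfolding chow_grading_eq by blast
      from p(2) obtain c where "p = Poly_Mapping.single 0 c"
        by (rule homogeneous_0)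
      thus "x \<in> range (\<lambda>c. proj (Poly_Mapping.single 0 c))"
        using p(1) by blast
    qed
    show "range (\<lambda>c. proj (Poly_Mapping.single 0 c)) \<subseteq> chow_grading 0"
      unfolding chow_grading_eq using const_homogeneous by blast
  qed
  have const: "Poly_Mapping.single 0 c \<in> poly_carrier" for c
    by (rule mpoly_carrier_single) simp
  have mult: "proj (Poly_Mapping.single 0 c) \<otimes>\<^bsub>chow_ring\<^esub> proj (Poly_Mapping.single 0 d) =
      proj (Poly_Mapping.single 0 (c * d))" for c d
    using proj_mult[OF const const] by (simp add: mult_single)
  have one: "\<one>\<^bsub>chow_ring\<^esub> = proj (Poly_Mapping.single 0 1)"
    by (simp add: proj_one)
  interpret A: additive_subgroup "chow_grading 0" chow_ring
    by (rule additive_subgroup_chow_grading)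
  have "subring (chow_grading 0) chow_ring"
  proof (rule subringI)
    show "chow_grading 0 \<subseteq> carrier chow_ring"
      by (rule chow_grading_carrier)
    show "\<one>\<^bsub>chow_ring\<^esub> \<in> chow_grading 0"
      unfolding one K by blast
    show "\<ominus>\<^bsub>chow_ring\<^esub> h \<in> chow_grading 0" if "h \<in> chow_grading 0" for h
      using that by (rule A.a_inv_closed)
    show "g \<otimes>\<^bsub>chow_ring\<^esub> h \<in> chow_grading 0" if "g \<in> chow_grading 0" "h \<in> chow_grading 0" for g h
      using chow_grading_mult[OF that] by simp
    show "g \<oplus>\<^bsub>chow_ring\<^esub> h \<in> chow_grading 0" if "g \<in> chow_grading 0" "h \<in> chow_grading 0" for g h
      using that by (rule A.a_closed)
  qed
  hence "subcring (chow_grading 0) chow_ring"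
    by (rule subcringI) (use m_comm chow_grading_carrier in blast)
  thus ?thesis
  proof (rule subfieldI)
    show "Units (chow_ring \<lparr>carrier := chow_grading 0\<rparr>) = chow_grading 0 - {\<zero>\<^bsub>chow_ring\<^esub>}"
    proof
      show "Units (chow_ring \<lparr>carrier := chow_grading 0\<rparr>) \<subseteq> chow_grading 0 - {\<zero>\<^bsub>chow_ring\<^esub>}"
      proof
        fix y assume "y \<in> Units (chow_ring \<lparr>carrier := chow_grading 0\<rparr>)"
        then obtain x where xy: "y \<in> chow_grading 0" "x \<in> chow_grading 0"
          "x \<otimes>\<^bsub>chow_ring\<^esub> y = \<one>\<^bsub>chow_ring\<^esub>"
          by (auto simp: Units_def)
        have "y \<noteq> \<zero>\<^bsub>chow_ring\<^esub>"
        proof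
          assume "y = \<zero>\<^bsub>chow_ring\<^esub>"
          moreover have "x \<in> carrier chow_ring"
            using xy(2) chow_grading_carrier by blast
          ultimately have "\<one>\<^bsub>chow_ring\<^esub> = \<zero>\<^bsub>chow_ring\<^esub>"
            using xy(3) r_null by simp
          thus False
            using proj_const_eq_zero[of 1] one by simp
        qed
        thus "y \<in> chow_grading 0 - {\<zero>\<^bsub>chow_ring\<^esub>}"
          using xy by blast
      qed
      show "chow_grading 0 - {\<zero>\<^bsub>chow_ring\<^esub>} \<subseteq> Units (chow_ring \<lparr>carrier := chow_grading 0\<rparr>)"
      proof
        fix y assume y: "y \<in> chow_grading 0 - {\<zero>\<^bsub>chow_ring\<^esub>}"
        then obtain c where c: "y = proj (Poly_Mapping.single 0 c)" "c \<noteq> 0"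
          unfolding K using proj_const_eq_zero by blast
        let ?x = "proj (Poly_Mapping.single 0 (1 / c))"
        have "?x \<in> chow_grading 0" "?x \<otimes>\<^bsub>chow_ring\<^esub> y = \<one>\<^bsub>chow_ring\<^esub>"
          "y \<otimes>\<^bsub>chow_ring\<^esub> ?x = \<one>\<^bsub>chow_ring\<^esub>"
          using c unfolding K one by (auto simp: mult)
        thus "y \<in> Units (chow_ring \<lparr>carrier := chow_grading 0\<rparr>)"
          using y by (auto simp: Units_def)
      qed
    qed
  qed
qed

lemma proj_decomposition:
  assumes p: "p \<in> poly_carrier"
  shows "homogeneous_decomposition chow_ring chow_grading (proj p) (\<lambda>d. proj (homogeneous_part d p))"
  unfolding homogeneous_decomposition_def
proof (intro conjI allI)
  have part: "homogeneous_part d p \<in> mpoly_homogeneous nonempty_flats d" for d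
    using p by (rule homogeneous_part_mem)
  hence carrier: "homogeneous_part d p \<in> poly_carrier" for d
    using mem_homogeneous_carrier by blast
  show "proj (homogeneous_part d p) \<in> chow_grading d" for d
    unfolding chow_grading_eq using part by blast
  let ?D = "monom_degree ` Poly_Mapping.keys p"
  let ?S = "{d. proj (homogeneous_part d p) \<noteq> \<zero>\<^bsub>chow_ring\<^esub>}"
  have S: "?S \<subseteq> ?D"
  proof
    fix d assume "d \<in> ?S"
    hence "homogeneous_part d p \<noteq> 0"
      by (auto simp: proj_zero)
    moreover have "homogeneous_part d p = 0" if e: "{m \<in> Poly_Mapping.keys p. monom_degree m = d} = {}"
      unfolding homogeneous_part_def e by simp
    ultimately have "{m \<in> Poly_Mapping.keys p. monom_degree m = d} \<noteq> {}"
      by blast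
    thus "d \<in> ?D"
      by blast
  qed
  thus fin: "finite ?S"
    by (rule finite_subset) simp
  have "(\<Oplus>\<^bsub>chow_ring\<^esub>d\<in>?S. proj (homogeneous_part d p)) = proj (\<Sum>d\<in>?S. homogeneous_part d p)"
    by (rule proj_sum[OF fin carrier])
  also have "\<dots> = proj p"
  proof -
    have "p = (\<Sum>d\<in>?D. homogeneous_part d p)"
      by (rule sum_homogeneous_parts[symmetric]) auto
    also have "\<dots> = (\<Sum>d\<in>?D - ?S. homogeneous_part d p) + (\<Sum>d\<in>?S. homogeneous_part d p)"
      using S by (intro sum.subset_diff) auto
    finally have "(\<Sum>d\<in>?S. homogeneous_part d p) - p = - (\<Sum>d\<in>?D - ?S. homogeneous_part d p)"
      by (simp add: algebra_simps)
    also have "\<dots> \<in> full_chow_ideal"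
      using proj_eq_zero_iff[OF carrier]
      by (intro chow.N_closed(6) rmod.subspace_sum[OF chow.subspace_N]) auto
    finally show ?thesis
      by (simp only: proj_eq_iff[OF mpoly_carrier_sum[OF carrier] p])
  qed
  finally show "proj p = (\<Oplus>\<^bsub>chow_ring\<^esub>d\<in>?S. proj (homogeneous_part d p))" ..
qed

text \<open>Lift the components to homogeneous polynomials. The difference of \<open>p\<close> and
  their sum lies in a homogeneous ideal, so the comparison can be made degree by degree.\<close>

lemma decomposition_unique:
  assumes p: "p \<in> poly_carrier" and f: "homogeneous_decomposition chow_ring chow_grading (proj p) f"
  shows "f d = proj (homogeneous_part d p)"
proof -
  let ?S = "{i. f i \<noteq> \<zero>\<^bsub>chow_ring\<^esub>}"
  have fin: "finite ?S" and "\<forall>i. f i \<in> proj ` mpoly_homogeneous nonempty_flats i"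
    and sum: "proj p = (\<Oplus>\<^bsub>chow_ring\<^esub>i\<in>?S. f i)"
    using f unfolding homogeneous_decomposition_def chow_grading_eq by auto
  hence "\<forall>i. \<exists>h. h \<in> mpoly_homogeneous nonempty_flats i \<and> f i = proj h"
    by blast
  from choice[OF this] obtain h where
    h: "\<forall>i. h i \<in> mpoly_homogeneous nonempty_flats i \<and> f i = proj (h i)"
    by blast
  hence hc: "h i \<in> poly_carrier" for i
    using mem_homogeneous_carrier by blast
  have f_eq: "f = (\<lambda>i. proj (h i))"
    using h by auto
  have "proj p = proj (sum h ?S)"
    unfolding sum by (subst f_eq) (rule proj_sum[OF fin hc])
  hence "p - sum h ?S \<in> full_chow_ideal"
    by (simp only: proj_eq_iff[OF p mpoly_carrier_sum[OF hc]])
  hence "homogeneous_part d (p - sum h ?S) \<in> full_chow_ideal"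
    by (rule homogeneous_part_full_chow_ideal)
  also have "homogeneous_part d (p - sum h ?S) = homogeneous_part d p - (if d \<in> ?S then h d else 0)"
  proof -
    have "homogeneous_part d (sum h ?S) = (\<Sum>i\<in>?S. if d = i then h i else 0)"
      unfolding homogeneous_part_sum
      by (intro sum.cong refl homogeneous_part_homogeneous) (use h in blast)
    thus ?thesis
      using fin by (simp add: homogeneous_part_diff)
  qed
  finally have mem: "homogeneous_part d p - (if d \<in> ?S then h d else 0) \<in> full_chow_ideal" .
  have "homogeneous_part d p \<in> poly_carrier"
    using homogeneous_part_mem[OF p] mem_homogeneous_carrier by blast
  moreover have "(if d \<in> ?S then h d else 0) \<in> poly_carrier"
    using hc poly_carrier_0 by simp
  ultimately have "proj (homogeneous_part d p) = proj (if d \<in> ?S then h d else 0)"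
    using mem proj_eq_iff by blast
  also have "\<dots> = f d"
    using h by (auto simp: proj_zero)
  finally show ?thesis ..
qed

lemma chow_ring_generated:
  "carrier chow_ring = generate_ring chow_ring (chow_grading 0 \<union> proj ` mpoly_var ` nonempty_flats)"
    (is "_ = generate_ring _ ?X")
proof
  interpret cring chow_ring
    by (rule cring_chow_ring)
  have "?X \<subseteq> carrier chow_ring"
    by (rule Un_least[OF chow_grading_carrier proj_var_closed[OF subset_refl]])
  thus "generate_ring chow_ring ?X \<subseteq> carrier chow_ring"
    by (rule generate_ring_incl)
  have single: "Poly_Mapping.keys m \<subseteq> nonempty_flats \<Longrightarrow>
      proj (Poly_Mapping.single m c) \<in> generate_ring chow_ring ?X" for m c
  proof (induction "monom_degree m" arbitrary: m rule: less_induct)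
    case less
    show ?case
    proof (cases "m = 0")
      case True
      hence "proj (Poly_Mapping.single m c) \<in> chow_grading 0"
        unfolding chow_grading_eq using const_homogeneous by blast
      thus ?thesis
        by (intro generate_ring.incl) blast
    next
      case False
      then obtain v where v: "v \<in> Poly_Mapping.keys m"
        using keys_eq_empty by blast
      let ?m = "m - Poly_Mapping.single v 1"
      have m: "m = Poly_Mapping.single v 1 + ?m"
        by (rule split_variable[OF v])
      have "monom_degree m = 1 + monom_degree ?m"
        by (subst m) (simp only: monom_degree_add monom_degree_single)
      moreover have keys: "Poly_Mapping.keys ?m \<subseteq> nonempty_flats"
      proof -
        have "Poly_Mapping.keys m = Poly_Mapping.keys (Poly_Mapping.single v (1::nat)) \<union> Poly_Mapping.keys ?m"
          by (subst m) (rule keys_add_nat)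
        thus ?thesis
          using less.prems by blast
      qed
      ultimately have IH: "proj (Poly_Mapping.single ?m c) \<in> generate_ring chow_ring ?X"
        by (intro less.hyps) auto
      have vV: "v \<in> nonempty_flats"
        using v less.prems by blast
      have "Poly_Mapping.single m c = Poly_Mapping.single ?m c * mpoly_var v"
        using m single_times_mpoly_var by metis
      hence "proj (Poly_Mapping.single m c) = proj (Poly_Mapping.single ?m c) \<otimes>\<^bsub>chow_ring\<^esub> proj (mpoly_var v)"
        using proj_mult[OF mpoly_carrier_single[OF keys] mpoly_carrier_var[OF vV]] by simp
      thus ?thesis
        using generate_ring.eng_mult[OF IH generate_ring.incl] vV by simp
    qed
  qed
  show "carrier chow_ring \<subseteq> generate_ring chow_ring ?X"
  proof
    fix x assume "x \<in> carrier chow_ring"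
    then obtain p where p: "x = proj p" "p \<in> poly_carrier"
      unfolding carrier_chow_ring by blast
    let ?f = "\<lambda>k. Poly_Mapping.single k (Poly_Mapping.lookup p k)"
    have keys: "Poly_Mapping.keys k \<subseteq> nonempty_flats" if "k \<in> Poly_Mapping.keys p" for k
      using p(2) that by (simp add: mpoly_ring_simps(1))
    have "finite A \<Longrightarrow> A \<subseteq> Poly_Mapping.keys p \<Longrightarrow> proj (sum ?f A) \<in> generate_ring chow_ring ?X" for A
    proof (induction A rule: finite_induct)
      case empty
      thus ?case
        using zero_in_generate by (simp add: proj_zero)
    next
      case (insert k A)
      have "proj (sum ?f (insert k A)) = proj (?f k) \<oplus>\<^bsub>chow_ring\<^esub> proj (sum ?f A)"
      proof -
        have "?f k \<in> poly_carrier" "sum ?f A \<in> poly_carrier"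
          using insert.prems keys by (intro mpoly_carrier_single mpoly_carrier_sum; blast)+
        from proj_add[OF this] show ?thesis
          using insert.hyps by simp
      qed
      moreover have "proj (?f k) \<in> generate_ring chow_ring ?X"
        using insert.prems keys by (intro single) blast
      ultimately show ?case
        using insert.IH insert.prems generate_ring.eng_add by fastforce
    qed
    hence "proj (sum ?f (Poly_Mapping.keys p)) \<in> generate_ring chow_ring ?X"
      by simp
    thus "x \<in> generate_ring chow_ring ?X"
      using p(1) poly_mapping_sum_singles[of p] by metis
  qed
qed

lemma standard_graded_chow_ring: "standard_graded_algebra chow_ring chow_grading"
proof (intro standard_graded_algebra.intro standard_graded_algebra_axioms.intro)
  show "\<exists>!f. homogeneous_decomposition chow_ring chow_grading x f" if "x \<in> carrier chow_ring" for x
  proof -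
    obtain p where p: "x = proj p" "p \<in> poly_carrier"
      using \<open>x \<in> _\<close> unfolding carrier_chow_ring by blast
    show ?thesis
      unfolding p(1)
      using proj_decomposition[OF p(2)] decomposition_unique[OF p(2)] by (intro ex1I) auto
  qed
  show "\<exists>X. finite X \<and> X \<subseteq> chow_grading 1 \<and> carrier chow_ring = generate_ring chow_ring (chow_grading 0 \<union> X)"
    by (intro exI[of _ "proj ` mpoly_var ` nonempty_flats"] conjI finite_imageI finite_nonempty_flats
        proj_var_grading subset_refl chow_ring_generated)
qed (simp_all add: cring_chow_ring subfield_chow_grading_0 additive_subgroup_chow_grading chow_grading_mult)

section \<open>The filtration carried over to the Chow ring\<close>

definition ideal_image :: "'a set set \<Rightarrow> 'a chow_poly set set" where
  "ideal_image \<K> = proj ` (poly_carrier \<inter> chow.J \<K>)"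

lemma mem_ideal_image:
  assumes "p \<in> poly_carrier"
  shows "proj p \<in> ideal_image \<K> \<longleftrightarrow> p \<in> chow.J \<K>"
proof
  assume "proj p \<in> ideal_image \<K>"
  then obtain q where q: "q \<in> poly_carrier" "q \<in> chow.J \<K>" "proj p = proj q"
    unfolding ideal_image_def by blast
  hence "p - q \<in> chow.J \<K>"
    using proj_eq_iff[OF assms q(1)] chow.N_subset_J by blast
  from chow.J_closed(2)[OF this q(2)] show "p \<in> chow.J \<K>"
    by simp
qed (use assms in \<open>auto simp: ideal_image_def\<close>)

lemma ideal_ideal_image: "ideal (ideal_image \<K>) chow_ring"
proof (rule idealI)
  interpret cring chow_ring
    by (rule cring_chow_ring)
  show "ring chow_ring"
    by (rule ring_axioms)
  have mult: "x \<otimes>\<^bsub>chow_ring\<^esub> a \<in> ideal_image \<K>"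
    if xa: "a \<in> ideal_image \<K>" "x \<in> carrier chow_ring" for a x
  proof -
    obtain p q where pq: "x = proj p" "p \<in> poly_carrier" "a = proj q" "q \<in> poly_carrier" "q \<in> chow.J \<K>"
      using xa unfolding ideal_image_def carrier_chow_ring by blast
    show ?thesis
      unfolding pq(1,3) proj_mult[OF pq(2,4)] mem_ideal_image[OF mpoly_carrier_mult[OF pq(2,4)]]
      using pq(5) by (rule chow.J_closed(3))
  qed
  thus "x \<otimes>\<^bsub>chow_ring\<^esub> a \<in> ideal_image \<K>" if "a \<in> ideal_image \<K>" "x \<in> carrier chow_ring" for a x
    using that .
  have sub: "ideal_image \<K> \<subseteq> carrier chow_ring"
    unfolding ideal_image_def carrier_chow_ring by blast
  thus "a \<otimes>\<^bsub>chow_ring\<^esub> x \<in> ideal_image \<K>" if "a \<in> ideal_image \<K>" "x \<in> carrier chow_ring" for a x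
    using mult[OF that] m_comm[of a x] that by auto
  show "subgroup (ideal_image \<K>) (add_monoid chow_ring)"
  proof (rule add.subgroupI[OF sub])
    show "ideal_image \<K> \<noteq> {}"
      using poly_carrier_0 chow.J_closed(1) unfolding ideal_image_def by blast
    fix a assume "a \<in> ideal_image \<K>"
    then obtain p where p: "a = proj p" "p \<in> poly_carrier" "p \<in> chow.J \<K>"
      unfolding ideal_image_def by blast
    show "\<ominus>\<^bsub>chow_ring\<^esub> a \<in> ideal_image \<K>"
      unfolding p(1) proj_uminus[OF p(2)] mem_ideal_image[OF mpoly_carrier_uminus[OF p(2)]]
      using p(3) by (rule chow.J_closed(6))
    fix b assume "b \<in> ideal_image \<K>"
    then obtain q where q: "b = proj q" "q \<in> poly_carrier" "q \<in> chow.J \<K>"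
      unfolding ideal_image_def by blast
    show "a \<oplus>\<^bsub>chow_ring\<^esub> b \<in> ideal_image \<K>"
      unfolding p(1) q(1) proj_add[OF p(2) q(2)] mem_ideal_image[OF mpoly_carrier_add[OF p(2) q(2)]]
      using p(3) q(3) by (rule chow.J_closed(2))
  qed
qed

text \<open>For the inclusion that is not immediate, the preimage of the generated ideal is an ideal
  of the polynomial ring containing the relations and the chosen variables; by
  \<open>genideal_iff_span\<close> it contains every member of \<open>chow.J \<K>\<close> in the
  carrier.\<close>

lemma ideal_image_generated:
  assumes K: "\<K> \<subseteq> nonempty_flats"
  shows "ideal_image \<K> = genideal chow_ring (proj ` mpoly_var ` \<K>)"
proof
  interpret cring chow_ring
    by (rule cring_chow_ring)
  have L: "proj ` mpoly_var ` \<K> \<subseteq> carrier chow_ring"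
    by (rule proj_var_closed[OF K])
  interpret I: ideal "Idl\<^bsub>chow_ring\<^esub> (proj ` mpoly_var ` \<K>)" chow_ring
    by (rule genideal_ideal[OF L])
  have var_J: "mpoly_var F \<in> chow.J \<K>" if "F \<in> \<K>" for F
    using chow.x_in_J[OF that] flat_var_eq[of F] K that by auto
  have "proj ` mpoly_var ` \<K> \<subseteq> ideal_image \<K>"
  proof safe
    fix F assume F: "F \<in> \<K>"
    hence "mpoly_var F \<in> poly_carrier"
      using K by (intro mpoly_carrier_var) blast
    thus "proj (mpoly_var F) \<in> ideal_image \<K>"
      using var_J[OF F] by (simp only: mem_ideal_image)
  qed
  thus "Idl\<^bsub>chow_ring\<^esub> (proj ` mpoly_var ` \<K>) \<subseteq> ideal_image \<K>"
    by (rule genideal_minimal[OF ideal_ideal_image])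
  let ?I = "{p \<in> poly_carrier. proj p \<in> Idl\<^bsub>chow_ring\<^esub> (proj ` mpoly_var ` \<K>)}"
  let ?A = "chow_generators \<union> mpoly_var ` \<K>"
  have A: "?A \<subseteq> poly_carrier"
  proof (rule Un_least[OF chow_generators_carrier], safe)
    fix F assume "F \<in> \<K>"
    thus "mpoly_var F \<in> poly_carrier"
      using K by (intro mpoly_carrier_var) blast
  qed
  have "ideal ?I (mpoly_ring nonempty_flats)"
  proof (rule mpoly_ring_idealI)
    show "0 \<in> ?I"
      using poly_carrier_0 I.zero_closed unfolding proj_zero by blast
    show "p + q \<in> ?I" if pq: "p \<in> ?I" "q \<in> ?I" for p q
    proof -
      have c: "p \<in> poly_carrier" "q \<in> poly_carrier"
        using pq by blast+
      have "proj p \<oplus>\<^bsub>chow_ring\<^esub> proj q \<in> Idl\<^bsub>chow_ring\<^esub> (proj ` mpoly_var ` \<K>)"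
        using pq by (intro I.a_closed) blast+
      thus ?thesis
        unfolding proj_add[OF c] using mpoly_carrier_add[OF c] by blast
    qed
    show "c * p \<in> ?I" if cp: "c \<in> poly_carrier" "p \<in> ?I" for c p
    proof -
      have p: "p \<in> poly_carrier"
        using cp by blast
      have "proj c \<otimes>\<^bsub>chow_ring\<^esub> proj p \<in> Idl\<^bsub>chow_ring\<^esub> (proj ` mpoly_var ` \<K>)"
        using cp by (intro I.I_l_closed proj_closed) blast+
      thus ?thesis
        unfolding proj_mult[OF cp(1) p] using mpoly_carrier_mult[OF cp(1) p] by blast
    qed
  qed blast
  moreover have "?A \<subseteq> ?I"
  proof -
    have "proj a = \<zero>\<^bsub>chow_ring\<^esub>" if a: "a \<in> chow_generators" for a
    proof -
      have "a \<in> full_chow_ideal"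
        unfolding full_chow_ideal_def using a by (intro rmod.span_base) blast
      thus ?thesis
        using proj_eq_zero_iff chow_generators_carrier a by blast
    qed
    hence "proj a \<in> Idl\<^bsub>chow_ring\<^esub> (proj ` mpoly_var ` \<K>)" if "a \<in> ?A" for a
      using that I.zero_closed genideal_self[OF L] by auto
    thus ?thesis
      using A by blast
  qed
  ultimately have min: "genideal (mpoly_ring nonempty_flats) ?A \<subseteq> ?I"
    by (rule ring.genideal_minimal[OF cring.axioms(1)[OF cring_mpoly_ring]])
  show "ideal_image \<K> \<subseteq> Idl\<^bsub>chow_ring\<^esub> (proj ` mpoly_var ` \<K>)"
  proof
    fix a assume "a \<in> ideal_image \<K>"
    then obtain p where p: "a = proj p" "p \<in> poly_carrier" "p \<in> chow.J \<K>"
      unfolding ideal_image_def by blast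
    have "chow.J \<K> \<subseteq> rmod.span (?A \<union> mpoly_var ` (- nonempty_flats))"
    proof (rule chow.J_minimal)
      show "full_chow_ideal \<subseteq> rmod.span (?A \<union> mpoly_var ` (- nonempty_flats))"
        unfolding full_chow_ideal_def by (rule rmod.span_mono) blast
      show "flat_var ` \<K> \<subseteq> rmod.span (?A \<union> mpoly_var ` (- nonempty_flats))"
      proof safe
        fix F assume "F \<in> \<K>"
        thus "flat_var F \<in> rmod.span (?A \<union> mpoly_var ` (- nonempty_flats))"
          using flat_var_eq[of F] K by (intro rmod.span_base) auto
      qed
    qed simp
    hence "p \<in> genideal (mpoly_ring nonempty_flats) ?A"
      using p(3) genideal_iff_span[OF A p(2)] by blast
    thus "a \<in> Idl\<^bsub>chow_ring\<^esub> (proj ` mpoly_var ` \<K>)"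
      using min p(1) by blast
  qed
qed

text \<open>By uniqueness of decompositions the component of degree zero is the image of the
  constant term, which vanishes only if the constant does.\<close>

lemma irrelevant_ideal_image:
  "irrelevant_ideal chow_ring chow_grading = ideal_image nonempty_flats"
proof -
  have "proj p \<in> irrelevant_ideal chow_ring chow_grading \<longleftrightarrow> proj p \<in> ideal_image nonempty_flats"
    if p: "p \<in> poly_carrier" for p
  proof -
    have "proj p \<in> irrelevant_ideal chow_ring chow_grading \<longleftrightarrow> proj (homogeneous_part 0 p) = \<zero>\<^bsub>chow_ring\<^esub>"
      unfolding irrelevant_ideal_def
    proof
      assume "proj p \<in> {x \<in> carrier chow_ring. \<exists>f. homogeneous_decomposition chow_ring chow_grading x f \<and> f 0 = \<zero>\<^bsub>chow_ring\<^esub>}"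
      then obtain f where f: "homogeneous_decomposition chow_ring chow_grading (proj p) f" "f 0 = \<zero>\<^bsub>chow_ring\<^esub>"
        by blast
      show "proj (homogeneous_part 0 p) = \<zero>\<^bsub>chow_ring\<^esub>"
        using decomposition_unique[OF p f(1), of 0] f(2) by simp
    next
      assume "proj (homogeneous_part 0 p) = \<zero>\<^bsub>chow_ring\<^esub>"
      thus "proj p \<in> {x \<in> carrier chow_ring. \<exists>f. homogeneous_decomposition chow_ring chow_grading x f \<and> f 0 = \<zero>\<^bsub>chow_ring\<^esub>}"
        using proj_closed[OF p] proj_decomposition[OF p] by blast
    qed
    also have "\<dots> \<longleftrightarrow> Poly_Mapping.lookup p 0 = 0"
      unfolding homogeneous_part_0_const by (rule proj_const_eq_zero)
    also have "\<dots> \<longleftrightarrow> p \<in> chow.J nonempty_flats"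
      using irrelevantI irrelevant_lookup_0 by blast
    finally show ?thesis
      using mem_ideal_image[OF p] by blast
  qed
  moreover have "irrelevant_ideal chow_ring chow_grading \<subseteq> proj ` poly_carrier"
    unfolding irrelevant_ideal_def carrier_chow_ring by blast
  moreover have "ideal_image nonempty_flats \<subseteq> proj ` poly_carrier"
    unfolding ideal_image_def by blast
  ultimately show ?thesis
    by blast
qed

text \<open>Modulo the smaller ideal everything is a multiple of \<open>flat_var G\<close>, so
  cyclicity follows and the colon need only be tested on this element. The multiplier may be taken
  from the carrier, because its terms with foreign variables lie in the ideal of relations.\<close>

lemma ideal_image_step:
  assumes G: "G \<in> nonempty_flats" and new: "flat_var G \<notin> chow.J \<K>'"
    and K'': "\<And>r. r * flat_var G \<in> chow.J \<K>' \<longleftrightarrow> r \<in> chow.J \<K>''"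
  shows "ideal_image \<K>' \<subset> ideal_image (insert G \<K>')"
    "cyclic_quotient chow_ring (ideal_image (insert G \<K>')) (ideal_image \<K>')"
    "colon_ideal chow_ring (ideal_image \<K>') (ideal_image (insert G \<K>')) = ideal_image \<K>''"
proof -
  interpret cring chow_ring
    by (rule cring_chow_ring)
  let ?I = "ideal_image (insert G \<K>')" and ?J = "ideal_image \<K>'" and ?g = "flat_var G"
  have gc: "?g \<in> poly_carrier"
    by (rule flat_var_carrier[OF G])
  have gI: "proj ?g \<in> ?I"
    unfolding mem_ideal_image[OF gc] by (rule chow.x_in_J) simp
  have gJ: "proj ?g \<notin> ?J"
    unfolding mem_ideal_image[OF gc] by (rule new)
  have "?J \<subseteq> ?I"
    unfolding ideal_image_def using chow.J_mono[OF subset_insertI] by blast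
  thus "?J \<subset> ?I"
    using gI gJ by blast
  have decomp: "\<exists>k. k \<in> poly_carrier \<and> p - k * ?g \<in> chow.J \<K>'" if p: "p \<in> chow.J (insert G \<K>')" for p
  proof -
    have "p \<in> rmod.span (insert ?g (full_chow_ideal \<union> flat_var ` \<K>'))"
      using p unfolding chow.J_def by (simp add: insert_commute)
    then obtain k where k: "p - k * ?g \<in> chow.J \<K>'"
      unfolding rmod.span_insert chow.J_def by blast
    obtain q n where qn: "k = q + n" "q \<in> poly_carrier" "n \<in> rmod.span (mpoly_var ` (- nonempty_flats))"
      by (rule split_poly[of k nonempty_flats])
    have "n \<in> full_chow_ideal"
      using qn(3) rmod.span_mono[of "mpoly_var ` (- nonempty_flats)" "chow_generators \<union> mpoly_var ` (- nonempty_flats)"]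
      unfolding full_chow_ideal_def by blast
    hence "n * ?g \<in> chow.J \<K>'"
      using chow.N_subset_J chow.J_closed(4) by blast
    from chow.J_closed(2)[OF k this] have "p - q * ?g \<in> chow.J \<K>'"
      unfolding qn(1) by (simp add: algebra_simps)
    thus ?thesis
      using qn(2) by blast
  qed
  show "cyclic_quotient chow_ring ?I ?J"
    unfolding cyclic_quotient_def
  proof (intro bexI[OF _ gI] ballI)
    fix x assume "x \<in> ?I"
    then obtain p where p: "x = proj p" "p \<in> poly_carrier" "p \<in> chow.J (insert G \<K>')"
      unfolding ideal_image_def by blast
    obtain k where k: "k \<in> poly_carrier" "p - k * ?g \<in> chow.J \<K>'"
      using decomp[OF p(3)] by blast
    have kg: "k * ?g \<in> poly_carrier"
      by (rule mpoly_carrier_mult[OF k(1) gc])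
    have "proj p \<ominus>\<^bsub>chow_ring\<^esub> proj (k * ?g) \<in> ?J"
      unfolding proj_minus[OF p(2) kg] mem_ideal_image[OF mpoly_carrier_diff[OF p(2) kg]] by (rule k(2))
    hence "?J +>\<^bsub>chow_ring\<^esub> proj p = ?J +>\<^bsub>chow_ring\<^esub> proj (k * ?g)"
      using quotient_eq_iff_same_a_r_cos[OF ideal_ideal_image proj_closed[OF p(2)] proj_closed[OF kg]] by blast
    thus "\<exists>r\<in>carrier chow_ring. ?J +>\<^bsub>chow_ring\<^esub> x = ?J +>\<^bsub>chow_ring\<^esub> (r \<otimes>\<^bsub>chow_ring\<^esub> proj ?g)"
      unfolding p(1) using proj_mult[OF k(1) gc] proj_closed[OF k(1)]
      by (intro bexI[of _ "proj k"]) simp_all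
  qed
  have "proj q \<in> colon_ideal chow_ring ?J ?I \<longleftrightarrow> q \<in> chow.J \<K>''" if q: "q \<in> poly_carrier" for q
  proof
    assume "proj q \<in> colon_ideal chow_ring ?J ?I"
    hence "proj q \<otimes>\<^bsub>chow_ring\<^esub> proj ?g \<in> ?J"
      unfolding colon_ideal_def using gI by blast
    hence "q * ?g \<in> chow.J \<K>'"
      unfolding proj_mult[OF q gc] mem_ideal_image[OF mpoly_carrier_mult[OF q gc]] .
    thus "q \<in> chow.J \<K>''"
      unfolding K'' .
  next
    assume "q \<in> chow.J \<K>''"
    hence qg: "q * ?g \<in> chow.J \<K>'"
      unfolding K'' .
    have "proj q \<otimes>\<^bsub>chow_ring\<^esub> x \<in> ?J" if x: "x \<in> ?I" for x
    proof -
      obtain p where p: "x = proj p" "p \<in> poly_carrier" "p \<in> chow.J (insert G \<K>')"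
        using x unfolding ideal_image_def by blast
      obtain k where k: "p - k * ?g \<in> chow.J \<K>'"
        using decomp[OF p(3)] by blast
      have "q * (p - k * ?g) + k * (q * ?g) \<in> chow.J \<K>'"
        by (rule chow.J_closed(2)[OF chow.J_closed(3)[OF k] chow.J_closed(3)[OF qg]])
      hence "q * p \<in> chow.J \<K>'"
        by (simp add: algebra_simps)
      thus ?thesis
        unfolding p(1) proj_mult[OF q p(2)] mem_ideal_image[OF mpoly_carrier_mult[OF q p(2)]] .
    qed
    thus "proj q \<in> colon_ideal chow_ring ?J ?I"
      unfolding colon_ideal_def using proj_closed[OF q] by blast
  qed
  moreover have "colon_ideal chow_ring ?J ?I \<subseteq> proj ` poly_carrier"
    unfolding colon_ideal_def carrier_chow_ring by blast
  ultimately show "colon_ideal chow_ring ?J ?I = ideal_image \<K>''"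
    unfolding ideal_image_def by blast
qed

theorem koszul_filtration_chow_ring:
  "koszul_filtration chow_ring chow_grading (ideal_image ` {\<K>. chow.filtration_flats \<K>})"
proof (intro koszul_filtration.intro standard_graded_chow_ring koszul_filtration_axioms.intro)
  let ?F = "ideal_image ` {\<K>. chow.filtration_flats \<K>}"
  have zero: "ideal_image {} = {\<zero>\<^bsub>chow_ring\<^esub>}"
  proof -
    have "proj p = \<zero>\<^bsub>chow_ring\<^esub>" if "p \<in> poly_carrier \<inter> full_chow_ideal" for p
      using proj_eq_zero_iff[of p] that by blast
    moreover have "0 \<in> poly_carrier \<inter> full_chow_ideal"
      using poly_carrier_0 chow.N_closed(1) by blast
    ultimately show ?thesis
      unfolding ideal_image_def chow.J_empty by blast
  qed
  show "{\<zero>\<^bsub>chow_ring\<^esub>} \<in> ?F"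
    unfolding zero[symmetric] using chow.filtration_flats.empty by blast
  show "irrelevant_ideal chow_ring chow_grading \<in> ?F"
  proof -
    obtain \<K> where "chow.filtration_flats \<K>" "chow.J \<K> = chow.J nonempty_flats"
      using chow.filtration_flats_irrelevant unfolding nonempty_flats_eq by blast
    thus ?thesis
      unfolding irrelevant_ideal_image ideal_image_def by blast
  qed
  fix I assume "I \<in> ?F"
  then obtain \<K> where K: "I = ideal_image \<K>" "chow.filtration_flats \<K>"
    by blast
  hence sub: "\<K> \<subseteq> nonempty_flats"
    using chow.filtration_flats_subset nonempty_flats_eq by blast
  have "proj ` mpoly_var ` \<K> \<subseteq> chow_grading 1"
    by (rule proj_var_grading[OF sub])
  thus "\<exists>L\<subseteq>chow_grading 1. I = Idl\<^bsub>chow_ring\<^esub> L"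
    unfolding K(1) ideal_image_generated[OF sub] by blast
  assume "I \<noteq> {\<zero>\<^bsub>chow_ring\<^esub>}"
  hence "chow.J \<K> \<noteq> full_chow_ideal"
    using K(1) zero unfolding ideal_image_def chow.J_empty by metis
  \<comment> \<open>Different sets of flats may give the same ideal, so the last step is recovered
    for the ideal \<open>chow.J \<K>\<close> and not for the set \<open>\<K>\<close>.\<close>
  from chow.filtration_flats_step[OF K(2) this] obtain \<K>' G \<K>'' where
    step: "chow.filtration_flats \<K>'" "G \<in> {F. flat F}" "G \<noteq> {}" "chow.J \<K> = chow.J (insert G \<K>')"
      "flat_var G \<notin> chow.J \<K>'" "chow.filtration_flats \<K>''"
      "\<And>r. r * flat_var G \<in> chow.J \<K>' \<longleftrightarrow> r \<in> chow.J \<K>''"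
    by metis
  have "G \<in> nonempty_flats"
    using step(2,3) by (simp add: nonempty_flats_def)
  note image_step = ideal_image_step[OF this step(5,7)]
  have "I = ideal_image (insert G \<K>')"
    unfolding K(1) ideal_image_def step(4) ..
  thus "\<exists>J\<in>?F. J \<subset> I \<and> cyclic_quotient chow_ring I J \<and> colon_ideal chow_ring J I \<in> ?F"
    using image_step step(1,6) by blast
qed

end

theorem theorem4p12:
  fixes E :: "'a set" and indep :: "'a set \<Rightarrow> bool"
  assumes "simple_matroid E indep"
  shows "\<exists>\<F>. koszul_filtration (matroid.chow_ring E indep) (matroid.chow_grading E indep) \<F>"
  using simple_matroid.koszul_filtration_chow_ring[OF assms] by blast

end
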